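(* Consider the combined heat and power network (described in the context) operating either under Mode 1 or under Mode 2, with constant loads $p^L, h^L$. Let $x^*=(\eta^*,\omega^*,p^{G*},T^*,h^{G*})$ be an equilibrium point of this system with $|\eta^*_{ij}|<\frac{\pi}{2}$ for all $(i,j)\in E_e$. Then there exists an open neighborhood of this equilibrium point such that all solutions of the system starting in this neighborhood converge to an equilibrium point. (The assertion is made for each of the two modes separately.)
   Context: **Electric network.** $(N_e,E_e)$ is a finite connected directed graph; $N_e$ is the set of buses, $E_e\subseteq N_e\times N_e$ the set of transmission lines. $N_e^G\subseteq N_e$ is the set of generator buses, $H_e\subseteq N_e$ the set of buses to which heat pumps are connected. For each bus $j\in N_e$, $$M_j\dot\omega_j=-p^L_j-p^P_j+p^G_j-p^U_j+\sum_{i:\,i\to j}p_{ij}-\sum_{k:\,j\to k}p_{jk},$$ and for each line $(i,j)\in E_e$, $\dot\eta_{ij}=\omega_i-\omega_j$, $p_{ij}=B_{ij}\sin(\eta_{ij})$ with $B_{ij}>0$. Here $\omega_j$ is the frequency deviation at bus $j$, $\eta_{ij}$ the angle difference between buses $i$ and $j$, $p^U_j=D_j\omega_j$ with $D_j>0$, $p^L_j$ is a constant load, $p^P_j$ is the heat pump consumption ($p^P_j=0$ if $j\notin H_e$), $p^G_j$ is the generation. If $j\in N_e^G$ then $M_j>0$; if $j$ is a load bus, $M_j=0$ and $p^G_j=0$, so that the equation at $j$ is an algebraic constraint (solutions are understood to satisfy these constraints). **Heating network.** $(N_h,E_h)$ is a finite directed graph with nodes $N_h$ and edges $E_h$; $H_h\subseteq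 E_h$ are the edges carrying heat pumps, $E_h^G\subseteq E_h$ those carrying conventional heat sources, $E_h^L\subseteq E_h$ those carrying heat loads. With $T=\mathrm{col}(T^E,T^N)$ the vector of edge and node temperature deviations, $$V\dot T=-A_hT+\begin{bmatrix}h^G+h^P-h^L\\ \mathbf 0\end{bmatrix},\qquad A_h=\begin{bmatrix}\mathrm{diag}(q^E)&-\mathrm{diag}(q^E)B_{sh}^T\\-B_{th}\mathrm{diag}(q^E)&\mathrm{diag}(B_{th}q^E)\end{bmatrix},$$ where $V=\mathrm{diag}(\{V^E_j\},\{V^N_k\})$ has positive volumes on the diagonal, $q^E$ is a given constant vector of edge mass flows, $B_h$ is the incidence matrix ($B_{h,ij}=1$ if the flow through edge $j$ enters node $i$, $-1$ if it originates from node $i$, $0$ otherwise), $B_{th}=\frac12(|B_h|+B_h)$, $B_{sh}=\frac12(|B_h|-B_h)$ (entrywise absolute value). $h^P,h^G,h^L\in\mathbb R^{E_h}$ are supported on $H_h$, $E_h^G$, $E_h^L$ respectively, and $h^L$ is constant. The matrix $A_h$ satisfies: $A_h+A_h^T$ is positive semidefinite with a simple eigenvalue at $0$, $A_h\mathbf 1=0$, $\mathbf 1^TA_h=0$. The average temperature is $\bar T=\frac{\mathbf 1^TVT}{\mathcal V}$ with $\mathcal V=\mathbf 1^TV\mathbf 1$. **Generation control.** With positive constants $\tau_{e,j},\tilde Q_{e,jj},\tau_{h,j},\tilde Q_{h,jj}$: $$\tau_{e,j}\dot p^G_j=-p^G_j-\tilde Q_{e,jj}\omega_j,\ j\in N_e^G;\qquad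 \tau_{h,j}\dot h^G_j=-h^G_j-\tilde Q_{h,jj}\bar T,\ j\in E_h^G.$$ **Heat pumps.** Each $j\in H_e$ is associated with an edge $k_j\in H_h$ (a one-to-one correspondence), and $h^P_{k_j}=C_{o,j}p^P_j$ with constant $C_{o,j}>0$. *Mode 1:* $p^P_j=a_{1,j}\omega_j$ for $j\in H_e$, with constants $a_{1,j}>0$. *Mode 2:* the heating network is connected to the power network through a single heat pump bus, $H_e=\{j\}$, which is a separate bus with zero inertia, no load, no generation and no damping term. At this bus the swing equation is replaced by $$0=-p^P_j+\sum_{i:\,i\to j}p_{ij}-\sum_{k:\,j\to k}p_{jk},\qquad \omega_j=m_j\bar T,$$ with constant $m_j>0$ (so $p^P_j$ is determined by the power transfers from neighbouring buses). All other buses satisfy the swing equation above with $p^P=0$ and $D>0$. **Equilibrium.** An equilibrium point is a point $(\eta,\omega,p^G,T,h^G)$ at which all these variables are constant in time; at an equilibrium all bus frequencies equal a common value, also denoted $\omega^*$. *)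

theory Defs
  imports "HOL-Analysis.Analysis" "HOL-Computational_Algebra.Polynomial"
begin

section \<open>Matrices\<close>

definition diag_mat :: "real ^ 'a \<Rightarrow> real ^ 'a ^ 'a" where
  "diag_mat v = (\<chi> i j. if i = j then v $ i else 0)"

definition pos_semidef :: "real ^ 'a ^ 'a \<Rightarrow> bool" where
  "pos_semidef S \<longleftrightarrow> transpose S = S \<and> (\<forall>x. 0 \<le> x \<bullet> (S *v x))"

definition charpoly :: "real ^ 'a ^ 'a \<Rightarrow> real poly" where
  "charpoly S = det (\<chi> i j. (if i = j then [:0, 1:] else 0) - [:S $ i $ j:])"

text \<open>Simplicity is algebraic multiplicity one.\<close>

definition simple_eigenvalue :: "real ^ 'a ^ 'a \<Rightarrow> real \<Rightarrow> bool" where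
  "simple_eigenvalue S c \<longleftrightarrow> order c (charpoly S) = 1"


section \<open>Network data\<close>

text \<open>
  The buses are the elements of \<open>'n\<close>, and the transmission lines form a subset of \<open>'n \<times> 'n\<close>.
  The edges and nodes of the heating network are the elements of \<open>'e\<close> and \<open>'v\<close>. Temperatures and
  volumes are indexed by \<open>'e + 'v\<close>, edges first. All constants attached to an index set
  (such as \<open>tau_e\<close> for generator buses) are only meaningful on that set.
\<close>

record ('n, 'e, 'v) chp_network =
  lines      :: "('n \<times> 'n) set"      \<comment> \<open>\<open>E_e\<close>\<close>
  gens       :: "'n set"              \<comment> \<open>\<open>N_e^G\<close>\<close>
  pump_buses :: "'n set"              \<comment> \<open>\<open>H_e\<close>\<close>
  inertia    :: "'n \<Rightarrow> real"          \<comment> \<open>\<open>M_j\<close>\<close>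
  damping    :: "'n \<Rightarrow> real"          \<comment> \<open>\<open>D_j\<close>\<close>
  load       :: "'n \<Rightarrow> real"          \<comment> \<open>\<open>p^L_j\<close>\<close>
  suscept    :: "'n \<times> 'n \<Rightarrow> real"     \<comment> \<open>\<open>B_ij\<close>\<close>
  tau_e      :: "'n \<Rightarrow> real"
  Q_e        :: "'n \<Rightarrow> real"
  hsrc       :: "'e \<Rightarrow> 'v"            \<comment> \<open>node from which the flow through an edge originates\<close>
  htgt       :: "'e \<Rightarrow> 'v"            \<comment> \<open>node which the flow through an edge enters\<close>
  pump_edges :: "'e set"              \<comment> \<open>\<open>H_h\<close>\<close>
  hgens      :: "'e set"              \<comment> \<open>\<open>E_h^G\<close>\<close>
  hloads     :: "'e set"              \<comment> \<open>\<open>E_h^L\<close>\<close>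
  volume     :: "(real, 'e + 'v) vec" \<comment> \<open>diagonal of \<open>V\<close>\<close>
  flow       :: "(real, 'e) vec"      \<comment> \<open>\<open>q^E\<close>\<close>
  hload      :: "(real, 'e) vec"      \<comment> \<open>\<open>h^L\<close>\<close>
  tau_h      :: "'e \<Rightarrow> real"
  Q_h        :: "'e \<Rightarrow> real"
  pump_edge  :: "'n \<Rightarrow> 'e"            \<comment> \<open>\<open>k_j\<close>\<close>
  pump_coeff :: "'n \<Rightarrow> real"          \<comment> \<open>\<open>C_{o,j}\<close>\<close>

definition h_incidence :: "('n, 'e::finite, 'v::finite) chp_network \<Rightarrow> real ^ 'e ^ 'v" where
  "h_incidence P = (\<chi> i j. if htgt P j = i then 1 else if hsrc P j = i then - 1 else 0)"

definition B_th :: "('n, 'e::finite, 'v::finite) chp_network \<Rightarrow> real ^ 'e ^ 'v" where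
  "B_th P = (\<chi> i j. (\<bar>h_incidence P $ i $ j\<bar> + h_incidence P $ i $ j) / 2)"

definition B_sh :: "('n, 'e::finite, 'v::finite) chp_network \<Rightarrow> real ^ 'e ^ 'v" where
  "B_sh P = (\<chi> i j. (\<bar>h_incidence P $ i $ j\<bar> - h_incidence P $ i $ j) / 2)"

definition A_h :: "('n, 'e::finite, 'v::finite) chp_network \<Rightarrow> real ^ ('e + 'v) ^ ('e + 'v)" where
  "A_h P = (\<chi> i j. case i of
      Inl e \<Rightarrow> (case j of
          Inl e' \<Rightarrow> diag_mat (flow P) $ e $ e'
        | Inr v' \<Rightarrow> - (diag_mat (flow P) ** transpose (B_sh P)) $ e $ v')
    | Inr v \<Rightarrow> (case j of
          Inl e' \<Rightarrow> - (B_th P ** diag_mat (flow P)) $ v $ e'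
        | Inr v' \<Rightarrow> diag_mat (B_th P *v flow P) $ v $ v'))"

text \<open>
  Standing assumptions common to both modes. Connectedness of the directed graph of lines is
  understood in the weak sense, i.e. ignoring orientations.
\<close>

definition valid_network :: "('n::finite, 'e::finite, 'v::finite) chp_network \<Rightarrow> bool" where
  "valid_network P \<longleftrightarrow>
     (\<forall>i j. (i, j) \<in> (lines P \<union> (lines P)\<inverse>)\<^sup>*) \<and>
     (\<forall>l\<in>lines P. suscept P l > 0) \<and>
     (\<forall>j\<in>gens P. inertia P j > 0 \<and> tau_e P j > 0 \<and> Q_e P j > 0) \<and>
     (\<forall>j. j \<notin> gens P \<longrightarrow> inertia P j = 0) \<and>
     (\<forall>i. volume P $ i > 0) \<and>
     pos_semidef (A_h P + transpose (A_h P)) \<and>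
     simple_eigenvalue (A_h P + transpose (A_h P)) 0 \<and>
     A_h P *v 1 = 0 \<and> 1 v* A_h P = 0 \<and>
     (\<forall>e. e \<notin> hloads P \<longrightarrow> hload P $ e = 0) \<and>
     (\<forall>e\<in>hgens P. tau_h P e > 0 \<and> Q_h P e > 0) \<and>
     bij_betw (pump_edge P) (pump_buses P) (pump_edges P) \<and>
     (\<forall>j\<in>pump_buses P. pump_coeff P j > 0)"


section \<open>Modes of operation\<close>

text \<open>
  \<open>Mode1 a\<close> carries the gains \<open>a_{1,j}\<close>; \<open>Mode2 b m\<close> carries the single heat pump bus \<open>b\<close> and
  its constant \<open>m_b\<close>.
\<close>

datatype 'n pump_mode = Mode1 "'n \<Rightarrow> real" | Mode2 'n real

fun valid_mode :: "('n, 'e, 'v) chp_network \<Rightarrow> 'n pump_mode \<Rightarrow> bool" where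
  "valid_mode P (Mode1 a) \<longleftrightarrow>
     (\<forall>j. damping P j > 0) \<and> (\<forall>j\<in>pump_buses P. a j > 0)"
| "valid_mode P (Mode2 b m) \<longleftrightarrow>
     pump_buses P = {b} \<and> b \<notin> gens P \<and> load P b = 0 \<and> damping P b = 0 \<and>
     (\<forall>j. j \<noteq> b \<longrightarrow> damping P j > 0) \<and> m > 0"


section \<open>Dynamics\<close>

text \<open>The state is \<open>(\<eta>, \<omega>, p\<^sup>G, T, h\<^sup>G)\<close>.\<close>

type_synonym ('n, 'e, 'v) chp_state =
  "(real, 'n \<times> 'n) vec \<times> (real, 'n) vec \<times> (real, 'n) vec \<times> (real, 'e + 'v) vec \<times> (real, 'e) vec"

definition angle :: "('n, 'e, 'v) chp_state \<Rightarrow> (real, 'n \<times> 'n) vec" where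
  "angle = (\<lambda>(\<eta>, \<omega>, pG, T, hG). \<eta>)"

definition freq :: "('n, 'e, 'v) chp_state \<Rightarrow> (real, 'n) vec" where
  "freq = (\<lambda>(\<eta>, \<omega>, pG, T, hG). \<omega>)"

definition pgen :: "('n, 'e, 'v) chp_state \<Rightarrow> (real, 'n) vec" where
  "pgen = (\<lambda>(\<eta>, \<omega>, pG, T, hG). pG)"

definition temp :: "('n, 'e, 'v) chp_state \<Rightarrow> (real, 'e + 'v) vec" where
  "temp = (\<lambda>(\<eta>, \<omega>, pG, T, hG). T)"

definition hgen :: "('n, 'e, 'v) chp_state \<Rightarrow> (real, 'e) vec" where
  "hgen = (\<lambda>(\<eta>, \<omega>, pG, T, hG). hG)"

text \<open>
  Lines, generators and heat sources are subsets of the index types, so the components of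
  \<open>\<eta>\<close>, \<open>p\<^sup>G\<close> and \<open>h\<^sup>G\<close> off these sets are fixed to zero.
\<close>

definition state_space ::
    "('n::finite, 'e::finite, 'v::finite) chp_network \<Rightarrow> ('n, 'e, 'v) chp_state set" where
  "state_space P = {x. (\<forall>l. l \<notin> lines P \<longrightarrow> angle x $ l = 0) \<and>
                       (\<forall>j. j \<notin> gens P \<longrightarrow> pgen x $ j = 0) \<and>
                       (\<forall>e. e \<notin> hgens P \<longrightarrow> hgen x $ e = 0)}"

definition transfer ::
    "('n::finite, 'e::finite, 'v::finite) chp_network \<Rightarrow> ('n, 'e, 'v) chp_state \<Rightarrow> 'n \<times> 'n \<Rightarrow> real" where
  "transfer P x l = suscept P l * sin (angle x $ l)"

definition net_inflow ::
    "('n::finite, 'e::finite, 'v::finite) chp_network \<Rightarrow> ('n, 'e, 'v) chp_state \<Rightarrow> 'n \<Rightarrow> real" where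
  "net_inflow P x j = (\<Sum>i | (i, j) \<in> lines P. transfer P x (i, j))
                    - (\<Sum>k | (j, k) \<in> lines P. transfer P x (j, k))"

definition avg_temp ::
    "('n::finite, 'e::finite, 'v::finite) chp_network \<Rightarrow> ('n, 'e, 'v) chp_state \<Rightarrow> real" where
  "avg_temp P x = (1 \<bullet> (diag_mat (volume P) *v temp x)) / (1 \<bullet> (diag_mat (volume P) *v 1))"

text \<open>
  Heat pump consumption \<open>p\<^sup>P\<close>. In Mode 2 the power balance
  \<open>0 = - p\<^sup>P + net_inflow\<close> at the heat pump bus determines it.
\<close>

fun pump_power :: "('n::finite, 'e::finite, 'v::finite) chp_network \<Rightarrow> 'n pump_mode \<Rightarrow>
    ('n, 'e, 'v) chp_state \<Rightarrow> 'n \<Rightarrow> real" where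
  "pump_power P (Mode1 a) x j = (if j \<in> pump_buses P then a j * freq x $ j else 0)"
| "pump_power P (Mode2 b m) x j = (if j = b then net_inflow P x j else 0)"

text \<open>The sum has at most one term, as \<open>pump_edge\<close> is injective on \<open>pump_buses\<close>.\<close>

definition pump_heat :: "('n::finite, 'e::finite, 'v::finite) chp_network \<Rightarrow> 'n pump_mode \<Rightarrow>
    ('n, 'e, 'v) chp_state \<Rightarrow> real ^ 'e" where
  "pump_heat P \<mu> x =
     (\<chi> e. \<Sum>j | j \<in> pump_buses P \<and> pump_edge P j = e. pump_coeff P j * pump_power P \<mu> x j)"

definition heat_input :: "('n::finite, 'e::finite, 'v::finite) chp_network \<Rightarrow> 'n pump_mode \<Rightarrow>
    ('n, 'e, 'v) chp_state \<Rightarrow> real ^ ('e + 'v)" where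
  "heat_input P \<mu> x = (\<chi> i. case i of
      Inl e \<Rightarrow> hgen x $ e + pump_heat P \<mu> x $ e - hload P $ e
    | Inr v \<Rightarrow> 0)"

definition swing_rhs :: "('n::finite, 'e::finite, 'v::finite) chp_network \<Rightarrow> 'n pump_mode \<Rightarrow>
    ('n, 'e, 'v) chp_state \<Rightarrow> 'n \<Rightarrow> real" where
  "swing_rhs P \<mu> x j = - load P j - pump_power P \<mu> x j + pgen x $ j
                       - damping P j * freq x $ j + net_inflow P x j"

text \<open>
  The swing equation in descriptor form \<open>d/dt (M_j \<omega>_j) = \<dots>\<close>. Where \<open>M_j = 0\<close> it says that the
  right-hand side vanishes, without requiring \<open>\<omega>_j\<close> to be differentiable. The constants
  \<open>\<tau>\<close> and \<open>V\<close> are treated likewise below.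
\<close>

definition swing_eq :: "('n::finite, 'e::finite, 'v::finite) chp_network \<Rightarrow> 'n pump_mode \<Rightarrow>
    (real \<Rightarrow> ('n, 'e, 'v) chp_state) \<Rightarrow> real \<Rightarrow> 'n \<Rightarrow> bool" where
  "swing_eq P \<mu> x t j \<longleftrightarrow>
     ((\<lambda>s. inertia P j * freq (x s) $ j) has_real_derivative swing_rhs P \<mu> (x t) j)
       (at t within {0..})"

fun bus_eq :: "('n::finite, 'e::finite, 'v::finite) chp_network \<Rightarrow> 'n pump_mode \<Rightarrow>
    (real \<Rightarrow> ('n, 'e, 'v) chp_state) \<Rightarrow> real \<Rightarrow> 'n \<Rightarrow> bool" where
  "bus_eq P (Mode1 a) x t j \<longleftrightarrow> swing_eq P (Mode1 a) x t j"
| "bus_eq P (Mode2 b m) x t j \<longleftrightarrow>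
     (if j = b then freq (x t) $ b = m * avg_temp P (x t) else swing_eq P (Mode2 b m) x t j)"

definition is_solution :: "('n::finite, 'e::finite, 'v::finite) chp_network \<Rightarrow> 'n pump_mode \<Rightarrow>
    (real \<Rightarrow> ('n, 'e, 'v) chp_state) \<Rightarrow> bool" where
  "is_solution P \<mu> x \<longleftrightarrow> (\<forall>t\<ge>0.
     x t \<in> state_space P \<and>
     (\<forall>(i, j)\<in>lines P. ((\<lambda>s. angle (x s) $ (i, j)) has_real_derivative
        freq (x t) $ i - freq (x t) $ j) (at t within {0..})) \<and>
     (\<forall>j. bus_eq P \<mu> x t j) \<and>
     (\<forall>j\<in>gens P. ((\<lambda>s. tau_e P j * pgen (x s) $ j) has_real_derivative
        - pgen (x t) $ j - Q_e P j * freq (x t) $ j) (at t within {0..})) \<and>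
     ((\<lambda>s. diag_mat (volume P) *v temp (x s)) has_vector_derivative
        - (A_h P *v temp (x t)) + heat_input P \<mu> (x t)) (at t within {0..}) \<and>
     (\<forall>e\<in>hgens P. ((\<lambda>s. tau_h P e * hgen (x s) $ e) has_real_derivative
        - hgen (x t) $ e - Q_h P e * avg_temp P (x t)) (at t within {0..})))"

definition is_equilibrium :: "('n::finite, 'e::finite, 'v::finite) chp_network \<Rightarrow> 'n pump_mode \<Rightarrow>
    ('n, 'e, 'v) chp_state \<Rightarrow> bool" where
  "is_equilibrium P \<mu> x \<longleftrightarrow> is_solution P \<mu> (\<lambda>_. x)"

end

theory Submission
  imports Defs
begin

text \<open>
  In both modes the electric part is a network of swing equations \<open>M \<omega>' = - d \<omega> + p + inflow\<close> (written for
  deviations from the equilibrium) in which at most one bus, the heat pump bus of Mode 2, is undamped.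
  The energy, with the potential \<open>B (1 - cos)\<close> of the lines recentred at the equilibrium, decreases along
  every solution, and it is coercive where the angles stay below \<open>pi / 2\<close>; so a solution starting
  with small energy is trapped. Barbalat's lemma takes the place of LaSalle's principle: the
  dissipation tends to 0, hence so do the damped frequencies and the generation, then the power
  imbalances, and finally the frequency of the undamped bus, which would otherwise move the angles at
  its neighbours. Hence limit points of the angles are equilibria, in general other than the given one,
  and the energy recentred at such a limit point shows that the angles converge to it.

  The temperatures relax to a constant plus the equilibrium profile because the quadratic form of
  \<open>A_h\<close> is coercive on profiles of weighted mean zero. What remains is the average temperature. In Mode 2 it
  is proportional to the frequency of the heat pump bus. In Mode 1 it is driven by the frequencies: if
  there are heat sources they stabilise it, and otherwise it is an integral of a combination of the
  frequencies, which converges because it is a combination of convergent state variables.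
\<close>

section \<open>Asymptotics on the half-line\<close>

text \<open>No semiflow is at hand: at a bus without inertia the frequency is fixed only by an
  algebraic constraint and is not assumed differentiable, and a solution is just a function
  satisfying the equations. Everything is therefore argued along one given solution. Barbalat's
  lemma suits this setting, since it asks for Lipschitz derivatives along the solution and not for
  invariant limit sets.

  Convergence to the given equilibrium itself cannot be expected. The angles are independent
  coordinates, one per line, whose signed sums around cycles of the graph are conserved, so nearby
  equilibria may form families. In Mode 1 without heat sources a constant can be added to all
  temperatures as well. In Mode 2, if the network consists of the pump bus alone and has no heat
  sources, the frequency of that bus is conserved; this is why \<open>converges\<close> allows a
  nonzero limit \<open>w\<close> of a frequency deviation in one exceptional case.\<close>

lemma vector_deriv_const_halfline_iff:
  fixes k D :: "'a::real_normed_vector"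
  assumes "0 \<le> t"
  shows "((\<lambda>s. k) has_vector_derivative D) (at t within {0..}) \<longleftrightarrow> D = 0"
proof
  assume D: "((\<lambda>s. k) has_vector_derivative D) (at t within {0..})"
  have "at_right t \<le> at t within {0..}" using assms by (intro at_le) auto
  then have "at t within {0..} \<noteq> bot" using trivial_limit_at_right_real[of t] by (metis bot.extremum_unique)
  then show "D = 0" using D vector_derivative_unique_within[of t "{0..}" "\<lambda>s. k" D 0] by simp
qed simp

text \<open>This extracts the algebraic equations hidden in the descriptor form: at a bus without
  inertia the differentiated product is constantly 0, and at an equilibrium everything is constant.
  One-sided derivatives are unique also at \<open>t = 0\<close>.\<close>

lemma deriv_const_halfline_iff:
  fixes k D t :: real
  assumes "0 \<le> t"
  shows "((\<lambda>s. k) has_real_derivative D) (at t within {0..}) \<longleftrightarrow> D = 0"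
  using vector_deriv_const_halfline_iff[OF assms]
  by (simp add: has_real_derivative_iff_has_vector_derivative)

lemma mvt_halfline:
  fixes f f' :: "real \<Rightarrow> real"
  assumes D: "\<And>t. 0 \<le> t \<Longrightarrow> (f has_real_derivative f' t) (at t within {0..})"
    and ab: "0 \<le> a" "a < b"
  obtains \<xi> where "a < \<xi>" "\<xi> < b" "f b - f a = (b - a) * f' \<xi>"
proof -
  have "\<exists>x\<in>{a<..<b}. f b - f a = (\<lambda>h. f' x * h) (b - a)"
  proof (rule mvt_simple[OF ab(2)])
    fix x assume x: "a \<le> x" "x \<le> b"
    then have "(f has_real_derivative f' x) (at x within {a..b})"
      using ab by (intro has_field_derivative_subset[OF D]) auto
    then show "(f has_derivative (\<lambda>h. f' x * h)) (at x within {a..b})"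
      by (simp add: has_field_derivative_def)
  qed
  then show ?thesis using that by (auto simp: mult.commute)
qed

lemma nonincreasing_halfline:
  fixes f f' :: "real \<Rightarrow> real"
  assumes D: "\<And>t. 0 \<le> t \<Longrightarrow> (f has_real_derivative f' t) (at t within {0..})"
    and neg: "\<And>t. t0 \<le> t \<Longrightarrow> f' t \<le> 0" and ab: "0 \<le> t0" "t0 \<le> a" "a \<le> b"
  shows "f b \<le> f a"
proof (cases "a = b")
  case False
  then have "a < b" "0 \<le> a" using ab by auto
  then obtain \<xi> where x: "a < \<xi>" "\<xi> < b" "f b - f a = (b - a) * f' \<xi>"
    using mvt_halfline[OF D] by metis
  then have "(b - a) * f' \<xi> \<le> 0" using neg[of \<xi>] ab by (simp add: mult_le_0_iff)
  then show ?thesis using x by simp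
qed simp

lemma constant_halfline:
  fixes f :: "real \<Rightarrow> real"
  assumes D: "\<And>t. 0 \<le> t \<Longrightarrow> (f has_real_derivative 0) (at t within {0..})" and t: "0 \<le> t"
  shows "f t = f 0"
proof (cases "t = 0")
  case False
  then show ?thesis using mvt_halfline[of f "\<lambda>_. 0" 0 t] D t by auto
qed simp

lemma nonincreasing_convergent:
  fixes f :: "real \<Rightarrow> real"
  assumes mono: "\<And>s t. 0 \<le> s \<Longrightarrow> s \<le> t \<Longrightarrow> f t \<le> f s" and low: "\<And>t. 0 \<le> t \<Longrightarrow> c \<le> f t"
  obtains l where "(f \<longlongrightarrow> l) at_top"
proof
  define l where "l = Inf (f ` {0..})"
  have bdd: "bdd_below (f ` {0..})" using low by (auto intro!: bdd_belowI[of _ c])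
  show "(f \<longlongrightarrow> l) at_top"
  proof (rule tendstoI)
    fix e :: real assume "0 < e"
    then obtain s where s: "0 \<le> s" "f s < l + e"
      using cInf_lessD[of "f ` {0..}" "l + e"] by (auto simp: l_def)
    have "dist (f t) l < e" if "s \<le> t" for t
    proof -
      have "l \<le> f t" unfolding l_def using that s by (intro cInf_lower bdd) auto
      moreover have "f t \<le> f s" using mono s that by simp
      ultimately show ?thesis using s by (simp add: dist_real_def)
    qed
    then show "\<forall>\<^sub>F t in at_top. dist (f t) l < e"
      by (auto simp: eventually_at_top_linorder)
  qed
qed

section \<open>Decay by comparison and Barbalat's lemma\<close>

lemma tendsto_0_if_square_le:
  fixes f Y :: "real \<Rightarrow> real"
  assumes le: "\<And>t. 0 \<le> t \<Longrightarrow> (f t)\<^sup>2 \<le> k * Y t" and Y: "(Y \<longlongrightarrow> 0) at_top"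
  shows "(f \<longlongrightarrow> 0) at_top"
proof -
  have "((\<lambda>t. (f t)\<^sup>2) \<longlongrightarrow> 0) at_top"
  proof (rule tendsto_sandwich[OF _ _ tendsto_const])
    show "\<forall>\<^sub>F t in at_top. (f t)\<^sup>2 \<le> k * Y t"
      using eventually_ge_at_top[of 0] by eventually_elim (rule le)
    show "((\<lambda>t. k * Y t) \<longlongrightarrow> 0) at_top" by (rule tendsto_mult_right_zero[OF Y])
  qed simp
  then show ?thesis by simp
qed

text \<open>Once \<open>w\<close> stays below \<open>c * (e/2)\<close>, the product of
  \<open>y - e/2\<close> with the integrating factor \<open>exp (c * t)\<close> no longer increases,
  so \<open>y\<close> exceeds \<open>e/2\<close> by at most a decaying exponential. As
  \<open>w\<close> comes without a rate, neither does the conclusion.\<close>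

lemma comparison_tendsto_0:
  fixes y y' w :: "real \<Rightarrow> real"
  assumes D: "\<And>t. 0 \<le> t \<Longrightarrow> (y has_real_derivative y' t) (at t within {0..})"
    and c: "0 < c" and le: "\<And>t. 0 \<le> t \<Longrightarrow> y' t \<le> - c * y t + w t"
    and nonneg: "\<And>t. 0 \<le> t \<Longrightarrow> 0 \<le> y t" and w: "(w \<longlongrightarrow> 0) at_top"
  shows "(y \<longlongrightarrow> 0) at_top"
proof (rule tendstoI)
  fix e :: real assume e: "0 < e"
  have "\<forall>\<^sub>F t in at_top. dist (w t) 0 < c * (e/2)"
    using tendstoD[OF w, of "c * (e/2)"] e c by simp
  then obtain t1 where t1: "\<And>t. t1 \<le> t \<Longrightarrow> dist (w t) 0 < c * (e/2)"
    by (auto simp: eventually_at_top_linorder)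
  define t0 where "t0 = max t1 0"
  have t0: "0 \<le> t0" "\<And>t. t0 \<le> t \<Longrightarrow> w t \<le> c * (e/2)"
    using t1 by (auto simp: t0_def dist_real_def abs_if split: if_splits) (smt (verit))+
  define z where "z = (\<lambda>t. (y t - e/2) * exp (c * t))"
  have Dz: "(z has_real_derivative (y' t + c * (y t - e/2)) * exp (c * t)) (at t within {0..})"
    if "0 \<le> t" for t
    unfolding z_def using D[OF that]
    by (auto intro!: derivative_eq_intros simp: algebra_simps)
  have zle: "z t \<le> z t0" if "t0 \<le> t" for t
  proof (rule nonincreasing_halfline[OF Dz])
    fix s assume s: "t0 \<le> s"
    have "y' s + c * (y s - e/2) \<le> 0"
      using le[of s] t0(1) t0(2)[OF s] s by (simp add: algebra_simps)
    then show "(y' s + c * (y s - e/2)) * exp (c * s) \<le> 0" by (simp add: mult_le_0_iff)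
  qed (use t0 that in auto)
  have "((\<lambda>t. z t0 * exp (- (c * t))) \<longlongrightarrow> z t0 * 0) at_top"
    by (intro tendsto_mult tendsto_const filterlim_compose[OF exp_at_bot]
          filterlim_compose[OF filterlim_uminus_at_bot_at_top]
          filterlim_tendsto_pos_mult_at_top[OF tendsto_const c] filterlim_ident)
  then have "\<forall>\<^sub>F t in at_top. dist (z t0 * exp (- (c * t))) 0 < e / 2"
    using tendstoD[of "\<lambda>t. z t0 * exp (- (c * t))" 0 at_top "e / 2"] e by simp
  then show "\<forall>\<^sub>F t in at_top. dist (y t) 0 < e"
    using eventually_ge_at_top[of t0]
  proof eventually_elim
    case (elim t)
    have "y t - e/2 = z t * exp (- (c * t))" by (simp add: z_def exp_minus)
    also have "\<dots> \<le> z t0 * exp (- (c * t))" using zle elim by simp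
    also have "\<dots> < e/2" using elim by (simp add: dist_real_def)
    finally show ?case using nonneg[of t] elim t0 by (simp add: dist_real_def)
  qed
qed

text \<open>Over a window of fixed length \<open>h\<close> the increments of \<open>f\<close> tend
  to 0, so \<open>f'\<close> is small somewhere in each late window. The Lipschitz bound carries
  this to the left end of the window.\<close>

lemma barbalat:
  fixes f f' :: "real \<Rightarrow> real"
  assumes D: "\<And>t. 0 \<le> t \<Longrightarrow> (f has_real_derivative f' t) (at t within {0..})"
    and L: "\<And>s t. 0 \<le> s \<Longrightarrow> 0 \<le> t \<Longrightarrow> \<bar>f' s - f' t\<bar> \<le> L * \<bar>s - t\<bar>"
    and lim: "(f \<longlongrightarrow> l) at_top"
  shows "(f' \<longlongrightarrow> 0) at_top"
proof (rule tendstoI)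
  fix e :: real assume e: "0 < e"
  \<comment> \<open>\<open>L\<close> is an arbitrary real; the maximum with 1 makes the window
    length positive.\<close>
  define K where "K = max L 1"
  define h where "h = e / (2 * K)"
  have K: "K \<ge> 1" "K \<ge> L" by (auto simp: K_def)
  have h: "h > 0" "K * h = e / 2" using e K by (auto simp: h_def)
  have "((\<lambda>t. f (h + t) - f t) \<longlongrightarrow> l - l) at_top"
    by (intro tendsto_diff lim filterlim_compose[OF lim] filterlim_tendsto_add_at_top[OF tendsto_const]
          filterlim_ident)
  then have "\<forall>\<^sub>F t in at_top. dist (f (h + t) - f t) 0 < e / 2 * h"
    using tendstoD[of "\<lambda>t. f (h + t) - f t" 0 at_top "e / 2 * h"] e h by simp
  then show "\<forall>\<^sub>F t in at_top. dist (f' t) 0 < e"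
    using eventually_ge_at_top[of 0]
  proof eventually_elim
    case (elim t)
    obtain \<xi> where x: "t < \<xi>" "\<xi> < h + t" "f (h + t) - f t = (h + t - t) * f' \<xi>"
      using mvt_halfline[OF D, of t "h + t"] elim h by auto
    have "\<bar>f' \<xi>\<bar> * h < e / 2 * h" using elim x h by (simp add: abs_mult mult.commute)
    then have "\<bar>f' \<xi>\<bar> < e / 2" using h by simp
    moreover have "\<bar>f' t - f' \<xi>\<bar> \<le> e / 2"
    proof -
      have "\<bar>f' t - f' \<xi>\<bar> \<le> L * \<bar>t - \<xi>\<bar>" by (rule L) (use elim x in auto)
      also have "\<dots> \<le> K * \<bar>t - \<xi>\<bar>" using K by (intro mult_right_mono) auto
      also have "\<dots> \<le> K * h" using K x by (intro mult_left_mono) auto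
      finally show ?thesis using h by simp
    qed
    ultimately show ?case unfolding dist_real_def by linarith
  qed
qed

text \<open>
  The closure properties of this class replace estimates on second derivatives when Barbalat's
  lemma is applied.
\<close>

definition bdd_Lipschitz :: "(real \<Rightarrow> real) \<Rightarrow> bool" where
  "bdd_Lipschitz f \<longleftrightarrow> (\<exists>K. \<forall>t\<ge>0. \<bar>f t\<bar> \<le> K) \<and>
     (\<exists>L. \<forall>s\<ge>0. \<forall>t\<ge>0. \<bar>f s - f t\<bar> \<le> L * \<bar>s - t\<bar>)"

lemma bdd_LipschitzI:
  "(\<And>t. 0 \<le> t \<Longrightarrow> \<bar>f t\<bar> \<le> K) \<Longrightarrow>
   (\<And>s t. 0 \<le> s \<Longrightarrow> 0 \<le> t \<Longrightarrow> \<bar>f s - f t\<bar> \<le> L * \<bar>s - t\<bar>) \<Longrightarrow> bdd_Lipschitz f"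
  unfolding bdd_Lipschitz_def by blast

lemma bdd_LipschitzE:
  assumes "bdd_Lipschitz f"
  obtains K L where "\<And>t. 0 \<le> t \<Longrightarrow> \<bar>f t\<bar> \<le> K"
    "\<And>s t. 0 \<le> s \<Longrightarrow> 0 \<le> t \<Longrightarrow> \<bar>f s - f t\<bar> \<le> L * \<bar>s - t\<bar>"
  using assms unfolding bdd_Lipschitz_def by blast

lemma bdd_Lipschitz_const [intro]: "bdd_Lipschitz (\<lambda>t. c)"
  by (rule bdd_LipschitzI[of _ "\<bar>c\<bar>" 0]) auto

lemma bdd_Lipschitz_add [intro]:
  assumes "bdd_Lipschitz f" "bdd_Lipschitz g"
  shows "bdd_Lipschitz (\<lambda>t. f t + g t)"
proof -
  obtain K L where f: "\<And>t. 0 \<le> t \<Longrightarrow> \<bar>f t\<bar> \<le> K"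
    "\<And>s t. 0 \<le> s \<Longrightarrow> 0 \<le> t \<Longrightarrow> \<bar>f s - f t\<bar> \<le> L * \<bar>s - t\<bar>"
    by (rule bdd_LipschitzE[OF assms(1)]) blast
  obtain K' L' where g: "\<And>t. 0 \<le> t \<Longrightarrow> \<bar>g t\<bar> \<le> K'"
    "\<And>s t. 0 \<le> s \<Longrightarrow> 0 \<le> t \<Longrightarrow> \<bar>g s - g t\<bar> \<le> L' * \<bar>s - t\<bar>"
    by (rule bdd_LipschitzE[OF assms(2)]) blast
  show ?thesis
  proof (rule bdd_LipschitzI[of _ "K + K'" "L + L'"])
    show "\<bar>f t + g t\<bar> \<le> K + K'" if "0 \<le> t" for t using f(1)[OF that] g(1)[OF that] by linarith
    show "\<bar>f s + g s - (f t + g t)\<bar> \<le> (L + L') * \<bar>s - t\<bar>" if "0 \<le> s" "0 \<le> t" for s t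
      using f(2)[OF that] g(2)[OF that] by (simp add: distrib_right)
  qed
qed

lemma bdd_Lipschitz_mult [intro]:
  assumes "bdd_Lipschitz f" "bdd_Lipschitz g"
  shows "bdd_Lipschitz (\<lambda>t. f t * g t)"
proof -
  obtain K L where f: "\<And>t. 0 \<le> t \<Longrightarrow> \<bar>f t\<bar> \<le> K"
    "\<And>s t. 0 \<le> s \<Longrightarrow> 0 \<le> t \<Longrightarrow> \<bar>f s - f t\<bar> \<le> L * \<bar>s - t\<bar>"
    by (rule bdd_LipschitzE[OF assms(1)]) blast
  obtain K' L' where g: "\<And>t. 0 \<le> t \<Longrightarrow> \<bar>g t\<bar> \<le> K'"
    "\<And>s t. 0 \<le> s \<Longrightarrow> 0 \<le> t \<Longrightarrow> \<bar>g s - g t\<bar> \<le> L' * \<bar>s - t\<bar>"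
    by (rule bdd_LipschitzE[OF assms(2)]) blast
  have K: "0 \<le> K" "0 \<le> K'" using f(1)[of 0] g(1)[of 0] by auto
  show ?thesis
  proof (rule bdd_LipschitzI[of _ "K * K'" "L * K' + K * L'"])
    show "\<bar>f t * g t\<bar> \<le> K * K'" if "0 \<le> t" for t
      unfolding abs_mult using f(1)[OF that] g(1)[OF that] K by (intro mult_mono) auto
    show "\<bar>f s * g s - f t * g t\<bar> \<le> (L * K' + K * L') * \<bar>s - t\<bar>" if "0 \<le> s" "0 \<le> t" for s t
    proof -
      have "\<bar>f s * g s - f t * g t\<bar> = \<bar>(f s - f t) * g s + f t * (g s - g t)\<bar>"
        by (simp add: algebra_simps)
      also have "\<dots> \<le> \<bar>f s - f t\<bar> * \<bar>g s\<bar> + \<bar>f t\<bar> * \<bar>g s - g t\<bar>"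
        by (metis abs_mult abs_triangle_ineq)
      also have "\<dots> \<le> (L * \<bar>s - t\<bar>) * K' + K * (L' * \<bar>s - t\<bar>)"
        using f(1)[OF that(2)] g(1)[OF that(1)] f(2)[OF that] g(2)[OF that] K
        by (intro add_mono mult_mono) auto
      finally show ?thesis by (simp add: algebra_simps)
    qed
  qed
qed

lemma bdd_Lipschitz_minus [intro]: "bdd_Lipschitz f \<Longrightarrow> bdd_Lipschitz (\<lambda>t. - f t)"
  using bdd_Lipschitz_mult[OF bdd_Lipschitz_const[of "-1"]] by simp

lemma bdd_Lipschitz_diff [intro]:
  "bdd_Lipschitz f \<Longrightarrow> bdd_Lipschitz g \<Longrightarrow> bdd_Lipschitz (\<lambda>t. f t - g t)"
  using bdd_Lipschitz_add[OF _ bdd_Lipschitz_minus] by simp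

lemma bdd_Lipschitz_divide [intro]: "bdd_Lipschitz f \<Longrightarrow> bdd_Lipschitz (\<lambda>t. f t / c)"
  using bdd_Lipschitz_mult[OF _ bdd_Lipschitz_const[of "inverse c"]] by (simp add: divide_inverse)

lemma bdd_Lipschitz_sum [intro]:
  "(\<And>i. i \<in> I \<Longrightarrow> bdd_Lipschitz (f i)) \<Longrightarrow> bdd_Lipschitz (\<lambda>t. \<Sum>i\<in>I. f i t)"
  by (induction I rule: infinite_finite_induct) auto

lemma bdd_Lipschitz_sin_cos:
  assumes "bdd_Lipschitz f"
  shows bdd_Lipschitz_sin [intro]: "bdd_Lipschitz (\<lambda>t. sin (f t))"
    and bdd_Lipschitz_cos [intro]: "bdd_Lipschitz (\<lambda>t. cos (f t))"
proof -
  obtain K L where f: "\<And>s t. 0 \<le> s \<Longrightarrow> 0 \<le> t \<Longrightarrow> \<bar>f s - f t\<bar> \<le> L * \<bar>s - t\<bar>"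
    by (rule bdd_LipschitzE[OF assms(1)]) blast
  have half: "\<bar>sin ((x - y) / 2)\<bar> \<le> \<bar>x - y\<bar> / 2" for x y :: real
    using abs_sin_x_le_abs_x[of "(x - y) / 2"] by simp
  have sin: "\<bar>sin x - sin y\<bar> \<le> \<bar>x - y\<bar>" for x y :: real
  proof -
    have "\<bar>sin x - sin y\<bar> = 2 * \<bar>sin ((x - y) / 2)\<bar> * \<bar>cos ((x + y) / 2)\<bar>"
      by (simp add: sin_diff_sin abs_mult)
    also have "\<dots> \<le> 2 * (\<bar>x - y\<bar> / 2) * 1" using half[of x y] by (intro mult_mono) auto
    finally show ?thesis by simp
  qed
  have cos: "\<bar>cos x - cos y\<bar> \<le> \<bar>x - y\<bar>" for x y :: real
    using sin[of "pi/2 - x" "pi/2 - y"] by (simp add: cos_sin_eq abs_minus_commute)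
  show "bdd_Lipschitz (\<lambda>t. sin (f t))"
    by (rule bdd_LipschitzI[of _ 1 L]) (auto intro: order_trans[OF sin f])
  show "bdd_Lipschitz (\<lambda>t. cos (f t))"
    by (rule bdd_LipschitzI[of _ 1 L]) (auto intro: order_trans[OF cos f])
qed

lemma bdd_Lipschitz_if_bdd_deriv:
  fixes f f' :: "real \<Rightarrow> real"
  assumes D: "\<And>t. 0 \<le> t \<Longrightarrow> (f has_real_derivative f' t) (at t within {0..})"
    and K: "\<And>t. 0 \<le> t \<Longrightarrow> \<bar>f t\<bar> \<le> K" and L: "\<And>t. 0 \<le> t \<Longrightarrow> \<bar>f' t\<bar> \<le> L"
  shows "bdd_Lipschitz f"
proof (rule bdd_LipschitzI[of _ K L])
  have *: "\<bar>f s - f t\<bar> \<le> L * \<bar>s - t\<bar>" if st: "0 \<le> s" "s < t" for s t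
  proof -
    obtain \<xi> where x: "s < \<xi>" "\<xi> < t" "f t - f s = (t - s) * f' \<xi>"
      using mvt_halfline[OF D st] by metis
    have "\<bar>f s - f t\<bar> = \<bar>s - t\<bar> * \<bar>f' \<xi>\<bar>"
      using x by (metis abs_minus_commute abs_mult)
    also have "\<dots> \<le> \<bar>s - t\<bar> * L" using L x st by (intro mult_left_mono) auto
    finally show ?thesis by (simp add: mult.commute)
  qed
  show "\<bar>f s - f t\<bar> \<le> L * \<bar>s - t\<bar>" if "0 \<le> s" "0 \<le> t" for s t
    using *[of s t] *[of t s] that by (cases s t rule: linorder_cases) (auto simp: abs_minus_commute)
qed (use K in auto)

lemma barbalat':
  assumes "\<And>t. 0 \<le> t \<Longrightarrow> (f has_real_derivative f' t) (at t within {0..})"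
    and "bdd_Lipschitz f'" and "(f \<longlongrightarrow> l) at_top"
  shows "(f' \<longlongrightarrow> 0) at_top"
  using assms(2) by (rule bdd_LipschitzE) (rule barbalat[OF assms(1) _ assms(3)])

text \<open>Kept apart from \<open>bdd_Lipschitz\<close> because bounds come first: the energy
  bounds the state, the equations then bound its derivatives, and only both together give membership
  in the Lipschitz class.\<close>

definition bdd_halfline :: "(real \<Rightarrow> real) \<Rightarrow> bool" where
  "bdd_halfline f \<longleftrightarrow> (\<exists>K. \<forall>t\<ge>0. \<bar>f t\<bar> \<le> K)"

lemma bdd_halflineI: "(\<And>t. 0 \<le> t \<Longrightarrow> \<bar>f t\<bar> \<le> K) \<Longrightarrow> bdd_halfline f"
  unfolding bdd_halfline_def by blast

lemma bdd_halfline_const [intro]: "bdd_halfline (\<lambda>t. k)"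
  by (rule bdd_halflineI[of _ "\<bar>k\<bar>"]) simp

lemma bdd_halfline_add [intro]:
  assumes "bdd_halfline f" "bdd_halfline g"
  shows "bdd_halfline (\<lambda>t. f t + g t)"
proof -
  from assms obtain K L where "\<forall>t\<ge>0. \<bar>f t\<bar> \<le> K" "\<forall>t\<ge>0. \<bar>g t\<bar> \<le> L"
    unfolding bdd_halfline_def by blast
  then show ?thesis by (intro bdd_halflineI[of _ "K + L"]) (smt (verit))
qed

lemma bdd_halfline_mult [intro]:
  assumes "bdd_halfline f" "bdd_halfline g"
  shows "bdd_halfline (\<lambda>t. f t * g t)"
proof -
  from assms obtain K L where "\<forall>t\<ge>0. \<bar>f t\<bar> \<le> K" "\<forall>t\<ge>0. \<bar>g t\<bar> \<le> L"
    unfolding bdd_halfline_def by blast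
  then show ?thesis
    by (intro bdd_halflineI[of _ "K * L"]) (auto simp: abs_mult intro!: mult_mono order_trans[OF abs_ge_zero])
qed

lemma bdd_halfline_minus [intro]: "bdd_halfline f \<Longrightarrow> bdd_halfline (\<lambda>t. - f t)"
  using bdd_halfline_mult[OF bdd_halfline_const[of "-1"]] by simp

lemma bdd_halfline_diff [intro]:
  "bdd_halfline f \<Longrightarrow> bdd_halfline g \<Longrightarrow> bdd_halfline (\<lambda>t. f t - g t)"
  using bdd_halfline_add[OF _ bdd_halfline_minus] by simp

lemma bdd_halfline_divide [intro]: "bdd_halfline f \<Longrightarrow> bdd_halfline (\<lambda>t. f t / k)"
  using bdd_halfline_mult[OF _ bdd_halfline_const[of "inverse k"]] by (simp add: divide_inverse)

lemma bdd_halfline_sum [intro]: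
  "(\<And>i. i \<in> I \<Longrightarrow> bdd_halfline (f i)) \<Longrightarrow> bdd_halfline (\<lambda>t. \<Sum>i\<in>I. f i t)"
  by (induction I rule: infinite_finite_induct) auto

lemma bdd_halfline_sin [intro]: "bdd_halfline (\<lambda>t. sin (f t))"
  by (rule bdd_halflineI[of _ 1]) simp

lemma bdd_halfline_if_square_le:
  assumes "\<And>t. 0 \<le> t \<Longrightarrow> (f t)\<^sup>2 \<le> K"
  shows "bdd_halfline f"
proof (rule bdd_halflineI[of _ "sqrt K"])
  fix t :: real assume "0 \<le> t"
  then show "\<bar>f t\<bar> \<le> sqrt K" using assms[of t] by (intro real_le_rsqrt) simp
qed

lemma bdd_halfline_cong:
  "(\<And>t. 0 \<le> t \<Longrightarrow> f t = g t) \<Longrightarrow> bdd_halfline f \<longleftrightarrow> bdd_halfline g"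
  unfolding bdd_halfline_def by auto

lemma bdd_Lipschitz_cong:
  "(\<And>t. 0 \<le> t \<Longrightarrow> f t = g t) \<Longrightarrow> bdd_Lipschitz f \<longleftrightarrow> bdd_Lipschitz g"
  unfolding bdd_Lipschitz_def by auto

lemma bdd_Lipschitz_if_bdd_halfline_deriv:
  assumes "\<And>t. 0 \<le> t \<Longrightarrow> (f has_real_derivative f' t) (at t within {0..})"
    and "bdd_halfline f" "bdd_halfline f'"
  shows "bdd_Lipschitz f"
proof -
  from assms(2,3) obtain K L where "\<forall>t\<ge>0. \<bar>f t\<bar> \<le> K" "\<forall>t\<ge>0. \<bar>f' t\<bar> \<le> L"
    unfolding bdd_halfline_def by blast
  then show ?thesis by (intro bdd_Lipschitz_if_bdd_deriv[OF assms(1)]) auto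
qed

text \<open>Strong convexity of \<open>- cos\<close> on \<open>[-c, c]\<close>, by Taylor expansion
  at \<open>y\<close> to second order: the intermediate point stays in the interval, where the
  second derivative is at least \<open>cos c\<close>. Since \<open>y\<close> is free, the bound
  serves for any centre of the energy.\<close>

lemma cos_gap_lower_bound:
  fixes x y c :: real
  assumes c: "0 \<le> c" "c < pi / 2" and "\<bar>x\<bar> \<le> c" "\<bar>y\<bar> \<le> c"
  shows "cos c / 2 * (x - y)\<^sup>2 \<le> cos y - cos x - sin y * (x - y)"
proof -
  have cosc: "cos c \<le> cos z" if "\<bar>z\<bar> \<le> c" for z
    using cos_monotone_0_pi_le[of "\<bar>z\<bar>" c] that c pi_gt_zero by simp
  show ?thesis
  proof (cases "x = y")
    case False
    define D where "D = (\<lambda>m::nat. if m = 0 then (\<lambda>z::real. - cos z) else if m = 1 then sin else cos)"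
    have DD: "\<forall>m t. m < 2 \<and> -c \<le> t \<and> t \<le> c \<longrightarrow> DERIV (D m) t :> D (Suc m) t"
      by (auto simp: D_def less_Suc_eq numeral_2_eq_2 intro!: derivative_eq_intros)
    have "\<exists>t. (if x < y then x < t \<and> t < y else y < t \<and> t < x) \<and>
        - cos x = (\<Sum>m<2. D m y / fact m * (x - y) ^ m) + D 2 t / fact 2 * (x - y)^2"
      by (rule Taylor[OF _ _ DD]) (use assms False in \<open>auto simp: D_def\<close>)
    then obtain t where t: "if x < y then x < t \<and> t < y else y < t \<and> t < x"
      and eq: "- cos x = (\<Sum>m<2. D m y / fact m * (x - y) ^ m) + D 2 t / fact 2 * (x - y)^2"
      by blast
    have "\<bar>t\<bar> \<le> c" using t assms by (auto split: if_splits)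
    then have "cos c * (x - y)\<^sup>2 \<le> cos t * (x - y)\<^sup>2" by (intro mult_right_mono cosc) auto
    with eq show ?thesis by (simp add: D_def numeral_2_eq_2)
  qed simp
qed

section \<open>Heat flow\<close>

lemma poly_charpoly: "poly (charpoly S) t = det (\<chi> i j. (if i = j then t else 0) - S $ i $ j)"
proof -
  have "poly ((if i = j then [:0, 1:] else 0) - [:S $ i $ j:]) t = (if i = j then t else 0) - S $ i $ j"
    for i j by simp
  then show ?thesis
    unfolding charpoly_def det_def by (simp add: poly_sum poly_prod del: poly_diff)
qed

text \<open>Otherwise a small step from \<open>x\<close> against the gradient \<open>S *v x\<close>
  would make the quadratic form negative.\<close>

lemma pos_semidef_kernel:
  assumes S: "pos_semidef S" and x: "x \<bullet> (S *v x) = 0"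
  shows "S *v x = 0"
proof (rule ccontr)
  assume nz: "S *v x \<noteq> 0"
  define y where "y = S *v x"
  define a where "a = y \<bullet> (S *v y)"
  have yy: "y \<bullet> y > 0" using nz by (simp add: y_def)
  have a: "0 \<le> a" using S by (simp add: pos_semidef_def a_def)
  have sym: "x \<bullet> (S *v y) = y \<bullet> y"
    using S dot_lmul_matrix[of x S y] by (simp add: pos_semidef_def y_def transpose_matrix_vector[symmetric])
  \<comment> \<open>Minimising \<open>2 * s * (y \<bullet> y) + s\<^sup>2 * a\<close> suggests the
    denominator \<open>a\<close>; the added 1 covers \<open>a = 0\<close> and keeps the value
    negative.\<close>
  define s where "s = - (y \<bullet> y) / (a + 1)"
  have "0 \<le> (x + s *\<^sub>R y) \<bullet> (S *v (x + s *\<^sub>R y))" using S by (simp add: pos_semidef_def)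
  also have "\<dots> = 2 * s * (y \<bullet> y) + s\<^sup>2 * a"
    using x sym by (simp add: matrix_vector_right_distrib matrix_vector_mult_scaleR inner_add_left inner_add_right
        a_def y_def[symmetric] power2_eq_square algebra_simps)
  also have "\<dots> = (s * (y \<bullet> y)) * ((a + 2) / (a + 1))"
  proof -
    have "2 * (y \<bullet> y) + s * a = (y \<bullet> y) * ((a + 2) / (a + 1))"
      using a by (simp add: s_def divide_simps) (simp add: algebra_simps)
    then have "s * (2 * (y \<bullet> y) + s * a) = s * ((y \<bullet> y) * ((a + 2) / (a + 1)))" by simp
    then show ?thesis by (simp add: power2_eq_square algebra_simps)
  qed
  also have "\<dots> < 0"
    using a yy by (intro mult_neg_pos) (auto simp: s_def divide_neg_pos mult_neg_pos)
  finally show False by simp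
qed

text \<open>
  If the kernel contained a vector that is not constant, two row operations would split off the
  factor \<open>t\<^sup>2\<close> from the characteristic polynomial.
\<close>

lemma kernel_simple_eigenvalue:
  fixes S :: "real ^ 'a ^ 'a"
  assumes psd: "pos_semidef S" and simple: "simple_eigenvalue S 0"
    and one: "S *v 1 = 0" and x: "S *v x = 0"
  shows "x $ i = x $ j"
proof (rule ccontr)
  assume ne: "x $ i \<noteq> x $ j"
  then have ij: "i \<noteq> j" by auto
  \<comment> \<open>In the span of \<open>x\<close> and the constants, \<open>z\<close> and
    \<open>y\<close> are normalised to the values 0, 1 and 1, 0 at \<open>i\<close>,
    \<open>j\<close>. Thus row \<open>j\<close> can be replaced using \<open>z\<close> and
    afterwards row \<open>i\<close> using \<open>y\<close>, without either needing the row already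
    replaced.\<close>
  define z where "z = (1 / (x $ j - x $ i)) *\<^sub>R (x - (x $ i) *\<^sub>R 1)"
  define y where "y = 1 - z"
  have z: "z $ i = 0" "z $ j = 1" "S *v z = 0"
    using ne one x by (auto simp: z_def matrix_vector_mult_diff_distrib matrix_vector_mult_scaleR)
  have y: "y $ i = 1" "y $ j = 0" "S *v y = 0"
    using z one by (auto simp: y_def matrix_vector_mult_diff_distrib)
  define N where "N = (\<lambda>t. (\<chi> k l. (if k = l then t else 0) - S $ k $ l) :: real ^ 'a ^ 'a)"
  \<comment> \<open>By symmetry a kernel vector is also a left kernel vector, so in this combination
    of the rows of \<open>t * I - S\<close> only the diagonal part survives.\<close>
  have comb: "(\<Sum>k\<in>UNIV. (v $ k) *s row k (N t)) = t *s v" if "S *v v = 0" for v t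
  proof -
    have "(\<Sum>k\<in>UNIV. v $ k * S $ k $ l) = 0" for l
    proof -
      have "v v* S = 0" using that psd by (metis pos_semidef_def transpose_matrix_vector)
      then have "(v v* S) $ l = 0" by simp
      then show ?thesis by (simp add: vector_matrix_mult_def mult.commute)
    qed
    moreover have "(\<Sum>k\<in>UNIV. v $ k * (if k = l then t else 0)) = t * v $ l" for l
      by (subst sum.cong[OF refl, where h = "\<lambda>k. if k = l then t * v $ l else 0"]) auto
    ultimately show ?thesis
      by (simp add: vec_eq_iff row_def N_def right_diff_distrib sum_subtractf)
  qed
  define N3 where "N3 = (\<lambda>t. (\<chi> k. if k = i then y else if k = j then z else row k (N t)) :: real ^ 'a ^ 'a)"
  have detN: "det (N t) = t\<^sup>2 * det (N3 t)" for t
  proof -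
    define A1 where "A1 = (\<chi> k. if k = j then t *s z else row k (N t))"
    have rowA1: "row k A1 = (if k = j then t *s z else row k (N t))" for k
      by (simp add: A1_def row_def vec_eq_iff)
    have "A1 = (\<chi> k. if k = j then row j (N t) + (\<Sum>k\<in>UNIV - {j}. (z $ k) *s row k (N t)) else row k (N t))"
    proof -
      have "t *s z = row j (N t) + (\<Sum>k\<in>UNIV - {j}. (z $ k) *s row k (N t))"
        using comb[OF z(3), of t] z(2) by (subst (asm) sum.remove[of _ j]) auto
      then show ?thesis by (simp only: A1_def)
    qed
    also have "det \<dots> = det (N t)"
      by (rule det_row_span, intro vec.span_sum vec.span_scale vec.span_base) auto
    finally have 1: "det A1 = det (N t)" .
    have "(\<chi> k. if k = i then t *s y else row k A1) =
        (\<chi> k. if k = i then row i A1 + (\<Sum>k\<in>UNIV - {i}. (y $ k) *s row k A1) else row k A1)"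
    proof -
      have "(\<Sum>k\<in>UNIV - {i}. (y $ k) *s row k A1) = (\<Sum>k\<in>UNIV - {i}. (y $ k) *s row k (N t))"
        using y(2) by (intro sum.cong) (auto simp: rowA1)
      then have "t *s y = row i A1 + (\<Sum>k\<in>UNIV - {i}. (y $ k) *s row k A1)"
        using comb[OF y(3), of t] y(1) ij by (subst (asm) sum.remove[of _ i]) (auto simp: rowA1)
      then show ?thesis by (simp only:)
    qed
    also have "det \<dots> = det A1"
      by (rule det_row_span, intro vec.span_sum vec.span_scale vec.span_base) auto
    finally have 2: "det (\<chi> k. if k = i then t *s y else row k A1) = det A1" .
    have "det (\<chi> k. if k = i then t *s y else row k A1) =
        t * det (\<chi> k. if k = i then y else row k A1)"
      using det_row_mul[of i t "\<lambda>_. y" "\<lambda>k. row k A1"] by simp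
    also have "(\<chi> k. if k = i then y else row k A1) =
        (\<chi> k. if k = j then t *s z else if k = i then y else row k (N t))"
      using ij by (intro arg_cong[where f = vec_lambda]) (auto simp: fun_eq_iff rowA1)
    also have "det \<dots> = t * det (\<chi> k. if k = j then z else if k = i then y else row k (N t))"
      using det_row_mul[of j t "\<lambda>_. z" "\<lambda>k. if k = i then y else row k (N t)"] by simp
    also have "(\<chi> k. if k = j then z else if k = i then y else row k (N t)) = N3 t"
      unfolding N3_def using ij by (intro arg_cong[where f = vec_lambda]) (auto simp: fun_eq_iff)
    finally have "det A1 = t * (t * det (N3 t))" unfolding 2 .
    then show ?thesis unfolding 1 by (simp add: power2_eq_square)
  qed
  \<comment> \<open>Needed to split off the root by its order. Semidefiniteness excludes the
    eigenvalue -1, so -1 is a point where the polynomial does not vanish.\<close>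
  have nonzero: "charpoly S \<noteq> 0"
  proof
    assume "charpoly S = 0"
    then have "det (N (-1)) = 0" using poly_charpoly[of S "-1"] by (simp add: N_def)
    then obtain v where v: "N (-1) *v v = 0" "v \<noteq> 0"
      using invertible_det_nz[of "N (-1)"] matrix_left_invertible_ker[of "N (-1)"]
        invertible_left_inverse[of "N (-1)"] by auto
    have "N (-1) = (-1) *\<^sub>R (mat 1 + S)" by (simp add: N_def mat_def vec_eq_iff)
    then have "v + S *v v = 0"
      using v(1) scaleR_matrix_vector_assoc[of "-1" "mat 1 + S" v]
      by (auto simp: matrix_vector_mult_add_rdistrib add_eq_0_iff)
    then have "S *v v = - v" by (simp add: add_eq_0_iff)
    moreover have "0 \<le> v \<bullet> (S *v v)" using psd by (simp add: pos_semidef_def)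
    moreover have "0 < v \<bullet> v" using v by simp
    ultimately show False by simp
  qed
  from order_decomp[OF nonzero, of 0]
  obtain q where q: "charpoly S = [:- 0, 1:] ^ order 0 (charpoly S) * q" "\<not> [:- 0, 1:] dvd q"
    by (elim exE conjE)
  have q0: "poly q 0 \<noteq> 0" using q(2) by (simp add: poly_eq_0_iff_dvd)
  \<comment> \<open>Cancelling one factor \<open>t\<close> is possible off 0 only. Continuity then
    forces \<open>q\<close> to vanish at 0, against the multiplicity one of that root.\<close>
  have eq: "poly q t = t * det (N3 t)" if "t \<noteq> 0" for t
  proof -
    have "t * poly q t = poly (charpoly S) t"
      using simple by (subst q(1)) (simp add: simple_eigenvalue_def)
    also have "\<dots> = t * (t * det (N3 t))"
      using detN[of t] by (simp add: poly_charpoly N_def power2_eq_square)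
    finally show ?thesis using that by simp
  qed
  have cont: "continuous (at 0) (\<lambda>t. det (N3 t))"
  proof -
    have "continuous (at 0) (\<lambda>t. N3 t $ k $ l)" for k l
      by (cases "k = i"; cases "k = j"; cases "k = l") (simp_all add: N3_def row_def N_def)
    then show ?thesis unfolding det_def isCont_def
      by (intro tendsto_sum tendsto_mult tendsto_const tendsto_prod) blast
  qed
  have lim0: "((\<lambda>t. t * det (N3 t)) \<longlongrightarrow> 0 * det (N3 0)) (at 0)"
    using cont by (intro tendsto_mult tendsto_ident_at) (simp add: isCont_def)
  have lim1: "((\<lambda>t. t * det (N3 t)) \<longlongrightarrow> poly q 0) (at 0)"
  proof (rule Lim_transform_eventually)
    show "(poly q \<longlongrightarrow> poly q 0) (at 0)" using poly_isCont[of 0 q] unfolding isCont_def .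
    show "\<forall>\<^sub>F t in at 0. poly q t = t * det (N3 t)"
      unfolding eventually_at by (rule exI[of _ 1]) (simp add: eq)
  qed
  have "0 * det (N3 0) = poly q 0" by (rule tendsto_unique[OF _ lim0 lim1]) simp
  with q0 show False by simp
qed

section \<open>Relaxation of temperature profiles around their mean\<close>

lemma diag_mat_vec: "(diag_mat v *v x) $ i = v $ i * x $ i"
proof -
  have "(\<Sum>j\<in>UNIV. (if i = j then v $ i else 0) * x $ j) = (\<Sum>j\<in>UNIV. if j = i then v $ i * x $ i else 0)"
    by (intro sum.cong) auto
  then show ?thesis by (simp add: diag_mat_def matrix_vector_mult_def)
qed

lemma one_inner_diag_mat: "1 \<bullet> (diag_mat v *v x) = (\<Sum>i\<in>UNIV. v $ i * x $ i)"
  by (simp add: inner_vec_def diag_mat_vec)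

text \<open>The quadratic form sees only the symmetric part of \<open>A\<close>, whose kernel
  consists of the constants, and positive weights leave no nonzero constant of mean zero.
  Compactness of the unit sphere turns strict positivity into a uniform constant.\<close>

lemma coercive_zero_mean:
  fixes A :: "real ^ 'a ^ 'a"
  assumes psd: "pos_semidef (A + transpose A)" and simple: "simple_eigenvalue (A + transpose A) 0"
    and A1: "A *v 1 = 0" "1 v* A = 0" and v: "\<And>i. 0 < v $ i"
  obtains c where "0 < c" "\<And>x. 1 \<bullet> (diag_mat v *v x) = 0 \<Longrightarrow> c * (x \<bullet> x) \<le> x \<bullet> (A *v x)"
proof -
  define S where "S = A + transpose A"
  have S1: "S *v 1 = 0" using A1 by (simp add: S_def matrix_vector_mult_add_rdistrib transpose_matrix_vector)
  have qS: "x \<bullet> (S *v x) = 2 * (x \<bullet> (A *v x))" for x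
  proof -
    have "x \<bullet> (transpose A *v x) = x \<bullet> (A *v x)"
      by (metis dot_lmul_matrix inner_commute transpose_matrix_vector)
    then show ?thesis by (simp add: S_def matrix_vector_mult_add_rdistrib inner_add_right)
  qed
  define K where "K = sphere 0 1 \<inter> {x :: real ^ 'a. 1 \<bullet> (diag_mat v *v x) = 0}"
  have pos: "0 < x \<bullet> (A *v x)" if x: "x \<in> K" for x
  proof -
    have "0 \<le> x \<bullet> (S *v x)" using psd by (simp add: pos_semidef_def S_def)
    moreover have "x \<bullet> (S *v x) \<noteq> 0"
    proof
      assume "x \<bullet> (S *v x) = 0"
      then have "S *v x = 0" using pos_semidef_kernel psd by (simp add: S_def)
      then have const: "x $ i = x $ j" for i j
        using kernel_simple_eigenvalue psd simple S1 unfolding S_def by blast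
      have "x $ i * (\<Sum>j\<in>UNIV. v $ j) = 0" for i
      proof -
        have "x $ i * (\<Sum>j\<in>UNIV. v $ j) = (\<Sum>j\<in>UNIV. v $ j * x $ j)"
          using const by (subst sum_distrib_left) (auto intro!: sum.cong simp: mult.commute)
        then show ?thesis using x by (simp add: K_def one_inner_diag_mat)
      qed
      moreover have "(\<Sum>j\<in>UNIV. v $ j) > 0" using v by (intro sum_pos) auto
      ultimately have "x = 0" by (simp add: vec_eq_iff)
      with x show False by (simp add: K_def)
    qed
    ultimately show ?thesis by (simp add: qS)
  qed
  have "\<exists>c>0. \<forall>x\<in>K. c \<le> x \<bullet> (A *v x)"
  \<comment> \<open>With a single coordinate, mean zero forces \<open>x = 0\<close>, and there is
    nothing to minimise over.\<close>
  proof (cases "K = {}")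
    case False
    have "compact K" unfolding K_def
      by (intro compact_Int_closed compact_sphere closed_Collect_eq continuous_intros)
    moreover have "continuous_on K (\<lambda>x. x \<bullet> (A *v x))" by (intro continuous_intros)
    ultimately obtain x0 where "x0 \<in> K" "\<forall>x\<in>K. x0 \<bullet> (A *v x0) \<le> x \<bullet> (A *v x)"
      using continuous_attains_inf[OF _ False] by blast
    then show ?thesis using pos by blast
  qed (auto intro: exI[of _ 1])
  then obtain c where c: "0 < c" "\<And>x. x \<in> K \<Longrightarrow> c \<le> x \<bullet> (A *v x)" by blast
  show ?thesis
  proof (rule that[OF c(1)])
    fix x :: "real ^ 'a" assume x: "1 \<bullet> (diag_mat v *v x) = 0"
    show "c * (x \<bullet> x) \<le> x \<bullet> (A *v x)"
    proof (cases "x = 0")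
      case False
      define u where "u = inverse (norm x) *\<^sub>R x"
      have "u \<in> K" using x False by (simp add: K_def u_def matrix_vector_mult_scaleR)
      then have "c \<le> u \<bullet> (A *v u)" by (rule c)
      moreover have "x = norm x *\<^sub>R u" using False by (simp add: u_def)
      then have "x \<bullet> (A *v x) = (norm x)\<^sup>2 * (u \<bullet> (A *v u))"
        by (metis (no_types, lifting) inner_scaleR_left inner_scaleR_right matrix_vector_mult_scaleR
            mult.assoc power2_eq_square)
      ultimately show ?thesis
        using mult_right_mono[of c "u \<bullet> (A *v u)" "(norm x)\<^sup>2"]
        by (simp add: power2_norm_eq_inner[symmetric] mult.commute)
    qed simp
  qed
qed

text \<open>\<open>A\<close> cannot influence the weighted mean, as constants lie in both its
  kernels; so the limit of the mean is a hypothesis, and only the remainder \<open>x\<close> of mean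
  zero has to be shown to decay. Its weighted square norm obeys a damped inequality driven by the
  error of the input.\<close>

lemma heat_relaxation:
  fixes T :: "real \<Rightarrow> real ^ 'a"
  assumes D: "\<And>t. 0 \<le> t \<Longrightarrow>
      ((\<lambda>s. diag_mat v *v T s) has_vector_derivative - (A *v T t) + u t) (at t within {0..})"
    and psd: "pos_semidef (A + transpose A)" and simple: "simple_eigenvalue (A + transpose A) 0"
    and A1: "A *v 1 = 0" "1 v* A = 0" and v: "\<And>i. 0 < v $ i"
    and u: "(u \<longlongrightarrow> A *v Ts) at_top"
    and mean: "((\<lambda>t. (1 \<bullet> (diag_mat v *v T t)) / (1 \<bullet> (diag_mat v *v 1)) -
                    (1 \<bullet> (diag_mat v *v Ts)) / (1 \<bullet> (diag_mat v *v 1))) \<longlongrightarrow> m) at_top"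
  shows "(T \<longlongrightarrow> Ts + m *\<^sub>R 1) at_top"
proof -
  define vol where "vol = 1 \<bullet> (diag_mat v *v 1)"
  have vol: "vol = (\<Sum>i\<in>UNIV. v $ i)" "0 < vol"
    using v by (auto simp: vol_def one_inner_diag_mat intro!: sum_pos)
  define \<theta> where "\<theta> = (\<lambda>t. (\<Sum>i\<in>UNIV. v $ i * T t $ i) / vol - (\<Sum>i\<in>UNIV. v $ i * Ts $ i) / vol)"
  define x where "x = (\<lambda>t. T t - Ts - \<theta> t *\<^sub>R 1)"
  define w where "w = (\<lambda>t. - (A *v T t) + u t)"
  define \<theta>' where "\<theta>' = (\<lambda>t. (\<Sum>i\<in>UNIV. w t $ i) / vol)"
  define y where "y = (\<lambda>t. (\<Sum>i\<in>UNIV. v $ i * (x t $ i)\<^sup>2) / 2)"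
  have \<theta>: "(\<theta> \<longlongrightarrow> m) at_top" using mean by (simp add: \<theta>_def one_inner_diag_mat vol)
  have xmean: "(\<Sum>i\<in>UNIV. v $ i * x t $ i) = 0" for t
  proof -
    have "(\<Sum>i\<in>UNIV. v $ i * x t $ i) =
        (\<Sum>i\<in>UNIV. v $ i * T t $ i) - (\<Sum>i\<in>UNIV. v $ i * Ts $ i) - vol * \<theta> t"
      by (simp add: x_def right_diff_distrib sum_subtractf vol(1) sum_distrib_right)
    also have "\<dots> = 0" using vol(2) by (simp add: \<theta>_def right_diff_distrib)
    finally show ?thesis .
  qed
  have DT: "((\<lambda>s. T s $ i) has_real_derivative w t $ i / v $ i) (at t within {0..})" if "0 \<le> t" for t i
  proof -
    have "((\<lambda>s. (diag_mat v *v T s) $ i) has_vector_derivative w t $ i) (at t within {0..})"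
      using bounded_linear.has_vector_derivative[OF bounded_linear_vec_nth D[OF that]] by (simp add: w_def)
    then have "((\<lambda>s. v $ i * T s $ i) has_real_derivative w t $ i) (at t within {0..})"
      by (simp add: diag_mat_vec has_real_derivative_iff_has_vector_derivative)
    from DERIV_cdivide[OF this, of "v $ i"] show ?thesis using v[of i] by simp
  qed
  have D\<theta>: "(\<theta> has_real_derivative \<theta>' t) (at t within {0..})" if "0 \<le> t" for t
  proof -
    have "(\<theta> has_real_derivative (\<Sum>i\<in>UNIV. v $ i * (w t $ i / v $ i)) / vol - 0) (at t within {0..})"
      unfolding \<theta>_def
      by (intro DERIV_diff DERIV_cdivide DERIV_sum DERIV_cmult DT[OF that] DERIV_const)
    also have "(\<Sum>i\<in>UNIV. v $ i * (w t $ i / v $ i)) = (\<Sum>i\<in>UNIV. w t $ i)"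
      using v by (intro sum.cong) (auto simp: less_imp_neq[THEN not_sym])
    finally show ?thesis by (simp add: \<theta>'_def)
  qed
  have Dy: "(y has_real_derivative x t \<bullet> w t) (at t within {0..})" if "0 \<le> t" for t
  proof -
    have "((\<lambda>s. T s $ i - Ts $ i - \<theta> s) has_real_derivative w t $ i / v $ i - 0 - \<theta>' t)
        (at t within {0..})" for i
      by (intro DERIV_diff DERIV_const DT[OF that] D\<theta>[OF that])
    then have "((\<lambda>s. (x s $ i)\<^sup>2) has_real_derivative 2 * x t $ i * (w t $ i / v $ i - \<theta>' t))
        (at t within {0..})" for i
      using DERIV_power[of "\<lambda>s. x s $ i" _ _ _ 2] by (simp add: x_def mult_ac)
    then have "(y has_real_derivative (\<Sum>i\<in>UNIV. v $ i * (2 * x t $ i * (w t $ i / v $ i - \<theta>' t))) / 2)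
        (at t within {0..})"
      unfolding y_def by (intro DERIV_cdivide DERIV_sum DERIV_cmult)
    also have "(\<Sum>i\<in>UNIV. v $ i * (2 * x t $ i * (w t $ i / v $ i - \<theta>' t))) / 2 =
        (\<Sum>i\<in>UNIV. x t $ i * w t $ i - \<theta>' t * (v $ i * x t $ i))"
      unfolding sum_divide_distrib using v
      by (intro sum.cong) (auto simp: field_simps less_imp_neq[THEN not_sym])
    \<comment> \<open>The drift \<open>\<theta>'\<close> of the mean drops out since
      \<open>x t\<close> has weighted mean zero.\<close>
    also have "\<dots> = x t \<bullet> w t"
      by (simp add: sum_subtractf sum_distrib_left[symmetric] xmean inner_vec_def)
    finally show ?thesis .
  qed
  obtain c where c: "0 < c" "\<And>x. 1 \<bullet> (diag_mat v *v x) = 0 \<Longrightarrow> c * (x \<bullet> x) \<le> x \<bullet> (A *v x)"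
    by (rule coercive_zero_mean[OF psd simple A1 v]) blast
  have yle: "y t \<le> vol / 2 * (x t \<bullet> x t)" and yge: "(v $ i / 2) * (x t $ i)\<^sup>2 \<le> y t" for t i
  proof -
    have "(\<Sum>i\<in>UNIV. v $ i * (x t $ i)\<^sup>2) \<le> (\<Sum>i\<in>UNIV. vol * (x t $ i)\<^sup>2)"
      unfolding vol(1) using v by (intro sum_mono mult_right_mono member_le_sum) (auto intro: less_imp_le)
    then show "y t \<le> vol / 2 * (x t \<bullet> x t)"
      by (simp add: y_def inner_vec_def power2_eq_square sum_distrib_left[symmetric])
    have "v $ i * (x t $ i)\<^sup>2 \<le> (\<Sum>i\<in>UNIV. v $ i * (x t $ i)\<^sup>2)"
      using v[THEN less_imp_le] by (intro member_le_sum mult_nonneg_nonneg) auto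
    then show "(v $ i / 2) * (x t $ i)\<^sup>2 \<le> y t" by (simp add: y_def)
  qed
  define e where "e = (\<lambda>t. norm (u t - A *v Ts))"
  have y: "(y \<longlongrightarrow> 0) at_top"
  proof (rule comparison_tendsto_0[OF Dy])
    show "0 < c / vol" using c vol by simp
    show "x t \<bullet> w t \<le> - (c / vol) * y t + (e t)\<^sup>2 / (2 * c)" for t
    proof -
      have "T t = x t + Ts + \<theta> t *\<^sub>R 1" by (simp add: x_def)
      then have "A *v T t = A *v x t + A *v Ts"
        by (simp add: matrix_vector_right_distrib matrix_vector_mult_scaleR A1)
      then have "x t \<bullet> w t = - (x t \<bullet> (A *v x t)) + x t \<bullet> (u t - A *v Ts)"
        by (simp add: w_def inner_add_right inner_diff_right)
      also have "\<dots> \<le> - (c * (x t \<bullet> x t)) + norm (x t) * e t"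
        using c(2)[of "x t"] xmean[of t] norm_cauchy_schwarz[of "x t" "u t - A *v Ts"]
        by (simp add: one_inner_diag_mat e_def)
      \<comment> \<open>Young's inequality, with the weight chosen to spend half of the coercivity
        \<open>c\<close> on the input error. The other half gives the rate \<open>c / vol\<close>,
        as \<open>y t\<close> is at most \<open>vol / 2\<close> times the squared norm.\<close>
      also have "norm (x t) * e t \<le> c / 2 * (norm (x t))\<^sup>2 + (e t)\<^sup>2 / (2 * c)"
      proof -
        have "0 \<le> (c * norm (x t) - e t)\<^sup>2 / (2 * c)" using c by simp
        then show ?thesis using c by (simp add: power2_eq_square field_simps)
      qed
      finally have "x t \<bullet> w t \<le> - (c / 2 * (x t \<bullet> x t)) + (e t)\<^sup>2 / (2 * c)"
        by (simp add: power2_norm_eq_inner)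
      moreover have "c / vol * y t \<le> c / 2 * (x t \<bullet> x t)"
        using mult_left_mono[OF yle[of t], of "c / vol"] c vol by simp
      ultimately show ?thesis by simp
    qed
    show "0 \<le> y t" for t unfolding y_def using v
      by (intro divide_nonneg_nonneg sum_nonneg mult_nonneg_nonneg) (auto intro: less_imp_le)
    have "((\<lambda>t. u t - A *v Ts) \<longlongrightarrow> 0) at_top" using u by (simp add: LIM_zero_iff)
    then have "(e \<longlongrightarrow> 0) at_top" unfolding e_def by (rule tendsto_norm_zero)
    then have "((\<lambda>t. (e t)\<^sup>2 / (2 * c)) \<longlongrightarrow> 0\<^sup>2 / (2 * c)) at_top"
      using c by (intro tendsto_intros) auto
    then show "((\<lambda>t. (e t)\<^sup>2 / (2 * c)) \<longlongrightarrow> 0) at_top" by simp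
  qed
  have x: "((\<lambda>t. x t $ i) \<longlongrightarrow> 0) at_top" for i
    by (rule tendsto_0_if_square_le[where k = "2 / v $ i", OF _ y])
      (use yge[of i] v[of i] in \<open>simp add: field_simps\<close>)
  have "((\<lambda>t. (Ts + \<theta> t *\<^sub>R 1) + x t) \<longlongrightarrow> (Ts + m *\<^sub>R 1) + 0) at_top"
    by (intro tendsto_add tendsto_const tendsto_scaleR \<theta> vec_tendstoI) (simp only: zero_index x)
  moreover have "(Ts + \<theta> t *\<^sub>R 1) + x t = T t" for t by (simp add: x_def)
  ultimately show ?thesis by (simp only: add_0_right)
qed

text \<open>
  The energy alone does not control \<open>s\<close>; the small cross term \<open>s * g e0\<close> turns it into a strict
  Lyapunov function.
\<close>

lemma driven_integral_control:
  fixes s v :: "real \<Rightarrow> real" and g :: "real \<Rightarrow> 'e \<Rightarrow> real"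
  assumes H: "finite H" "e0 \<in> H" and vol: "0 < vol"
    and tQ: "\<And>e. e \<in> H \<Longrightarrow> 0 < \<tau> e" "\<And>e. e \<in> H \<Longrightarrow> 0 < Q e"
    and Ds: "\<And>t. 0 \<le> t \<Longrightarrow> (s has_real_derivative ((\<Sum>e\<in>H. g t e) + v t) / vol) (at t within {0..})"
    and Dg: "\<And>t e. 0 \<le> t \<Longrightarrow> e \<in> H \<Longrightarrow>
      ((\<lambda>r. \<tau> e * g r e) has_real_derivative - g t e - Q e * s t) (at t within {0..})"
    and v: "(v \<longlongrightarrow> 0) at_top"
  shows "(s \<longlongrightarrow> 0) at_top" and "e \<in> H \<Longrightarrow> ((\<lambda>t. g t e) \<longlongrightarrow> 0) at_top"
proof -
  \<comment> \<open>\<open>N\<close> is the dissipation of the heat sources; it bounds every single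
    \<open>g t e\<close> as well as, by Cauchy-Schwarz, their sum.\<close>
  define N where "N = (\<lambda>t. \<Sum>e\<in>H. (g t e)\<^sup>2 / Q e)"
  define q where "q = (\<Sum>e\<in>H. Q e)"
  define \<tau>m where "\<tau>m = Min (\<tau> ` H)"
  define \<tau>M where "\<tau>M = Max (\<tau> ` H)"
  define Q0 where "Q0 = Q e0"
  define \<tau>0 where "\<tau>0 = \<tau> e0"
  have "H \<noteq> {}" using H by auto
  then have pos: "0 < Q0" "0 < \<tau>0" "0 < \<tau>m"
    using tQ H by (auto simp: Q0_def \<tau>0_def \<tau>m_def)
  have \<tau>m: "\<tau>m \<le> \<tau> e" "\<tau> e \<le> \<tau>M" if "e \<in> H" for e
    using H that by (auto simp: \<tau>m_def \<tau>M_def)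
  have q: "0 < q" unfolding q_def using H tQ by (intro sum_pos) auto
  have gN: "(g t e)\<^sup>2 \<le> Q e * N t" if "e \<in> H" for t e
  proof -
    have "(g t e)\<^sup>2 / Q e \<le> N t" unfolding N_def
      using that H tQ by (intro member_le_sum divide_nonneg_nonneg) (auto intro: less_imp_le)
    then show ?thesis using tQ(2)[OF that] by (simp add: field_simps)
  qed
  have N0: "0 \<le> N t" for t
    unfolding N_def using tQ by (intro sum_nonneg divide_nonneg_nonneg) (auto intro: less_imp_le)
  have GN: "(\<Sum>e\<in>H. g t e)\<^sup>2 \<le> q * N t" for t
  proof -
    have "(\<Sum>e\<in>H. sqrt (Q e) * (g t e / sqrt (Q e)))\<^sup>2 \<le>
        (\<Sum>e\<in>H. (sqrt (Q e))\<^sup>2) * (\<Sum>e\<in>H. (g t e / sqrt (Q e))\<^sup>2)"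
      by (rule Cauchy_Schwarz_ineq_sum)
    moreover have "(\<Sum>e\<in>H. sqrt (Q e) * (g t e / sqrt (Q e))) = (\<Sum>e\<in>H. g t e)"
      using tQ(2) by (intro sum.cong) (auto simp: less_imp_neq[THEN not_sym])
    moreover have "(\<Sum>e\<in>H. (sqrt (Q e))\<^sup>2) = q"
      unfolding q_def using tQ(2) by (intro sum.cong) (auto simp: less_imp_le)
    moreover have "(\<Sum>e\<in>H. (g t e / sqrt (Q e))\<^sup>2) = N t"
      unfolding N_def using tQ(2) by (intro sum.cong) (auto simp: power_divide less_imp_le)
    ultimately show ?thesis by simp
  qed
  \<comment> \<open>The total coefficient of \<open>N\<close> produced by the derivative of the
    cross term: 1 from estimate \<open>b\<close>, the other summands from \<open>d\<close> and
    \<open>f\<close> below.\<close>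
  define K where "K = 1 + \<tau>0 / vol * ((Q0 + q) / 2) + \<tau>0 / vol * (Q0 / 2)"
  have K: "1 \<le> K" using pos vol q by (simp add: K_def)
  \<comment> \<open>The first bound preserves half of the dissipation \<open>N\<close>. The other
    two keep the cross term below half of a lower bound for the plain energy, so that
    \<open>Y\<close> stays positive definite.\<close>
  define \<epsilon> where "\<epsilon> = Min {1 / (2 * K), vol / (2 * \<tau>0), \<tau>m / (2 * \<tau>0 * Q0)}"
  have \<epsilon>: "0 < \<epsilon>" "\<epsilon> * K \<le> 1/2" "\<epsilon> * \<tau>0 \<le> vol / 2" "\<epsilon> * \<tau>0 * Q0 \<le> \<tau>m / 2"
  proof -
    show "0 < \<epsilon>" using K pos vol by (simp add: \<epsilon>_def)
    have "\<epsilon> \<le> 1 / (2 * K)" "\<epsilon> \<le> vol / (2 * \<tau>0)" "\<epsilon> \<le> \<tau>m / (2 * \<tau>0 * Q0)" by (auto simp: \<epsilon>_def)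
    then show "\<epsilon> * K \<le> 1/2" "\<epsilon> * \<tau>0 \<le> vol / 2" "\<epsilon> * \<tau>0 * Q0 \<le> \<tau>m / 2"
      using K pos vol by (simp_all add: field_simps)
  qed
  define Y where "Y = (\<lambda>t. vol / 2 * (s t)\<^sup>2 + (\<Sum>e\<in>H. \<tau> e / Q e * (g t e)\<^sup>2) / 2 + \<epsilon> * (s t * (\<tau>0 * g t e0)))"
  define Y' where "Y' = (\<lambda>t. s t * ((\<Sum>e\<in>H. g t e) + v t) + (\<Sum>e\<in>H. g t e * (- g t e - Q e * s t) / Q e)
      + \<epsilon> * (((\<Sum>e\<in>H. g t e) + v t) / vol * (\<tau>0 * g t e0) + s t * (- g t e0 - Q0 * s t)))"
  have Dge: "((\<lambda>r. g r e) has_real_derivative (- g t e - Q e * s t) / \<tau> e) (at t within {0..})"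
    if "0 \<le> t" "e \<in> H" for t e
    using DERIV_cdivide[OF Dg[OF that], of "\<tau> e"] tQ(1)[OF that(2)] by simp
  have DY: "(Y has_real_derivative Y' t) (at t within {0..})" if t: "0 \<le> t" for t
  proof -
    have "((\<lambda>r. (\<tau> e / Q e * (g r e)\<^sup>2) / 2) has_real_derivative g t e * (- g t e - Q e * s t) / Q e)
        (at t within {0..})" if e: "e \<in> H" for e
    proof -
      have "\<tau> e \<noteq> 0" "Q e \<noteq> 0" using tQ(1)[OF e] tQ(2)[OF e] by auto
      then show ?thesis
        by (intro DERIV_cong[OF DERIV_cdivide[OF DERIV_cmult[OF DERIV_power[OF Dge[OF t e], of 2], of "\<tau> e / Q e"], of 2]])
          simp
    qed
    then have 1: "((\<lambda>r. (\<Sum>e\<in>H. \<tau> e / Q e * (g r e)\<^sup>2) / 2) has_real_derivative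
        (\<Sum>e\<in>H. g t e * (- g t e - Q e * s t) / Q e)) (at t within {0..})"
      unfolding sum_divide_distrib by (rule DERIV_sum)
    have 2: "((\<lambda>r. vol / 2 * (s r)\<^sup>2) has_real_derivative s t * ((\<Sum>e\<in>H. g t e) + v t)) (at t within {0..})"
      using vol by (auto intro!: derivative_eq_intros Ds[OF t])
    have 3: "((\<lambda>r. \<epsilon> * (s r * (\<tau>0 * g r e0))) has_real_derivative
        \<epsilon> * (((\<Sum>e\<in>H. g t e) + v t) / vol * (\<tau>0 * g t e0) + s t * (- g t e0 - Q0 * s t))) (at t within {0..})"
      using DERIV_cmult[OF DERIV_mult[OF Ds[OF t] Dg[OF t H(2)]], of \<epsilon>]
      by (simp add: \<tau>0_def Q0_def mult.commute add.commute)
    show ?thesis unfolding Y_def Y'_def by (intro DERIV_add 1 2 3)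
  qed
  define \<sigma> where "\<sigma> = (\<lambda>t. (\<Sum>e\<in>H. \<tau> e / Q e * (g t e)\<^sup>2))"
  have \<sigma>: "\<tau>m * N t \<le> \<sigma> t" "\<sigma> t \<le> \<tau>M * N t" for t
    unfolding \<sigma>_def N_def sum_distrib_left
    using \<tau>m tQ(2) by (auto intro!: sum_mono divide_right_mono mult_right_mono simp: less_imp_le)
  have cross: "\<bar>s t * (\<tau>0 * g t e0)\<bar> \<le> \<tau>0 / 2 * (s t)\<^sup>2 + \<tau>0 * Q0 / 2 * N t" for t
  proof -
    have "2 * \<bar>s t * g t e0\<bar> \<le> (s t)\<^sup>2 + (g t e0)\<^sup>2"
      using sum_squares_bound[of "\<bar>s t\<bar>" "\<bar>g t e0\<bar>"] by (simp add: abs_mult)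
    then have "2 * \<bar>s t * g t e0\<bar> \<le> (s t)\<^sup>2 + Q0 * N t" using gN[OF H(2), of t] by (simp add: Q0_def)
    then have "\<tau>0 / 2 * (2 * \<bar>s t * g t e0\<bar>) \<le> \<tau>0 / 2 * ((s t)\<^sup>2 + Q0 * N t)"
      using pos by (intro mult_left_mono) auto
    then show ?thesis using pos by (simp add: abs_mult algebra_simps)
  qed
  have cross\<epsilon>: "\<bar>\<epsilon> * (s t * (\<tau>0 * g t e0))\<bar> \<le> vol / 4 * (s t)\<^sup>2 + \<tau>m / 4 * N t" for t
  proof -
    have "\<bar>\<epsilon> * (s t * (\<tau>0 * g t e0))\<bar> \<le> \<epsilon> * (\<tau>0 / 2 * (s t)\<^sup>2 + \<tau>0 * Q0 / 2 * N t)"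
      using mult_left_mono[OF cross[of t], of \<epsilon>] \<epsilon>(1) by (simp add: abs_mult)
    also have "\<dots> = (\<epsilon> * \<tau>0) / 2 * (s t)\<^sup>2 + (\<epsilon> * \<tau>0 * Q0) / 2 * N t" by (simp add: algebra_simps)
    also have "\<dots> \<le> (vol / 2) / 2 * (s t)\<^sup>2 + (\<tau>m / 2) / 2 * N t"
      using \<epsilon> N0 by (intro add_mono mult_right_mono divide_right_mono) auto
    finally show ?thesis by simp
  qed
  have Ylow: "vol / 4 * (s t)\<^sup>2 + \<tau>m / 4 * N t \<le> Y t" for t
  proof -
    have "Y t = vol / 2 * (s t)\<^sup>2 + \<sigma> t / 2 + \<epsilon> * (s t * (\<tau>0 * g t e0))" by (simp add: Y_def \<sigma>_def)
    then show ?thesis using cross\<epsilon>[of t] \<sigma>(1)[of t] unfolding abs_le_iff by linarith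
  qed
  define M where "M = max (vol * 3/4) (\<tau>M / 2 + \<tau>m / 4)"
  have M: "0 < M" using vol by (simp add: M_def)
  have Yup: "Y t \<le> M * ((s t)\<^sup>2 + N t)" for t
  proof -
    have "Y t = vol / 2 * (s t)\<^sup>2 + \<sigma> t / 2 + \<epsilon> * (s t * (\<tau>0 * g t e0))" by (simp add: Y_def \<sigma>_def)
    also have "\<dots> \<le> (vol * 3/4) * (s t)\<^sup>2 + (\<tau>M / 2 + \<tau>m / 4) * N t"
      using cross\<epsilon>[of t] \<sigma>(2)[of t] unfolding abs_le_iff by (simp add: algebra_simps)
    also have "\<dots> \<le> M * (s t)\<^sup>2 + M * N t"
      using N0 by (intro add_mono mult_right_mono) (auto simp: M_def)
    finally show ?thesis by (simp add: algebra_simps)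
  qed
  define C where "C = 1 / (\<epsilon> * Q0) + \<epsilon> * \<tau>0 / (2 * vol)"
  define c where "c = min (1/2) (\<epsilon> * Q0 / 2)"
  have c: "0 < c" using \<epsilon> pos by (simp add: c_def)
  have Y'le: "Y' t \<le> - (c / M) * Y t + C * (v t)\<^sup>2" for t
  proof -
    define G where "G = (\<Sum>e\<in>H. g t e)"
    define g0 where "g0 = g t e0"
    define r where "r = s t"
    have "(\<Sum>e\<in>H. g t e * (- g t e - Q e * s t) / Q e) = (\<Sum>e\<in>H. - ((g t e)\<^sup>2 / Q e) - s t * g t e)"
      using tQ(2) by (intro sum.cong refl)
        (simp add: power2_eq_square field_simps less_imp_neq[THEN not_sym])
    also have "\<dots> = - N t - r * G"
      by (simp add: sum_subtractf sum_negf N_def G_def r_def sum_distrib_left)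
    finally have Y': "Y' t = - N t + r * v t + \<epsilon> * ((G + v t) / vol * (\<tau>0 * g0) + r * (- g0 - Q0 * r))"
      by (simp add: Y'_def G_def g0_def r_def algebra_simps)
    \<comment> \<open>The cross term contributes \<open>- \<epsilon> * Q0 * r\<^sup>2\<close>, the
      only damping of \<open>r\<close>. A quarter of it is spent here on the input \<open>v\<close>,
      a quarter in \<open>b\<close> on \<open>g0\<close>, and half remains.\<close>
    have a: "r * v t \<le> \<epsilon> * Q0 / 4 * r\<^sup>2 + (v t)\<^sup>2 / (\<epsilon> * Q0)"
    proof -
      have "0 \<le> (\<epsilon> * Q0 * r - 2 * v t)\<^sup>2 / (4 * (\<epsilon> * Q0))" using \<epsilon> pos by simp
      then show ?thesis using \<epsilon> pos by (simp add: power2_eq_square field_simps)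
    qed
    have g0N: "g0\<^sup>2 \<le> Q0 * N t" using gN[OF H(2), of t] by (simp add: g0_def Q0_def)
    have b: "r * (- g0) \<le> Q0 / 4 * r\<^sup>2 + N t"
    proof -
      have "0 \<le> (Q0 * r + 2 * g0)\<^sup>2 / (4 * Q0)" using pos by simp
      then have "r * (- g0) \<le> Q0 / 4 * r\<^sup>2 + g0\<^sup>2 / Q0" using pos by (simp add: power2_eq_square field_simps)
      also have "g0\<^sup>2 / Q0 \<le> N t" using g0N pos by (simp add: field_simps)
      finally show ?thesis by simp
    qed
    have d: "G * g0 \<le> (Q0 + q) / 2 * N t"
      using sum_squares_bound[of G g0] g0N GN[of t] by (simp add: G_def[symmetric] algebra_simps)
    have f: "v t * g0 \<le> Q0 / 2 * N t + (v t)\<^sup>2 / 2"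
      using sum_squares_bound[of "v t" g0] g0N by simp
    have "(G + v t) / vol * (\<tau>0 * g0) = \<tau>0 / vol * (G * g0) + \<tau>0 / vol * (v t * g0)"
      using vol by (simp add: field_simps)
    also have "\<dots> \<le> \<tau>0 / vol * ((Q0 + q) / 2 * N t) + \<tau>0 / vol * (Q0 / 2 * N t + (v t)\<^sup>2 / 2)"
      using d f pos vol by (intro add_mono mult_left_mono) auto
    also have "\<dots> = (K - 1) * N t + \<tau>0 / (2 * vol) * (v t)\<^sup>2"
      using vol by (simp add: K_def field_simps)
    finally have "(G + v t) / vol * (\<tau>0 * g0) + r * (- g0 - Q0 * r)
        \<le> K * N t - 3/4 * Q0 * r\<^sup>2 + \<tau>0 / (2 * vol) * (v t)\<^sup>2"
      using b by (simp add: power2_eq_square algebra_simps)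
    then have "\<epsilon> * ((G + v t) / vol * (\<tau>0 * g0) + r * (- g0 - Q0 * r))
        \<le> \<epsilon> * (K * N t - 3/4 * Q0 * r\<^sup>2 + \<tau>0 / (2 * vol) * (v t)\<^sup>2)"
      using \<epsilon> by (intro mult_left_mono) auto
    also have "\<dots> = (\<epsilon> * K) * N t - 3/4 * (\<epsilon> * Q0) * r\<^sup>2 + \<epsilon> * \<tau>0 / (2 * vol) * (v t)\<^sup>2"
      by (simp add: algebra_simps)
    also have "\<dots> \<le> 1/2 * N t - 3/4 * (\<epsilon> * Q0) * r\<^sup>2 + \<epsilon> * \<tau>0 / (2 * vol) * (v t)\<^sup>2"
      using \<epsilon>(2) N0[of t] by (intro add_right_mono diff_right_mono mult_right_mono) auto
    finally have "Y' t \<le> - (1/2 * N t) - \<epsilon> * Q0 / 2 * r\<^sup>2 + C * (v t)\<^sup>2"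
      using a by (simp add: Y' C_def algebra_simps)
    moreover have "c \<le> 1/2" "c \<le> \<epsilon> * Q0 / 2" by (auto simp: c_def)
    then have "c * N t \<le> 1/2 * N t" "c * r\<^sup>2 \<le> \<epsilon> * Q0 / 2 * r\<^sup>2"
      using N0[of t] by (auto intro!: mult_right_mono simp del: times_divide_eq_left)
    moreover have "(c / M) * Y t \<le> c * (r\<^sup>2 + N t)"
      using mult_left_mono[OF Yup[of t], of "c / M"] c M by (simp add: r_def)
    ultimately show ?thesis by (simp add: algebra_simps)
  qed
  have nn: "0 \<le> Y t" for t using Ylow[of t] N0[of t] vol pos
    by (smt (verit) divide_nonneg_nonneg mult_nonneg_nonneg zero_le_power2)
  have "((\<lambda>t. C * (v t)\<^sup>2) \<longlongrightarrow> C * 0\<^sup>2) at_top" by (intro tendsto_intros v)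
  then have Y: "(Y \<longlongrightarrow> 0) at_top"
    using comparison_tendsto_0[OF DY _ Y'le nn] c M by simp
  have sb: "(s t)\<^sup>2 \<le> 4 / vol * Y t" for t
  proof -
    have "vol / 4 * (s t)\<^sup>2 \<le> Y t" using Ylow[of t] N0[of t] pos
      by (smt (verit) divide_nonneg_nonneg mult_nonneg_nonneg)
    then show ?thesis using vol by (simp add: field_simps)
  qed
  have gb: "(g t e)\<^sup>2 \<le> Q e * (4 / \<tau>m) * Y t" if e: "e \<in> H" for t e
  proof -
    have "\<tau>m / 4 * N t \<le> Y t" using Ylow[of t] vol
      by (smt (verit) divide_nonneg_nonneg mult_nonneg_nonneg zero_le_power2)
    then have "N t \<le> 4 / \<tau>m * Y t" using pos by (simp add: field_simps)
    then have "Q e * N t \<le> Q e * (4 / \<tau>m * Y t)" using tQ(2)[OF e] by (intro mult_left_mono) auto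
    then show ?thesis using gN[OF e, of t] by (simp add: mult.assoc)
  qed
  show "(s \<longlongrightarrow> 0) at_top" by (rule tendsto_0_if_square_le[OF sb Y])
  show "((\<lambda>t. g t e) \<longlongrightarrow> 0) at_top" if "e \<in> H" by (rule tendsto_0_if_square_le[OF gb[OF that] Y])
qed

section \<open>Swing equations\<close>

definition line_inflow :: "('n::finite \<times> 'n) set \<Rightarrow> ('n \<times> 'n \<Rightarrow> real) \<Rightarrow> real ^ ('n \<times> 'n) \<Rightarrow> 'n \<Rightarrow> real" where
  "line_inflow L B z j = (\<Sum>i | (i, j) \<in> L. B (i, j) * sin (z $ (i, j)))
                       - (\<Sum>k | (j, k) \<in> L. B (j, k) * sin (z $ (j, k)))"

text \<open>The Bregman divergence of the potential with terms \<open>- B l * cos (y $ l)\<close>: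
  its first-order expansion at \<open>z\<close> is removed. The centre \<open>z\<close> is an
  argument because both the equilibrium and a limit point of the angles take this role.\<close>

definition line_energy ::
  "('n::finite \<times> 'n) set \<Rightarrow> ('n \<times> 'n \<Rightarrow> real) \<Rightarrow> real ^ ('n \<times> 'n) \<Rightarrow> real ^ ('n \<times> 'n) \<Rightarrow> real" where
  "line_energy L B z y = (\<Sum>l\<in>L. B l * (cos (z $ l) - cos (y $ l) - sin (z $ l) * (y $ l - z $ l)))"

lemma sum_incident_lines:
  fixes L :: "('n::finite \<times> 'n) set" and f :: "'n \<times> 'n \<Rightarrow> real"
  shows "(\<Sum>j\<in>UNIV. \<Sum>i | (i, j) \<in> L. f (i, j)) = sum f L"
    and "(\<Sum>j\<in>UNIV. \<Sum>k | (j, k) \<in> L. f (j, k)) = sum f L"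
proof -
  have 1: "(\<Sum>j\<in>UNIV. \<Sum>k\<in>UNIV. if (j, k) \<in> L then f (j, k) else 0) = sum f L"
    by (simp add: sum.cartesian_product case_prod_unfold flip: UNIV_Times_UNIV sum.inter_restrict)
      (simp add: sum.If_cases)
  then show "(\<Sum>j\<in>UNIV. \<Sum>k | (j, k) \<in> L. f (j, k)) = sum f L"
    by (simp add: sum.If_cases)
  show "(\<Sum>j\<in>UNIV. \<Sum>i | (i, j) \<in> L. f (i, j)) = sum f L"
    using 1 by (subst (asm) sum.swap) (simp add: sum.If_cases)
qed

text \<open>Summation by parts on the graph. With \<open>a\<close> the frequencies it gives the
  power exchanged with the line potential; with \<open>a\<close> constant it says that the lines
  conserve power.\<close>

lemma sum_mult_line_inflow:
  "(\<Sum>j\<in>UNIV. a j * line_inflow L B z j) = - (\<Sum>l\<in>L. B l * sin (z $ l) * (a (fst l) - a (snd l)))"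
proof -
  define F where "F = (\<lambda>l. B l * sin (z $ l))"
  have "(\<Sum>j\<in>UNIV. a j * line_inflow L B z j) =
      (\<Sum>j\<in>UNIV. \<Sum>i | (i, j) \<in> L. (\<lambda>l. a (snd l) * F l) (i, j))
    - (\<Sum>j\<in>UNIV. \<Sum>k | (j, k) \<in> L. (\<lambda>l. a (fst l) * F l) (j, k))"
    by (simp add: line_inflow_def F_def right_diff_distrib sum_subtractf sum_distrib_left)
  also have "\<dots> = (\<Sum>l\<in>L. a (snd l) * F l) - (\<Sum>l\<in>L. a (fst l) * F l)"
    by (simp only: sum_incident_lines(1)[where f = "\<lambda>l. a (snd l) * F l"]
        sum_incident_lines(2)[where f = "\<lambda>l. a (fst l) * F l"])
  also have "\<dots> = - (\<Sum>l\<in>L. F l * (a (fst l) - a (snd l)))"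
    by (simp add: sum_subtractf[symmetric] sum_negf[symmetric] algebra_simps)
  finally show ?thesis by (simp add: F_def)
qed

lemma line_energy_lower_bound:
  fixes z y :: "real ^ ('n::finite \<times> 'n)"
  assumes B: "\<And>l. l \<in> L \<Longrightarrow> 0 < B l" and c: "0 \<le> c" "c < pi / 2"
    and k: "\<And>l. l \<in> L \<Longrightarrow> k \<le> B l * cos c / 2"
    and z: "\<And>l. l \<in> L \<Longrightarrow> \<bar>z $ l\<bar> \<le> c" and y: "\<And>l. l \<in> L \<Longrightarrow> \<bar>y $ l\<bar> \<le> c"
    and off: "\<And>l. l \<notin> L \<Longrightarrow> y $ l = z $ l"
  shows "k * (norm (y - z))\<^sup>2 \<le> line_energy L B z y"
proof -
  have "(norm (y - z))\<^sup>2 = (\<Sum>l\<in>UNIV. (y $ l - z $ l)\<^sup>2)"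
    by (simp add: norm_vec_def L2_set_def sum_nonneg)
  also have "\<dots> = (\<Sum>l\<in>L. (y $ l - z $ l)\<^sup>2)"
    by (rule sum.mono_neutral_right) (auto simp: off)
  finally have "k * (norm (y - z))\<^sup>2 = (\<Sum>l\<in>L. k * (y $ l - z $ l)\<^sup>2)"
    by (simp add: sum_distrib_left)
  also have "\<dots> \<le> line_energy L B z y"
    unfolding line_energy_def
  proof (rule sum_mono)
    fix l assume l: "l \<in> L"
    have "k * (y $ l - z $ l)\<^sup>2 \<le> B l * cos c / 2 * (y $ l - z $ l)\<^sup>2"
      using k[OF l] by (intro mult_right_mono) auto
    also have "\<dots> = B l * (cos c / 2 * (y $ l - z $ l)\<^sup>2)" by simp
    also have "\<dots> \<le> B l * (cos (z $ l) - cos (y $ l) - sin (z $ l) * (y $ l - z $ l))"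
      using B[OF l] cos_gap_lower_bound[OF c y[OF l] z[OF l]] by (intro mult_left_mono) auto
    finally show "k * (y $ l - z $ l)\<^sup>2 \<le> B l * (cos (z $ l) - cos (y $ l) - sin (z $ l) * (y $ l - z $ l))" .
  qed
  finally show ?thesis .
qed

text \<open>One solution, with frequencies and generation taken as deviations from the equilibrium.
  Only \<open>M j * \<omega> s j\<close> is differentiated, so load buses are included. Generators
  have their own index type because several may act at one bus, as the heat sources do in Mode 2.
  The bus \<open>b\<close> is the only one that may lack damping, and then it has inertia. The
  numbers \<open>c\<close>, \<open>r\<close>, \<open>k\<close> bound the angles, the radius of the
  trapping ball and the convexity of the line energy.\<close>

locale swing_network =
  fixes lines :: "('n::finite \<times> 'n) set" and B :: "'n \<times> 'n \<Rightarrow> real"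
    and M d :: "'n \<Rightarrow> real" and G :: "'g set" and bus :: "'g \<Rightarrow> 'n" and \<tau> Q :: "'g \<Rightarrow> real"
    and b :: 'n and c r k :: real and \<eta>s :: "real ^ ('n \<times> 'n)"
    and \<eta> :: "real \<Rightarrow> real ^ ('n \<times> 'n)" and \<omega> :: "real \<Rightarrow> 'n \<Rightarrow> real" and p :: "real \<Rightarrow> 'g \<Rightarrow> real"
  assumes finite_G: "finite G"
    and connected: "(i, j) \<in> (lines \<union> lines\<inverse>)\<^sup>*"
    and B_pos: "l \<in> lines \<Longrightarrow> 0 < B l"
    and M_nonneg: "0 \<le> M j" and d_nonneg: "0 \<le> d j"
    and damped: "j \<noteq> b \<Longrightarrow> 0 < d j" and inertial: "0 < M b \<or> 0 < d b"
    and \<tau>_pos: "g \<in> G \<Longrightarrow> 0 < \<tau> g" and Q_pos: "g \<in> G \<Longrightarrow> 0 < Q g"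
    and c: "0 \<le> c" "c < pi / 2" and r_pos: "0 < r"
    and k_pos: "0 < k" and k_le: "l \<in> lines \<Longrightarrow> k \<le> B l * cos c / 2"
    and \<eta>s_le: "l \<in> lines \<Longrightarrow> \<bar>\<eta>s $ l\<bar> + r \<le> c"
    and off_lines: "0 \<le> t \<Longrightarrow> l \<notin> lines \<Longrightarrow> \<eta> t $ l = \<eta>s $ l"
    and D\<eta>: "0 \<le> t \<Longrightarrow> (i, j) \<in> lines \<Longrightarrow>
      ((\<lambda>s. \<eta> s $ (i, j)) has_real_derivative \<omega> t i - \<omega> t j) (at t within {0..})"
    and D\<omega>: "0 \<le> t \<Longrightarrow>
      ((\<lambda>s. M j * \<omega> s j) has_real_derivative
        - d j * \<omega> t j + (\<Sum>g | g \<in> G \<and> bus g = j. p t g)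
        + line_inflow lines B (\<eta> t) j - line_inflow lines B \<eta>s j) (at t within {0..})"
    and Dp: "0 \<le> t \<Longrightarrow> g \<in> G \<Longrightarrow>
      ((\<lambda>s. \<tau> g * p s g) has_real_derivative - p t g - Q g * \<omega> t (bus g)) (at t within {0..})"
    and start: "norm (\<eta> 0 - \<eta>s) < r"
    and start_energy: "(\<Sum>j\<in>UNIV. M j * (\<omega> 0 j)\<^sup>2) / 2 + line_energy lines B \<eta>s (\<eta> 0)
      + (\<Sum>g\<in>G. \<tau> g / Q g * (p 0 g)\<^sup>2) / 2 < k * r\<^sup>2"
begin

abbreviation inflow :: "real ^ ('n \<times> 'n) \<Rightarrow> 'n \<Rightarrow> real" where
  "inflow \<equiv> line_inflow lines B"

definition kinetic :: "real \<Rightarrow> real" where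
  "kinetic t = (\<Sum>j\<in>UNIV. M j * (\<omega> t j)\<^sup>2) / 2"

text \<open>The weight \<open>\<tau> g / Q g\<close> normalises the coupling term in the derivative
  to \<open>- \<omega> t (bus g) * p t g\<close>, which cancels the power fed into the kinetic
  energy.\<close>

definition gen_energy :: "real \<Rightarrow> real" where
  "gen_energy t = (\<Sum>g\<in>G. \<tau> g / Q g * (p t g)\<^sup>2) / 2"

definition energy :: "real ^ ('n \<times> 'n) \<Rightarrow> real \<Rightarrow> real" where
  "energy z t = kinetic t + line_energy lines B z (\<eta> t) + gen_energy t"

definition swing :: "real \<Rightarrow> 'n \<Rightarrow> real" where
  "swing t j = - d j * \<omega> t j + (\<Sum>g | g \<in> G \<and> bus g = j. p t g) + inflow (\<eta> t) j - inflow \<eta>s j"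

definition dissipation :: "real \<Rightarrow> real" where
  "dissipation t = (\<Sum>j\<in>UNIV. d j * (\<omega> t j)\<^sup>2) + (\<Sum>g\<in>G. (p t g)\<^sup>2 / Q g)"

section \<open>Energy balance\<close>

lemma D\<omega>': "0 \<le> t \<Longrightarrow> ((\<lambda>s. M j * \<omega> s j) has_real_derivative swing t j) (at t within {0..})"
  unfolding swing_def by (rule D\<omega>)

lemma swing_eq_0: "0 \<le> t \<Longrightarrow> M j = 0 \<Longrightarrow> swing t j = 0"
  using D\<omega>'[of t j] by (simp add: deriv_const_halfline_iff)

lemma D\<omega>_div: "0 \<le> t \<Longrightarrow> 0 < M j \<Longrightarrow>
  ((\<lambda>s. \<omega> s j) has_real_derivative swing t j / M j) (at t within {0..})"
  using DERIV_cdivide[OF D\<omega>', of t j "M j"] by simp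

lemma Dp_div: "0 \<le> t \<Longrightarrow> g \<in> G \<Longrightarrow>
  ((\<lambda>s. p s g) has_real_derivative (- p t g - Q g * \<omega> t (bus g)) / \<tau> g) (at t within {0..})"
  using DERIV_cdivide[OF Dp, of t g "\<tau> g"] \<tau>_pos[of g] by simp

lemma D_kinetic: "0 \<le> t \<Longrightarrow>
  (kinetic has_real_derivative (\<Sum>j\<in>UNIV. \<omega> t j * swing t j)) (at t within {0..})"
proof -
  assume t: "0 \<le> t"
  have "((\<lambda>s. M j * (\<omega> s j)\<^sup>2) has_real_derivative 2 * (\<omega> t j * swing t j)) (at t within {0..})" for j
  \<comment> \<open>Without inertia the power rule for the frequency is not at hand, but both sides
    vanish: the left one by \<open>M j = 0\<close>, the right one by the algebraic
    constraint.\<close>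
  proof (cases "M j = 0")
    case True
    then show ?thesis using swing_eq_0[OF t] by simp
  next
    case False
    then have "0 < M j" using M_nonneg[of j] by simp
    with DERIV_cmult[OF DERIV_power[OF D\<omega>_div[OF t this], of 2], of "M j"] show ?thesis
      by (simp add: mult_ac)
  qed
  then have "(kinetic has_real_derivative (\<Sum>j\<in>UNIV. 2 * (\<omega> t j * swing t j)) / 2) (at t within {0..})"
    unfolding kinetic_def by (intro DERIV_cdivide DERIV_sum)
  then show ?thesis unfolding sum_distrib_left[symmetric] by simp
qed

lemma D_gen_energy: "0 \<le> t \<Longrightarrow>
  (gen_energy has_real_derivative (\<Sum>g\<in>G. - (p t g)\<^sup>2 / Q g - \<omega> t (bus g) * p t g)) (at t within {0..})"
proof -
  assume t: "0 \<le> t"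
  have "((\<lambda>s. \<tau> g / Q g * (p s g)\<^sup>2) has_real_derivative 2 * (- (p t g)\<^sup>2 / Q g - \<omega> t (bus g) * p t g))
      (at t within {0..})" if g: "g \<in> G" for g
  proof -
    have "\<tau> g \<noteq> 0" "Q g \<noteq> 0" using \<tau>_pos[OF g] Q_pos[OF g] by auto
    then show ?thesis
      by (intro DERIV_cong[OF DERIV_cmult[OF DERIV_power[OF Dp_div[OF t g], of 2], of "\<tau> g / Q g"]])
        (simp add: field_simps power2_eq_square)
  qed
  then have "(gen_energy has_real_derivative
      (\<Sum>g\<in>G. 2 * (- (p t g)\<^sup>2 / Q g - \<omega> t (bus g) * p t g)) / 2) (at t within {0..})"
    unfolding gen_energy_def by (intro DERIV_cdivide DERIV_sum)
  then show ?thesis unfolding sum_distrib_left[symmetric] by simp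
qed

lemma D_line_energy: "0 \<le> t \<Longrightarrow>
  ((\<lambda>s. line_energy lines B z (\<eta> s)) has_real_derivative
    (\<Sum>j\<in>UNIV. \<omega> t j * inflow z j) - (\<Sum>j\<in>UNIV. \<omega> t j * inflow (\<eta> t) j)) (at t within {0..})"
proof -
  assume t: "0 \<le> t"
  have "((\<lambda>s. B l * (cos (z $ l) - cos (\<eta> s $ l) - sin (z $ l) * (\<eta> s $ l - z $ l))) has_real_derivative
      B l * sin (\<eta> t $ l) * (\<omega> t (fst l) - \<omega> t (snd l))
      - B l * sin (z $ l) * (\<omega> t (fst l) - \<omega> t (snd l))) (at t within {0..})" if l: "l \<in> lines" for l
  proof -
    obtain i j where ij: "l = (i, j)" by (cases l)
    have D: "((\<lambda>s. \<eta> s $ l) has_real_derivative \<omega> t i - \<omega> t j) (at t within {0..})"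
      using D\<eta>[OF t] l ij by simp
    have "((\<lambda>s. B l * (cos (z $ l) - cos (\<eta> s $ l) - sin (z $ l) * (\<eta> s $ l - z $ l))) has_real_derivative
      B l * (sin (\<eta> t $ l) * (\<omega> t i - \<omega> t j) - sin (z $ l) * (\<omega> t i - \<omega> t j))) (at t within {0..})"
      by (rule derivative_eq_intros D refl | simp)+
    then show ?thesis by (simp add: ij algebra_simps)
  qed
  then have "((\<lambda>s. line_energy lines B z (\<eta> s)) has_real_derivative
      (\<Sum>l\<in>lines. B l * sin (\<eta> t $ l) * (\<omega> t (fst l) - \<omega> t (snd l))
        - B l * sin (z $ l) * (\<omega> t (fst l) - \<omega> t (snd l)))) (at t within {0..})"
    unfolding line_energy_def by (rule DERIV_sum)
  then show ?thesis by (simp add: sum_mult_line_inflow sum_subtractf)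
qed

lemma sum_gens_by_bus: "(\<Sum>j\<in>UNIV. \<Sum>g | g \<in> G \<and> bus g = j. f g) = sum f G"
  using sum.group[OF finite_G finite_class.finite_UNIV, of bus f] by simp

text \<open>All exchange terms between the three energies cancel. The centre enters the derivative
  only through its inflows, so any angles with the inflows of the equilibrium are as good a
  centre.\<close>

lemma D_energy:
  assumes t: "0 \<le> t" and z: "\<And>j. inflow z j = inflow \<eta>s j"
  shows "(energy z has_real_derivative - dissipation t) (at t within {0..})"
proof -
  have "(\<Sum>j\<in>UNIV. \<omega> t j * (\<Sum>g | g \<in> G \<and> bus g = j. p t g)) = (\<Sum>g\<in>G. \<omega> t (bus g) * p t g)"
  proof -
    have "(\<Sum>j\<in>UNIV. \<omega> t j * (\<Sum>g | g \<in> G \<and> bus g = j. p t g)) =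
        (\<Sum>j\<in>UNIV. \<Sum>g | g \<in> G \<and> bus g = j. \<omega> t (bus g) * p t g)"
      by (auto simp: sum_distrib_left intro!: sum.cong)
    then show ?thesis by (simp only: sum_gens_by_bus)
  qed
  then have "(\<Sum>j\<in>UNIV. \<omega> t j * swing t j) = - (\<Sum>j\<in>UNIV. d j * (\<omega> t j)\<^sup>2) + (\<Sum>g\<in>G. \<omega> t (bus g) * p t g)
      + (\<Sum>j\<in>UNIV. \<omega> t j * inflow (\<eta> t) j) - (\<Sum>j\<in>UNIV. \<omega> t j * inflow z j)"
    by (simp add: swing_def z distrib_left right_diff_distrib sum.distrib sum_subtractf sum_negf power2_eq_square mult_ac)
  moreover have "(\<Sum>g\<in>G. - (p t g)\<^sup>2 / Q g - \<omega> t (bus g) * p t g) =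
      - (\<Sum>g\<in>G. (p t g)\<^sup>2 / Q g) - (\<Sum>g\<in>G. \<omega> t (bus g) * p t g)"
    by (simp add: sum_subtractf sum_negf)
  ultimately have "(\<Sum>j\<in>UNIV. \<omega> t j * swing t j) +
      ((\<Sum>j\<in>UNIV. \<omega> t j * inflow z j) - (\<Sum>j\<in>UNIV. \<omega> t j * inflow (\<eta> t) j)) +
      (\<Sum>g\<in>G. - (p t g)\<^sup>2 / Q g - \<omega> t (bus g) * p t g) = - dissipation t"
    by (simp add: dissipation_def)
  moreover have "(energy z has_real_derivative (\<Sum>j\<in>UNIV. \<omega> t j * swing t j) +
      ((\<Sum>j\<in>UNIV. \<omega> t j * inflow z j) - (\<Sum>j\<in>UNIV. \<omega> t j * inflow (\<eta> t) j)) +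
      (\<Sum>g\<in>G. - (p t g)\<^sup>2 / Q g - \<omega> t (bus g) * p t g)) (at t within {0..})"
    unfolding energy_def by (intro DERIV_add D_kinetic D_line_energy D_gen_energy t)
  ultimately show ?thesis by simp
qed

section \<open>Trapping near the equilibrium\<close>

lemma kinetic_nonneg: "0 \<le> kinetic t"
  unfolding kinetic_def by (simp add: sum_nonneg M_nonneg)

lemma gen_energy_nonneg: "0 \<le> gen_energy t"
  unfolding gen_energy_def
  by (intro divide_nonneg_nonneg sum_nonneg mult_nonneg_nonneg) (auto simp: less_imp_le \<tau>_pos Q_pos)

lemma dissipation_ge:
  "d j * (\<omega> t j)\<^sup>2 \<le> dissipation t" "g \<in> G \<Longrightarrow> (p t g)\<^sup>2 / Q g \<le> dissipation t"
  and dissipation_nonneg: "0 \<le> dissipation t"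
proof -
  have 1: "0 \<le> (\<Sum>j\<in>UNIV. d j * (\<omega> t j)\<^sup>2)" by (intro sum_nonneg) (simp add: d_nonneg)
  have 2: "0 \<le> (\<Sum>g\<in>G. (p t g)\<^sup>2 / Q g)" by (intro sum_nonneg) (simp add: Q_pos less_imp_le)
  show "0 \<le> dissipation t" using 1 2 by (simp add: dissipation_def)
  have "d j * (\<omega> t j)\<^sup>2 \<le> (\<Sum>j\<in>UNIV. d j * (\<omega> t j)\<^sup>2)"
    by (rule member_le_sum) (auto simp: d_nonneg)
  then show "d j * (\<omega> t j)\<^sup>2 \<le> dissipation t" using 2 by (simp add: dissipation_def)
  assume "g \<in> G"
  then have "(p t g)\<^sup>2 / Q g \<le> (\<Sum>g\<in>G. (p t g)\<^sup>2 / Q g)"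
    by (intro member_le_sum finite_G) (auto simp: Q_pos less_imp_le)
  then show "(p t g)\<^sup>2 / Q g \<le> dissipation t" using 1 by (simp add: dissipation_def)
qed

lemma energy_antimono:
  assumes "\<And>j. inflow z j = inflow \<eta>s j" "0 \<le> s" "s \<le> t"
  shows "energy z t \<le> energy z s"
  by (rule nonincreasing_halfline[OF D_energy[OF _ assms(1)], of s]) (use assms dissipation_nonneg in auto)

lemma line_angle_le:
  assumes "norm (y - \<eta>s) \<le> r" "l \<in> lines"
  shows "\<bar>y $ l\<bar> \<le> c"
proof -
  have "\<bar>(y - \<eta>s) $ l\<bar> \<le> r" using component_le_norm_cart[of "y - \<eta>s" l] assms(1) by linarith
  then show ?thesis using \<eta>s_le[OF assms(2)] by simp
qed

lemma line_energy_ge: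
  assumes "norm (y - \<eta>s) \<le> r" "norm (z - \<eta>s) \<le> r" "\<And>l. l \<notin> lines \<Longrightarrow> y $ l = z $ l"
  shows "k * (norm (y - z))\<^sup>2 \<le> line_energy lines B z y"
  using assms line_angle_le by (intro line_energy_lower_bound[OF B_pos c k_le])

lemma continuous_\<eta>: "continuous_on {0..} \<eta>"
proof -
  have "continuous_on {0..} (\<lambda>t. \<eta> t $ l)" for l
  proof (cases "l \<in> lines")
    case True
    then show ?thesis using D\<eta>[of _ "fst l" "snd l"]
      by (auto simp: continuous_on_eq_continuous_within intro!: DERIV_continuous)
  next
    case False
    then show ?thesis using off_lines by (subst continuous_on_cong[OF refl, where g = "\<lambda>_. \<eta>s $ l"]) auto
  qed
  then have "continuous_on {0..} (\<lambda>t. \<chi> l. \<eta> t $ l)" by (intro continuous_on_vec_lambda)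
  then show ?thesis by simp
qed

text \<open>On the sphere of radius \<open>r\<close> the energy is at least \<open>k * r\<^sup>2\<close>, a level it never reaches.\<close>

lemma trapped:
  assumes t: "0 \<le> t"
  shows "norm (\<eta> t - \<eta>s) < r"
proof (rule ccontr)
  assume "\<not> norm (\<eta> t - \<eta>s) < r"
  moreover have "continuous_on {0..t} (\<lambda>s. norm (\<eta> s - \<eta>s))"
    by (intro continuous_intros continuous_on_subset[OF continuous_\<eta>]) auto
  ultimately obtain s where s: "0 \<le> s" "norm (\<eta> s - \<eta>s) = r"
    using IVT'[of "\<lambda>s. norm (\<eta> s - \<eta>s)" 0 r t] start t by auto
  have "k * r\<^sup>2 \<le> line_energy lines B \<eta>s (\<eta> s)"
    using line_energy_ge[of "\<eta> s" \<eta>s] s off_lines r_pos by auto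
  also have "\<dots> \<le> energy \<eta>s s" using kinetic_nonneg[of s] gen_energy_nonneg[of s] by (simp add: energy_def)
  also have "\<dots> \<le> energy \<eta>s 0" using energy_antimono[of \<eta>s 0 s] s by simp
  also have "\<dots> < k * r\<^sup>2" using start_energy by (simp add: energy_def kinetic_def gen_energy_def)
  finally show False by simp
qed

lemma energy_nonneg:
  assumes "0 \<le> t" "norm (z - \<eta>s) \<le> r" "\<And>l. l \<notin> lines \<Longrightarrow> z $ l = \<eta>s $ l"
  shows "0 \<le> line_energy lines B z (\<eta> t)" "0 \<le> energy z t"
proof -
  have "0 \<le> k * (norm (\<eta> t - z))\<^sup>2" using k_pos by simp
  also have "\<dots> \<le> line_energy lines B z (\<eta> t)"
    using trapped[OF assms(1)] assms off_lines by (intro line_energy_ge) auto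
  finally show "0 \<le> line_energy lines B z (\<eta> t)" .
  then show "0 \<le> energy z t"
    using kinetic_nonneg[of t] gen_energy_nonneg[of t] by (simp add: energy_def)
qed

lemma kinetic_gen_le: "0 \<le> t \<Longrightarrow> kinetic t + gen_energy t \<le> energy \<eta>s 0"
  using energy_nonneg(1)[of t \<eta>s] energy_antimono[of \<eta>s 0 t] r_pos by (simp add: energy_def)

section \<open>Uniform bounds and Lipschitz continuity of the trajectory\<close>

lemma bdd_inflow: "bdd_halfline (\<lambda>t. inflow (\<eta> t) j)"
  unfolding line_inflow_def by (intro bdd_halfline_diff bdd_halfline_sum bdd_halfline_mult) auto

lemma bdd_p: "g \<in> G \<Longrightarrow> bdd_halfline (\<lambda>t. p t g)"
proof (rule bdd_halfline_if_square_le)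
  fix t :: real assume t: "0 \<le> t" and g: "g \<in> G"
  have "\<tau> g / Q g * (p t g)\<^sup>2 \<le> (\<Sum>g\<in>G. \<tau> g / Q g * (p t g)\<^sup>2)"
    using g \<tau>_pos Q_pos finite_G
    by (intro member_le_sum mult_nonneg_nonneg divide_nonneg_nonneg) (auto intro: less_imp_le)
  also have "\<dots> \<le> 2 * energy \<eta>s 0"
    using kinetic_gen_le[OF t] kinetic_nonneg[of t] by (simp add: gen_energy_def)
  finally show "(p t g)\<^sup>2 \<le> 2 * energy \<eta>s 0 * (Q g / \<tau> g)"
    using \<tau>_pos[OF g] Q_pos[OF g] by (simp add: field_simps)
qed

lemma bdd_gens: "bdd_halfline (\<lambda>t. \<Sum>g | g \<in> G \<and> bus g = j. p t g)"
  using bdd_p by (intro bdd_halfline_sum) auto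

lemma damped_if_no_inertia: "M j = 0 \<Longrightarrow> 0 < d j"
  using damped[of j] inertial by (cases "j = b") auto

text \<open>At a bus without inertia neither the kinetic energy nor a differential equation controls
  the frequency. Solving the constraint lets it inherit first boundedness and then the Lipschitz
  property from generation and inflow.\<close>

lemma \<omega>_algebraic: "0 \<le> t \<Longrightarrow> M j = 0 \<Longrightarrow>
  \<omega> t j = ((\<Sum>g | g \<in> G \<and> bus g = j. p t g) + inflow (\<eta> t) j - inflow \<eta>s j) / d j"
  using swing_eq_0[of t j] damped_if_no_inertia[of j] by (simp add: swing_def field_simps)

lemma bdd_\<omega>: "bdd_halfline (\<lambda>t. \<omega> t j)"
proof (cases "M j = 0")
  case True
  then show ?thesis
    by (subst bdd_halfline_cong[OF \<omega>_algebraic])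
      (intro bdd_halfline_divide bdd_halfline_diff bdd_halfline_add bdd_inflow bdd_gens bdd_halfline_const
        | assumption)+
next
  case False
  then have M: "0 < M j" using M_nonneg[of j] by simp
  show ?thesis
  proof (rule bdd_halfline_if_square_le)
    fix t :: real assume t: "0 \<le> t"
    have "M j * (\<omega> t j)\<^sup>2 \<le> (\<Sum>j\<in>UNIV. M j * (\<omega> t j)\<^sup>2)"
      by (intro member_le_sum) (auto simp: M_nonneg)
    also have "\<dots> \<le> 2 * energy \<eta>s 0"
      using kinetic_gen_le[OF t] gen_energy_nonneg[of t] by (simp add: kinetic_def)
    finally show "(\<omega> t j)\<^sup>2 \<le> 2 * energy \<eta>s 0 / M j" using M by (simp add: field_simps)
  qed
qed

lemma Lip_p: "g \<in> G \<Longrightarrow> bdd_Lipschitz (\<lambda>t. p t g)"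
  by (rule bdd_Lipschitz_if_bdd_halfline_deriv[OF Dp_div])
    (intro bdd_p bdd_\<omega> bdd_halfline_divide bdd_halfline_diff bdd_halfline_minus bdd_halfline_mult
      bdd_halfline_const | assumption)+

lemma Lip_\<eta>: "bdd_Lipschitz (\<lambda>t. \<eta> t $ l)"
proof (cases "l \<in> lines")
  case True
  show ?thesis
  proof (rule bdd_Lipschitz_if_bdd_halfline_deriv)
    show "((\<lambda>t. \<eta> t $ l) has_real_derivative \<omega> t (fst l) - \<omega> t (snd l)) (at t within {0..})"
      if "0 \<le> t" for t
      using D\<eta>[OF that, of "fst l" "snd l"] True by simp
    show "bdd_halfline (\<lambda>t. \<eta> t $ l)"
      using line_angle_le[OF less_imp_le[OF trapped] True] by (rule bdd_halflineI)
  qed (auto intro!: bdd_\<omega>)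
next
  case False
  then show ?thesis by (subst bdd_Lipschitz_cong[OF off_lines]) auto
qed

lemma Lip_inflow: "bdd_Lipschitz (\<lambda>t. inflow (\<eta> t) j)"
  unfolding line_inflow_def
  by (intro bdd_Lipschitz_diff bdd_Lipschitz_sum bdd_Lipschitz_mult bdd_Lipschitz_sin Lip_\<eta>) auto

lemma Lip_gens: "bdd_Lipschitz (\<lambda>t. \<Sum>g | g \<in> G \<and> bus g = j. p t g)"
  using Lip_p by (intro bdd_Lipschitz_sum) auto

lemma bdd_swing: "bdd_halfline (\<lambda>t. swing t j)"
  unfolding swing_def
  by (intro bdd_halfline_diff bdd_halfline_add bdd_halfline_mult bdd_inflow bdd_gens bdd_\<omega>) auto

lemma Lip_\<omega>: "bdd_Lipschitz (\<lambda>t. \<omega> t j)"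
proof (cases "M j = 0")
  case True
  then show ?thesis
    by (subst bdd_Lipschitz_cong[OF \<omega>_algebraic])
      (intro bdd_Lipschitz_divide bdd_Lipschitz_diff bdd_Lipschitz_add Lip_inflow Lip_gens bdd_Lipschitz_const
        | assumption)+
next
  case False
  then have M: "0 < M j" using M_nonneg[of j] by simp
  show ?thesis
    by (rule bdd_Lipschitz_if_bdd_halfline_deriv[OF D\<omega>_div[OF _ M]]) (auto intro!: bdd_swing bdd_\<omega>)
qed

lemma Lip_swing: "bdd_Lipschitz (\<lambda>t. swing t j)"
  unfolding swing_def
  by (intro bdd_Lipschitz_diff bdd_Lipschitz_add bdd_Lipschitz_mult Lip_inflow Lip_gens Lip_\<omega>) auto

section \<open>Limits of frequencies, generation and power flows\<close>

lemma dissipation_tendsto: "(dissipation \<longlongrightarrow> 0) at_top"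
proof -
  have anti: "energy \<eta>s t \<le> energy \<eta>s s" if "0 \<le> s" "s \<le> t" for s t
    using energy_antimono that by blast
  have nonneg: "0 \<le> energy \<eta>s t" if "0 \<le> t" for t
    using energy_nonneg(2)[OF that, of \<eta>s] r_pos by simp
  obtain e where "(energy \<eta>s \<longlongrightarrow> e) at_top"
    by (rule nonincreasing_convergent[OF anti nonneg])
  moreover have "bdd_Lipschitz (\<lambda>t. - dissipation t)"
    unfolding dissipation_def power2_eq_square
    by (intro bdd_Lipschitz_minus bdd_Lipschitz_add bdd_Lipschitz_sum bdd_Lipschitz_mult
        bdd_Lipschitz_divide bdd_Lipschitz_const Lip_\<omega> Lip_p)
  ultimately have "((\<lambda>t. - dissipation t) \<longlongrightarrow> 0) at_top"
    by (intro barbalat'[OF D_energy[OF _ refl]])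
  from tendsto_minus[OF this] show ?thesis by simp
qed

lemma \<omega>_tendsto_damped:
  assumes "0 < d j"
  shows "((\<lambda>t. \<omega> t j) \<longlongrightarrow> 0) at_top"
  by (rule tendsto_0_if_square_le[where k = "inverse (d j)", OF _ dissipation_tendsto])
    (use dissipation_ge(1)[of j] assms in \<open>simp add: field_simps\<close>)

lemma p_tendsto:
  assumes "g \<in> G"
  shows "((\<lambda>t. p t g) \<longlongrightarrow> 0) at_top"
  by (rule tendsto_0_if_square_le[where k = "Q g", OF _ dissipation_tendsto])
    (use dissipation_ge(2)[OF assms] Q_pos[OF assms] in \<open>simp add: field_simps\<close>)

text \<open>Generation already tends to 0, so Barbalat's lemma applies to its own equation and
  leaves the frequency as the only term. This settles an undamped bus that carries a
  generator.\<close>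

lemma \<omega>_tendsto_gen:
  assumes "g \<in> G"
  shows "((\<lambda>t. \<omega> t (bus g)) \<longlongrightarrow> 0) at_top"
proof -
  have "((\<lambda>t. - p t g - Q g * \<omega> t (bus g)) \<longlongrightarrow> 0) at_top"
    by (rule barbalat'[OF Dp[OF _ assms] _ tendsto_mult_right_zero[OF p_tendsto[OF assms]]])
      (intro bdd_Lipschitz_diff bdd_Lipschitz_minus bdd_Lipschitz_mult bdd_Lipschitz_const Lip_p Lip_\<omega> assms
        | assumption)+
  from tendsto_add[OF this p_tendsto[OF assms]]
  have "((\<lambda>t. - (1 / Q g) * (- (Q g * \<omega> t (bus g)))) \<longlongrightarrow> 0) at_top"
    by (intro tendsto_mult_right_zero) simp
  then show ?thesis using Q_pos[OF assms] by simp
qed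

lemma gens_tendsto: "((\<lambda>t. \<Sum>g | g \<in> G \<and> bus g = j. p t g) \<longlongrightarrow> 0) at_top"
  using p_tendsto by (intro tendsto_null_sum) auto

text \<open>Barbalat's lemma for \<open>M j * \<omega> t j\<close>, whose derivative is the
  imbalance. The product \<open>d j * w\<close> covers both a vanishing frequency and a lone
  undamped bus whose frequency has a nonzero limit.\<close>

lemma inflow_tendsto_if:
  assumes "((\<lambda>t. \<omega> t j) \<longlongrightarrow> w) at_top" "d j * w = 0"
  shows "((\<lambda>t. inflow (\<eta> t) j) \<longlongrightarrow> inflow \<eta>s j) at_top"
proof -
  have "((\<lambda>t. swing t j) \<longlongrightarrow> 0) at_top"
    by (rule barbalat'[OF D\<omega>' Lip_swing tendsto_mult_left[OF assms(1)]])
  then have "((\<lambda>t. swing t j + d j * \<omega> t j - (\<Sum>g | g \<in> G \<and> bus g = j. p t g) + inflow \<eta>s j)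
      \<longlongrightarrow> 0 + d j * w - 0 + inflow \<eta>s j) at_top"
    by (intro tendsto_intros assms gens_tendsto)
  then show ?thesis using assms(2) by (simp add: swing_def)
qed

text \<open>Self-loops are allowed among the lines and must not make \<open>b\<close> its own
  neighbour.\<close>

definition neighbour :: "'n \<Rightarrow> bool" where
  "neighbour j \<longleftrightarrow> j \<noteq> b \<and> ((b, j) \<in> lines \<or> (j, b) \<in> lines)"

text \<open>
  The derivative of the power flow into a neighbour of the undamped bus vanishes asymptotically,
  and so do all frequencies in it except \<open>\<omega> t b\<close>, whose coefficient is at least \<open>2 * k\<close>.
\<close>

lemma \<omega>_tendsto_neighbour:
  assumes j: "neighbour j"
  shows "((\<lambda>t. \<omega> t b) \<longlongrightarrow> 0) at_top"
proof -
  have jb: "j \<noteq> b" using j by (simp add: neighbour_def)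
  define I where "I = {i. (i, j) \<in> lines}"
  define O' where "O' = {i. (j, i) \<in> lines}"
  \<comment> \<open>\<open>w\<close> suppresses the one frequency whose limit is still unknown and
    \<open>\<delta>\<close> marks it. The derivative \<open>f'\<close> of the inflow at
    \<open>j\<close> then splits into \<open>R\<close>, which tends to 0, and
    \<open>\<beta> t * \<omega> t b\<close>.\<close>
  define w where "w = (\<lambda>t i. if i = b then 0 else \<omega> t i)"
  define \<delta> where "\<delta> = (\<lambda>i. if i = b then 1 else 0 :: real)"
  define f' where "f' = (\<lambda>t. (\<Sum>i\<in>I. B (i, j) * (cos (\<eta> t $ (i, j)) * (\<omega> t i - \<omega> t j)))
                           - (\<Sum>i\<in>O'. B (j, i) * (cos (\<eta> t $ (j, i)) * (\<omega> t j - \<omega> t i))))"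
  define R where "R = (\<lambda>t. (\<Sum>i\<in>I. B (i, j) * (cos (\<eta> t $ (i, j)) * (w t i - w t j)))
                          + (\<Sum>i\<in>O'. B (j, i) * (cos (\<eta> t $ (j, i)) * (w t i - w t j))))"
  define \<beta> where "\<beta> = (\<lambda>t. (\<Sum>i\<in>I. B (i, j) * cos (\<eta> t $ (i, j)) * \<delta> i)
                          + (\<Sum>i\<in>O'. B (j, i) * cos (\<eta> t $ (j, i)) * \<delta> i))"
  have w: "((\<lambda>t. w t i) \<longlongrightarrow> 0) at_top" for i
    using \<omega>_tendsto_damped[OF damped[of i]] by (cases "i = b") (auto simp: w_def)
  have \<omega>w: "\<omega> t i = w t i + \<delta> i * \<omega> t b" for t i by (simp add: w_def \<delta>_def)
  have "((\<lambda>s. B l * sin (\<eta> s $ l)) has_real_derivative B l * (cos (\<eta> t $ l) * (\<omega> t (fst l) - \<omega> t (snd l))))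
      (at t within {0..})" if "0 \<le> t" "l \<in> lines" for t l
  proof -
    have D: "((\<lambda>s. \<eta> s $ l) has_real_derivative \<omega> t (fst l) - \<omega> t (snd l)) (at t within {0..})"
      using D\<eta>[OF that(1), of "fst l" "snd l"] that(2) by simp
    show ?thesis by (rule derivative_eq_intros D refl | simp)+
  qed
  then have D: "((\<lambda>s. inflow (\<eta> s) j) has_real_derivative f' t) (at t within {0..})" if "0 \<le> t" for t
    unfolding line_inflow_def f'_def I_def O'_def
    using that by (intro DERIV_diff DERIV_sum) fastforce+
  have "((\<lambda>t. inflow (\<eta> t) j) \<longlongrightarrow> inflow \<eta>s j) at_top"
    by (rule inflow_tendsto_if[OF \<omega>_tendsto_damped[OF damped[OF jb]]]) simp
  moreover have "bdd_Lipschitz f'"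
    unfolding f'_def
    by (intro bdd_Lipschitz_diff bdd_Lipschitz_sum bdd_Lipschitz_mult bdd_Lipschitz_cos Lip_\<eta> Lip_\<omega>
        bdd_Lipschitz_const)
  ultimately have f': "(f' \<longlongrightarrow> 0) at_top" using barbalat'[OF D] by blast
  have prod0: "((\<lambda>t. B l * (cos (\<eta> t $ l) * (w t i - w t j))) \<longlongrightarrow> 0) at_top" for l i
  proof -
    have "((\<lambda>t. w t i - w t j) \<longlongrightarrow> 0) at_top" using tendsto_diff[OF w w] by simp
    then have "((\<lambda>t. (w t i - w t j) * cos (\<eta> t $ l)) \<longlongrightarrow> 0) at_top"
      by (rule lim_null_mult_right_bounded[where B = 1]) simp
    then show ?thesis by (intro tendsto_mult_right_zero) (simp add: mult.commute)
  qed
  have R: "(R \<longlongrightarrow> 0) at_top"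
    unfolding R_def by (intro tendsto_add_zero tendsto_null_sum prod0)
  have eq: "f' t = R t + \<beta> t * \<omega> t b" for t
  proof -
    have "f' t = (\<Sum>i\<in>I. B (i, j) * (cos (\<eta> t $ (i, j)) * (\<omega> t i - \<omega> t j)))
               + (\<Sum>i\<in>O'. B (j, i) * (cos (\<eta> t $ (j, i)) * (\<omega> t i - \<omega> t j)))"
    proof -
      have "(\<Sum>i\<in>O'. B (j, i) * (cos (\<eta> t $ (j, i)) * (\<omega> t j - \<omega> t i))) =
          - (\<Sum>i\<in>O'. B (j, i) * (cos (\<eta> t $ (j, i)) * (\<omega> t i - \<omega> t j)))"
        by (simp add: sum_negf[symmetric] right_diff_distrib)
      then show ?thesis by (simp add: f'_def)
    qed
    moreover have "\<omega> t i - \<omega> t j = (w t i - w t j) + \<delta> i * \<omega> t b" for i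
      using jb by (subst \<omega>w[of t i]) (simp add: w_def)
    ultimately show ?thesis
      unfolding R_def \<beta>_def
      by (simp add: distrib_left distrib_right sum.distrib sum_distrib_right sum_distrib_left mult_ac)
  qed
  have cos_ge: "2 * k \<le> B l * cos (\<eta> t $ l)" if t: "0 \<le> t" and l: "l \<in> lines" for t l
  proof -
    have "cos c \<le> cos \<bar>\<eta> t $ l\<bar>"
      using line_angle_le[OF less_imp_le[OF trapped[OF t]] l] c pi_gt_zero by (intro cos_monotone_0_pi_le) auto
    then have "B l * cos c \<le> B l * cos (\<eta> t $ l)" using B_pos[OF l] by (intro mult_left_mono) auto
    then show ?thesis using k_le[OF l] by simp
  qed
  have \<beta>: "2 * k \<le> \<beta> t" if t: "0 \<le> t" for t
  proof -
    define e1 where "e1 = (\<lambda>i. B (i, j) * cos (\<eta> t $ (i, j)) * \<delta> i)"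
    define e2 where "e2 = (\<lambda>i. B (j, i) * cos (\<eta> t $ (j, i)) * \<delta> i)"
    have n1: "0 \<le> e1 i" if "i \<in> I" for i
      using cos_ge[OF t, of "(i, j)"] that k_pos by (simp add: e1_def I_def \<delta>_def)
    have n2: "0 \<le> e2 i" if "i \<in> O'" for i
      using cos_ge[OF t, of "(j, i)"] that k_pos by (simp add: e2_def O'_def \<delta>_def)
    have s: "0 \<le> sum e1 I" "0 \<le> sum e2 O'" using n1 n2 by (auto intro: sum_nonneg)
    have \<beta>eq: "\<beta> t = sum e1 I + sum e2 O'" by (simp add: \<beta>_def e1_def e2_def)
    from j consider "b \<in> I" | "b \<in> O'" by (auto simp: neighbour_def I_def O'_def)
    then show ?thesis
    proof cases
      case 1
      then have "e1 b \<le> sum e1 I" using n1 by (intro member_le_sum) auto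
      moreover have "2 * k \<le> e1 b" using 1 cos_ge[OF t, of "(b, j)"] by (simp add: e1_def I_def \<delta>_def)
      ultimately show ?thesis using s \<beta>eq by simp
    next
      case 2
      then have "e2 b \<le> sum e2 O'" using n2 by (intro member_le_sum) auto
      moreover have "2 * k \<le> e2 b" using 2 cos_ge[OF t, of "(j, b)"] by (simp add: e2_def O'_def \<delta>_def)
      ultimately show ?thesis using s \<beta>eq by simp
    qed
  qed
  have "((\<lambda>t. \<bar>f' t - R t\<bar> / (2 * k)) \<longlongrightarrow> \<bar>0 - 0\<bar> / (2 * k)) at_top"
    using k_pos by (intro tendsto_intros f' R) auto
  then have lim: "((\<lambda>t. \<bar>f' t - R t\<bar> / (2 * k)) \<longlongrightarrow> 0) at_top" by simp
  show ?thesis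
  proof (rule Lim_null_comparison[OF _ lim])
    show "\<forall>\<^sub>F t in at_top. norm (\<omega> t b) \<le> \<bar>f' t - R t\<bar> / (2 * k)"
      using eventually_ge_at_top[of 0]
    proof eventually_elim
      case (elim t)
      have "2 * k * \<bar>\<omega> t b\<bar> \<le> \<bar>\<beta> t\<bar> * \<bar>\<omega> t b\<bar>"
        using \<beta>[OF elim] by (intro mult_right_mono) auto
      also have "\<dots> = \<bar>f' t - R t\<bar>" by (simp add: eq abs_mult)
      finally show ?case using k_pos by (simp add: field_simps)
    qed
  qed
qed

lemma univ_eq_if_no_neighbour:
  assumes "\<And>j. \<not> neighbour j"
  shows "UNIV = {b}"
proof -
  have "i = b" for i
    using connected[of b i] by induction (use assms in \<open>auto simp: neighbour_def\<close>)
  then show ?thesis by auto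
qed

text \<open>An undamped bus is \<open>b\<close>, and its frequency vanishes in the limit if it has a
  neighbour or a generator. With neither, connectedness makes it the whole network; it then has no
  power exchange at all and keeps its frequency forever.\<close>

lemma \<omega>_convergent:
  "\<exists>w. ((\<lambda>t. \<omega> t j) \<longlongrightarrow> w) at_top \<and> (w = 0 \<or> d j = 0 \<and> UNIV = {j} \<and> (\<forall>g\<in>G. bus g \<noteq> j))"
proof (cases "d j = 0 \<and> (\<forall>g\<in>G. bus g \<noteq> j) \<and> (\<forall>i. \<not> neighbour i)")
  case True
  then have jb: "j = b" and U: "UNIV = {b}" using damped[of j] univ_eq_if_no_neighbour by force+
  have no_gens: "{g \<in> G. bus g = j} = {}" using True by auto
  \<comment> \<open>With a single bus every line is a self-loop, so inflow and outflow
    coincide.\<close>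
  have flow0: "inflow z j = 0" for z
  proof -
    have "{i. (i, j) \<in> lines} = {i. (j, i) \<in> lines}" using U jb by (metis UNIV_I singletonD)
    moreover have "B (i, j) * sin (z $ (i, j)) = B (j, i) * sin (z $ (j, i))" for i
      using U jb by (metis UNIV_I singletonD)
    ultimately show ?thesis by (simp add: line_inflow_def)
  qed
  have M: "0 < M j" using inertial True jb by simp
  have D0: "((\<lambda>s. \<omega> s j) has_real_derivative 0) (at t within {0..})" if "0 \<le> t" for t
    using D\<omega>_div[OF that M] True no_gens flow0 by (simp add: swing_def)
  have "\<forall>\<^sub>F t in at_top. \<omega> t j = \<omega> 0 j"
    using eventually_ge_at_top[of 0]
    by eventually_elim (rule constant_halfline[where f = "\<lambda>s. \<omega> s j", OF D0])
  then have "((\<lambda>t. \<omega> t j) \<longlongrightarrow> \<omega> 0 j) at_top"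
    by (rule tendsto_eventually)
  moreover have "d j = 0 \<and> UNIV = {j} \<and> (\<forall>g\<in>G. bus g \<noteq> j)" using True U jb by simp
  ultimately show ?thesis by (intro exI[of _ "\<omega> 0 j"] conjI[OF _ disjI2])
next
  case False
  have "((\<lambda>t. \<omega> t j) \<longlongrightarrow> 0) at_top"
  proof (cases "d j = 0")
    case d: True
    then have jb: "j = b" using damped[of j] by force
    show ?thesis
    proof (cases "\<exists>i. neighbour i")
      case True
      then show ?thesis unfolding jb by (elim exE) (rule \<omega>_tendsto_neighbour)
    next
      case no_nb: False
      then obtain g where "g \<in> G" "bus g = j" using False d by auto
      then show ?thesis using \<omega>_tendsto_gen[of g] by simp
    qed
  next
    case False
    then have "0 < d j" using d_nonneg[of j] by simp
    then show ?thesis by (rule \<omega>_tendsto_damped)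
  qed
  then show ?thesis by (intro exI[of _ 0] conjI disjI1 refl)
qed

theorem converges:
  obtains z w where "(\<eta> \<longlongrightarrow> z) at_top" "\<And>l. l \<notin> lines \<Longrightarrow> z $ l = \<eta>s $ l"
    "\<And>j. inflow z j = inflow \<eta>s j" "\<And>j. ((\<lambda>t. \<omega> t j) \<longlongrightarrow> w j) at_top"
    "\<And>j. w j = 0 \<or> d j = 0 \<and> UNIV = {j} \<and> (\<forall>g\<in>G. bus g \<noteq> j)"
    "\<And>j. ((\<lambda>t. inflow (\<eta> t) j) \<longlongrightarrow> inflow \<eta>s j) at_top"
proof -
  obtain w where w: "\<And>j. ((\<lambda>t. \<omega> t j) \<longlongrightarrow> w j) at_top"
    and w0: "\<And>j. w j = 0 \<or> d j = 0 \<and> UNIV = {j} \<and> (\<forall>g\<in>G. bus g \<noteq> j)"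
    using \<omega>_convergent by metis
  have flow: "((\<lambda>t. inflow (\<eta> t) j) \<longlongrightarrow> inflow \<eta>s j) at_top" for j
    using inflow_tendsto_if[OF w[of j]] w0[of j] by auto
  have "compact (cball \<eta>s r)" by simp
  moreover have "\<forall>n. \<eta> (real n) \<in> cball \<eta>s r"
    using trapped by (auto simp: dist_norm norm_minus_commute intro: less_imp_le)
  ultimately obtain z \<phi> where z: "z \<in> cball \<eta>s r" and \<phi>: "strict_mono \<phi>"
    and lim: "((\<lambda>n. \<eta> (real n)) \<circ> \<phi>) \<longlonglongrightarrow> z"
    unfolding compact_def by metis
  define q where "q = (\<lambda>n. real (\<phi> n))"
  have lim: "(\<lambda>n. \<eta> (q n)) \<longlonglongrightarrow> z" using lim by (simp add: o_def q_def)
  have q: "filterlim q at_top sequentially"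
    unfolding q_def by (intro filterlim_compose[OF filterlim_real_sequentially] filterlim_subseq \<phi>)
  have lim_nth: "(\<lambda>n. \<eta> (q n) $ l) \<longlonglongrightarrow> z $ l" for l using lim by (rule tendsto_vec_nth)
  have zr: "norm (z - \<eta>s) \<le> r" using z by (simp add: dist_norm norm_minus_commute)
  have zoff: "z $ l = \<eta>s $ l" if "l \<notin> lines" for l
  proof -
    have "(\<lambda>n. \<eta> (q n) $ l) = (\<lambda>n. \<eta>s $ l)" using off_lines[OF _ that] by (simp add: q_def)
    then show ?thesis using lim_nth[of l] LIMSEQ_unique tendsto_const by metis
  qed
  have zflow: "inflow z j = inflow \<eta>s j" for j
  proof -
    have "(\<lambda>n. inflow (\<eta> (q n)) j) \<longlonglongrightarrow> inflow z j"
      unfolding line_inflow_def by (intro tendsto_intros lim_nth)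
    moreover have "(\<lambda>n. inflow (\<eta> (q n)) j) \<longlonglongrightarrow> inflow \<eta>s j"
      by (rule filterlim_compose[OF flow q])
    ultimately show ?thesis by (rule LIMSEQ_unique)
  qed
  have anti: "energy z t \<le> energy z s" if "0 \<le> s" "s \<le> t" for s t
    using energy_antimono[OF zflow that] .
  have nonneg: "0 \<le> energy z t" if "0 \<le> t" for t using energy_nonneg(2)[OF that zr zoff] .
  obtain e where e: "(energy z \<longlongrightarrow> e) at_top"
    by (rule nonincreasing_convergent[OF anti nonneg])
  have kin: "(kinetic \<longlongrightarrow> (\<Sum>j\<in>UNIV. M j * (w j)\<^sup>2) / 2) at_top"
    unfolding kinetic_def by (intro tendsto_intros w) simp_all
  have "((\<lambda>t. (\<Sum>g\<in>G. \<tau> g / Q g * (p t g)\<^sup>2) / 2) \<longlongrightarrow> (\<Sum>g\<in>G. \<tau> g / Q g * 0\<^sup>2) / 2) at_top"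
    by (intro tendsto_intros p_tendsto) simp_all
  then have gen: "(gen_energy \<longlongrightarrow> 0) at_top" by (simp add: gen_energy_def[abs_def])
  \<comment> \<open>The kinetic limit is kept because some \<open>w j\<close> may be nonzero. As
    kinetic and generation energy converge, so does the line energy centred at \<open>z\<close>; its
    limit must be 0, the value obtained along the subsequence.\<close>
  define u where "u = e - (\<Sum>j\<in>UNIV. M j * (w j)\<^sup>2) / 2 - 0"
  have U: "((\<lambda>t. line_energy lines B z (\<eta> t)) \<longlongrightarrow> u) at_top"
    using tendsto_diff[OF tendsto_diff[OF e kin] gen] by (simp add: energy_def u_def)
  have "(\<lambda>n. line_energy lines B z (\<eta> (q n))) \<longlonglongrightarrow> line_energy lines B z z"
    unfolding line_energy_def by (intro tendsto_intros lim_nth)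
  then have "line_energy lines B z z = u"
    using filterlim_compose[OF U q] LIMSEQ_unique by blast
  then have "u = 0" by (simp add: line_energy_def)
  have "((\<lambda>t. norm (\<eta> t - z)) \<longlongrightarrow> 0) at_top"
  proof (rule tendsto_0_if_square_le[where k = "inverse k"])
    show "((\<lambda>t. line_energy lines B z (\<eta> t)) \<longlongrightarrow> 0) at_top" using U \<open>u = 0\<close> by simp
    show "(norm (\<eta> t - z))\<^sup>2 \<le> inverse k * line_energy lines B z (\<eta> t)" if "0 \<le> t" for t
    proof -
      have "k * (norm (\<eta> t - z))\<^sup>2 \<le> line_energy lines B z (\<eta> t)"
        using trapped[OF that] zr zoff off_lines[OF that] by (intro line_energy_ge) auto
      then show ?thesis using k_pos by (simp add: field_simps)
    qed
  qed
  then have "(\<eta> \<longlongrightarrow> z) at_top" by (simp add: tendsto_norm_zero_iff LIM_zero_iff)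
  from that[OF this zoff zflow w w0 flow] show ?thesis .
qed

text \<open>An antiderivative is the signed sum of the line angles along a path from
  \<open>i\<close> to \<open>j\<close>; it converges with the angles.\<close>

lemma frequency_difference_integral:
  "\<exists>F l. (\<forall>t\<ge>0. (F has_real_derivative \<omega> t i - \<omega> t j) (at t within {0..})) \<and> (F \<longlongrightarrow> l) at_top"
proof -
  obtain z where z: "(\<eta> \<longlongrightarrow> z) at_top" by (rule converges)
  from connected[of i j] show ?thesis
  proof induction
    case base
    then show ?case by (intro exI[of _ "\<lambda>_. 0"] exI[of _ 0]) auto
  next
    case (step j m)
    then obtain F l where F: "\<And>t. 0 \<le> t \<Longrightarrow> (F has_real_derivative \<omega> t i - \<omega> t j) (at t within {0..})"
      "(F \<longlongrightarrow> l) at_top" by blast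
    have "\<exists>H h. (\<forall>t\<ge>0. (H has_real_derivative \<omega> t j - \<omega> t m) (at t within {0..})) \<and> (H \<longlongrightarrow> h) at_top"
    proof (cases "(j, m) \<in> lines")
      case True
      then show ?thesis using D\<eta>[of _ j m] tendsto_vec_nth[OF z, of "(j, m)"] by blast
    next
      case False
      then have "(m, j) \<in> lines" using step.hyps by simp
      then show ?thesis
        using DERIV_minus[OF D\<eta>[of _ m j]] tendsto_minus[OF tendsto_vec_nth[OF z, of "(m, j)"]]
        by (intro exI[of _ "\<lambda>t. - \<eta> t $ (m, j)"] exI[of _ "- (z $ (m, j))"]) auto
    qed
    then obtain H h where H: "\<And>t. 0 \<le> t \<Longrightarrow> (H has_real_derivative \<omega> t j - \<omega> t m) (at t within {0..})"
      "(H \<longlongrightarrow> h) at_top" by blast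
    show ?case
      using DERIV_add[OF F(1) H(1)] tendsto_add[OF F(2) H(2)]
      by (intro exI[of _ "\<lambda>t. F t + H t"] exI[of _ "l + h"]) auto
  qed
qed

text \<open>
  No decay rate of the frequencies is available, but their integrals converge: the differences
  \<open>\<omega> t i - \<omega> t j\<close> integrate to combinations of angles, and summing all equations writes a positive
  combination of the \<open>\<omega> t j\<close> as a derivative.
\<close>

lemma frequency_integral_convergent:
  assumes d: "\<And>j. 0 < d j"
    and D: "\<And>t. 0 \<le> t \<Longrightarrow> (\<theta> has_real_derivative (\<Sum>j\<in>UNIV. \<alpha> j * \<omega> t j)) (at t within {0..})"
  obtains l where "(\<theta> \<longlongrightarrow> l) at_top"
proof -
  obtain F l where F: "\<And>j t. 0 \<le> t \<Longrightarrow> (F j has_real_derivative \<omega> t j - \<omega> t b) (at t within {0..})"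
    and Fl: "\<And>j. (F j \<longlongrightarrow> l j) at_top"
    using frequency_difference_integral[of _ b] by metis
  \<comment> \<open>The coefficient of \<open>\<omega> t j\<close> left when all swing and generator
    equations are added: line flows and generation cancel, and each generator contributes its
    gain.\<close>
  define e where "e = (\<lambda>j. d j + (\<Sum>g | g \<in> G \<and> bus g = j. Q g))"
  define E where "E = (\<Sum>j\<in>UNIV. e j)"
  define A where "A = (\<Sum>j\<in>UNIV. \<alpha> j)"
  define X where "X = (\<lambda>t. (\<Sum>j\<in>UNIV. M j * \<omega> t j) + (\<Sum>g\<in>G. \<tau> g * p t g))"
  have "0 < e j" for j
    unfolding e_def using d Q_pos by (intro add_pos_nonneg sum_nonneg) (auto intro: less_imp_le)
  then have E: "0 < E" unfolding E_def by (intro sum_pos) auto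
  have DX: "(X has_real_derivative - (\<Sum>j\<in>UNIV. e j * \<omega> t j)) (at t within {0..})" if t: "0 \<le> t" for t
  proof -
    have "(X has_real_derivative (\<Sum>j\<in>UNIV. swing t j) + (\<Sum>g\<in>G. - p t g - Q g * \<omega> t (bus g)))
        (at t within {0..})"
      unfolding X_def by (intro DERIV_add DERIV_sum D\<omega>' Dp t)
    moreover have "(\<Sum>j\<in>UNIV. inflow y j) = 0" for y
      using sum_mult_line_inflow[of "\<lambda>_. 1" lines B y] by simp
    then have "(\<Sum>j\<in>UNIV. swing t j) = - (\<Sum>j\<in>UNIV. d j * \<omega> t j) + (\<Sum>g\<in>G. p t g)"
      by (simp add: swing_def sum.distrib sum_subtractf sum_negf sum_gens_by_bus)
    moreover have "(\<Sum>g\<in>G. Q g * \<omega> t (bus g)) = (\<Sum>j\<in>UNIV. (\<Sum>g | g \<in> G \<and> bus g = j. Q g) * \<omega> t j)"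
      by (subst sum_gens_by_bus[symmetric]) (auto simp: sum_distrib_right intro!: sum.cong)
    ultimately show ?thesis
      by (simp add: e_def distrib_right sum.distrib sum_subtractf sum_negf)
  qed
  \<comment> \<open>The part of \<open>\<alpha>\<close> proportional to \<open>e\<close> is
    integrated by \<open>X\<close>. The remaining coefficients
    \<open>E * \<alpha> j - A * e j\<close> sum to zero, so they see only differences to the
    reference bus \<open>b\<close>, which the \<open>F j\<close> integrate. Hence \<open>H\<close>
    is a conserved quantity.\<close>
  define H where "H = (\<lambda>t. E * \<theta> t + A * X t - (\<Sum>j\<in>UNIV. (E * \<alpha> j - A * e j) * F j t))"
  have DH: "(H has_real_derivative 0) (at t within {0..})" if t: "0 \<le> t" for t
  proof -
    have "(H has_real_derivative E * (\<Sum>j\<in>UNIV. \<alpha> j * \<omega> t j) + A * - (\<Sum>j\<in>UNIV. e j * \<omega> t j)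
        - (\<Sum>j\<in>UNIV. (E * \<alpha> j - A * e j) * (\<omega> t j - \<omega> t b))) (at t within {0..})"
      unfolding H_def by (intro DERIV_diff DERIV_add DERIV_cmult DERIV_sum D DX F t)
    moreover have "(\<Sum>j\<in>UNIV. (E * \<alpha> j - A * e j) * (\<omega> t j - \<omega> t b)) =
        (\<Sum>j\<in>UNIV. E * (\<alpha> j * \<omega> t j) - A * (e j * \<omega> t j))
        - (\<Sum>j\<in>UNIV. E * \<alpha> j - A * e j) * \<omega> t b"
      by (simp only: right_diff_distrib left_diff_distrib sum_subtractf sum_distrib_right mult.assoc)
    moreover have "(\<Sum>j\<in>UNIV. E * \<alpha> j - A * e j) = 0"
      by (simp add: sum_subtractf sum_distrib_left[symmetric] E_def[symmetric] A_def[symmetric])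
    ultimately show ?thesis by (simp add: sum_subtractf sum_distrib_left[symmetric])
  qed
  have H: "H t = H 0" if "0 \<le> t" for t by (rule constant_halfline[OF DH that])
  have w: "((\<lambda>t. \<omega> t j) \<longlongrightarrow> 0) at_top" for j by (rule \<omega>_tendsto_damped[OF d])
  have X: "((\<lambda>t. X t) \<longlongrightarrow> (\<Sum>j\<in>UNIV. M j * 0) + (\<Sum>g\<in>G. \<tau> g * 0)) at_top"
    unfolding X_def by (intro tendsto_intros w p_tendsto)
  have "((\<lambda>t. (H 0 - A * X t + (\<Sum>j\<in>UNIV. (E * \<alpha> j - A * e j) * F j t)) / E) \<longlongrightarrow>
      (H 0 - A * ((\<Sum>j\<in>UNIV. M j * 0) + (\<Sum>g\<in>G. \<tau> g * 0)) + (\<Sum>j\<in>UNIV. (E * \<alpha> j - A * e j) * l j)) / E) at_top"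
    using E by (intro tendsto_intros X Fl) auto
  moreover have "\<forall>\<^sub>F t in at_top. (H 0 - A * X t + (\<Sum>j\<in>UNIV. (E * \<alpha> j - A * e j) * F j t)) / E = \<theta> t"
    using eventually_ge_at_top[of 0]
  proof eventually_elim
    case (elim t)
    then show ?case using H[OF elim] E by (simp add: H_def field_simps)
  qed
  ultimately show ?thesis using that Lim_transform_eventually by blast
qed

end

section \<open>The combined network\<close>

text \<open>\<open>c\<close> lies halfway between the largest angle and \<open>pi / 2\<close>, and
  \<open>r\<close> is the room up to \<open>c\<close>. The elements 0 and 1 inserted into the sets
  also cover a network without lines.\<close>

lemma exists_trapping_constants:
  fixes z :: "real ^ 'l" and L :: "'l::finite set"
  assumes z: "\<And>l. l \<in> L \<Longrightarrow> \<bar>z $ l\<bar> < pi / 2" and B: "\<And>l. l \<in> L \<Longrightarrow> 0 < B l"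
  obtains c r k :: real where "0 \<le> c" "c < pi / 2" "0 < r" "0 < k"
    "\<And>l. l \<in> L \<Longrightarrow> \<bar>z $ l\<bar> + r \<le> c" "\<And>l. l \<in> L \<Longrightarrow> k \<le> B l * cos c / 2"
proof -
  define a where "a = Max (insert 0 ((\<lambda>l. \<bar>z $ l\<bar>) ` L))"
  define c where "c = (a + pi / 2) / 2"
  define k where "k = Min (insert 1 ((\<lambda>l. B l * cos c / 2) ` L))"
  have a: "0 \<le> a" "\<And>l. l \<in> L \<Longrightarrow> \<bar>z $ l\<bar> \<le> a" by (auto simp: a_def)
  have a_less: "a < pi / 2" unfolding a_def by (subst Max_less_iff) (use z in auto)
  have c: "0 \<le> c" "c < pi / 2" "a < c" using a(1) a_less by (auto simp: c_def)
  have "0 < cos c" using c by (intro cos_gt_zero_pi) auto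
  then have "0 < k" using B by (auto simp: k_def)
  moreover have "k \<le> B l * cos c / 2" if "l \<in> L" for l
    unfolding k_def by (intro Min_le) (use that in auto)
  moreover have "\<bar>z $ l\<bar> + (c - a) \<le> c" if "l \<in> L" for l using a(2)[OF that] by simp
  ultimately show ?thesis using that[of c "c - a" k] c by simp
qed

section \<open>Equilibria and heat balance of the model\<close>

lemma state_components:
  "angle x = fst x" "freq x = fst (snd x)" "pgen x = fst (snd (snd x))"
  "temp x = fst (snd (snd (snd x)))" "hgen x = snd (snd (snd (snd x)))"
  by (simp_all add: angle_def freq_def pgen_def temp_def hgen_def case_prod_unfold)

lemma state_space_zero:
  assumes "x \<in> state_space P"
  shows "l \<notin> lines P \<Longrightarrow> angle x $ l = 0" "j \<notin> gens P \<Longrightarrow> pgen x $ j = 0"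
    "e \<notin> hgens P \<Longrightarrow> hgen x $ e = 0"
  using assms unfolding state_space_def by blast+

lemma net_inflow_eq: "net_inflow P x j = line_inflow (lines P) (suscept P) (angle x) j"
  by (simp add: net_inflow_def line_inflow_def transfer_def)

lemma heat_input_cong:
  "hgen x = hgen y \<Longrightarrow> (\<And>j. pump_power P \<mu> x j = pump_power P \<mu> y j) \<Longrightarrow>
   heat_input P \<mu> x = heat_input P \<mu> y"
  by (auto simp: heat_input_def pump_heat_def vec_eq_iff split: sum.splits)

lemma one_inner_heat_input:
  "1 \<bullet> heat_input P \<mu> x = (\<Sum>e\<in>UNIV. hgen x $ e) - (\<Sum>e\<in>UNIV. hload P $ e)
     + (\<Sum>j\<in>pump_buses P. pump_coeff P j * pump_power P \<mu> x j)"
proof -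
  have "1 \<bullet> heat_input P \<mu> x = (\<Sum>i\<in>UNIV <+> UNIV. heat_input P \<mu> x $ i)"
    by (simp add: inner_vec_def)
  also have "\<dots> = (\<Sum>e\<in>UNIV. hgen x $ e + pump_heat P \<mu> x $ e - hload P $ e)"
    by (subst sum.Plus) (simp_all add: heat_input_def)
  also have "(\<Sum>e\<in>UNIV. hgen x $ e + pump_heat P \<mu> x $ e - hload P $ e) =
      (\<Sum>e\<in>UNIV. hgen x $ e) + (\<Sum>e\<in>UNIV. pump_heat P \<mu> x $ e) - (\<Sum>e\<in>UNIV. hload P $ e)"
    by (simp add: sum.distrib sum_subtractf)
  also have "(\<Sum>e\<in>UNIV. pump_heat P \<mu> x $ e) = (\<Sum>j\<in>pump_buses P. pump_coeff P j * pump_power P \<mu> x j)"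
    by (simp add: pump_heat_def sum.group)
  finally show ?thesis by simp
qed

definition bus_balanced ::
  "('n::finite, 'e::finite, 'v::finite) chp_network \<Rightarrow> 'n pump_mode \<Rightarrow> ('n, 'e, 'v) chp_state \<Rightarrow> 'n \<Rightarrow> bool" where
  "bus_balanced P \<mu> x j \<longleftrightarrow> (case \<mu> of
      Mode1 a \<Rightarrow> swing_rhs P \<mu> x j = 0
    | Mode2 b m \<Rightarrow> if j = b then freq x $ b = m * avg_temp P x else swing_rhs P \<mu> x j = 0)"

lemma is_equilibrium_iff:
  "is_equilibrium P \<mu> x \<longleftrightarrow> x \<in> state_space P \<and>
     (\<forall>(i, j)\<in>lines P. freq x $ i = freq x $ j) \<and> (\<forall>j. bus_balanced P \<mu> x j) \<and>
     (\<forall>j\<in>gens P. pgen x $ j = - Q_e P j * freq x $ j) \<and>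
     A_h P *v temp x = heat_input P \<mu> x \<and>
     (\<forall>e\<in>hgens P. hgen x $ e = - Q_h P e * avg_temp P x)"
proof -
  have bus: "bus_eq P \<mu> (\<lambda>_. x) t j \<longleftrightarrow> bus_balanced P \<mu> x j" if "0 \<le> t" for t j
    by (cases \<mu>) (simp_all add: bus_balanced_def swing_eq_def deriv_const_halfline_iff that)
  have ex: "(\<forall>t\<ge>0::real. Z) \<longleftrightarrow> Z" for Z by (auto intro: exI[of _ 0])
  have "is_equilibrium P \<mu> x \<longleftrightarrow> (\<forall>t\<ge>0::real. x \<in> state_space P \<and>
     (\<forall>(i, j)\<in>lines P. freq x $ i = freq x $ j) \<and> (\<forall>j. bus_balanced P \<mu> x j) \<and>
     (\<forall>j\<in>gens P. pgen x $ j = - Q_e P j * freq x $ j) \<and>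
     A_h P *v temp x = heat_input P \<mu> x \<and>
     (\<forall>e\<in>hgens P. hgen x $ e = - Q_h P e * avg_temp P x))"
    unfolding is_equilibrium_def is_solution_def
    by (intro arg_cong[where f = All] ext imp_cong refl conj_cong)
      (auto simp: bus deriv_const_halfline_iff vector_deriv_const_halfline_iff algebra_simps neg_eq_iff_add_eq_0
        add_eq_0_iff)
  then show ?thesis unfolding ex .
qed

definition total_volume :: "('n::finite, 'e::finite, 'v::finite) chp_network \<Rightarrow> real" where
  "total_volume P = 1 \<bullet> (diag_mat (volume P) *v 1)"

lemma total_volume_pos: "valid_network P \<Longrightarrow> 0 < total_volume P"
  by (auto simp: total_volume_def one_inner_diag_mat valid_network_def intro!: sum_pos)

lemma avg_temp_add_const:
  assumes "valid_network P" "temp y = temp x + m *\<^sub>R 1"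
  shows "avg_temp P y = avg_temp P x + m"
  using total_volume_pos[OF assms(1)]
  by (simp add: avg_temp_def total_volume_def assms(2) matrix_vector_right_distrib
      matrix_vector_mult_scaleR inner_add_right add_divide_distrib)

text \<open>The circulating flow only redistributes heat, by \<open>1 v* A_h P = 0\<close>, so the
  average temperature sees nothing but the total input.\<close>

lemma D_avg_temp:
  assumes "valid_network P" "is_solution P \<mu> x" "0 \<le> t"
  shows "((\<lambda>s. avg_temp P (x s)) has_real_derivative (1 \<bullet> heat_input P \<mu> (x t)) / total_volume P)
    (at t within {0..})"
proof -
  have D: "((\<lambda>s. diag_mat (volume P) *v temp (x s)) has_vector_derivative
      - (A_h P *v temp (x t)) + heat_input P \<mu> (x t)) (at t within {0..})"
    using assms(2,3) by (auto simp: is_solution_def)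
  have "((\<lambda>s. 1 \<bullet> (diag_mat (volume P) *v temp (x s))) has_vector_derivative
      1 \<bullet> (- (A_h P *v temp (x t)) + heat_input P \<mu> (x t))) (at t within {0..})"
    by (rule bounded_linear.has_vector_derivative[OF bounded_linear_inner_right D])
  moreover have "1 \<bullet> (A_h P *v temp (x t)) = 0"
    using assms(1) dot_lmul_matrix[of 1 "A_h P" "temp (x t)"] by (simp add: valid_network_def)
  ultimately have "((\<lambda>s. 1 \<bullet> (diag_mat (volume P) *v temp (x s))) has_real_derivative
      1 \<bullet> heat_input P \<mu> (x t)) (at t within {0..})"
    by (simp add: inner_diff_right has_real_derivative_iff_has_vector_derivative)
  then show ?thesis unfolding avg_temp_def total_volume_def by (rule DERIV_cdivide)
qed

text \<open>The total heat input vanishes at an equilibrium; subtracting it removes the constant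
  heat loads.\<close>

lemma D_avg_temp_deviation:
  assumes "valid_network P" "is_solution P \<mu> x" "is_equilibrium P \<mu> xs" "0 \<le> t"
  shows "((\<lambda>s. avg_temp P (x s) - avg_temp P xs) has_real_derivative
    ((\<Sum>e\<in>hgens P. hgen (x t) $ e - hgen xs $ e) + (\<Sum>j\<in>pump_buses P. pump_coeff P j *
        (pump_power P \<mu> (x t) j - pump_power P \<mu> xs j))) / total_volume P) (at t within {0..})"
proof -
  have "1 \<bullet> heat_input P \<mu> xs = 0"
    using D_avg_temp[OF assms(1) assms(3)[unfolded is_equilibrium_def], of 0] total_volume_pos[OF assms(1)]
    by (simp add: deriv_const_halfline_iff)
  then have "1 \<bullet> heat_input P \<mu> (x t) = 1 \<bullet> heat_input P \<mu> (x t) - 1 \<bullet> heat_input P \<mu> xs" by simp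
  also have "\<dots> = (\<Sum>e\<in>UNIV. hgen (x t) $ e - hgen xs $ e) + (\<Sum>j\<in>pump_buses P. pump_coeff P j *
        (pump_power P \<mu> (x t) j - pump_power P \<mu> xs j))"
    by (simp add: one_inner_heat_input sum_subtractf right_diff_distrib)
  also have "(\<Sum>e\<in>UNIV. hgen (x t) $ e - hgen xs $ e) = (\<Sum>e\<in>hgens P. hgen (x t) $ e - hgen xs $ e)"
    using assms(2-4) by (intro sum.mono_neutral_right)
      (auto simp: is_equilibrium_iff is_solution_def state_space_def)
  finally show ?thesis
    using DERIV_diff[OF D_avg_temp[OF assms(1,2,4)] DERIV_const[of "avg_temp P xs"]] by simp
qed

lemma temp_converges:
  assumes P: "valid_network P" and x: "is_solution P \<mu> x" and xs: "is_equilibrium P \<mu> xs"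
    and u: "((\<lambda>t. heat_input P \<mu> (x t)) \<longlongrightarrow> heat_input P \<mu> xs) at_top"
    and m: "((\<lambda>t. avg_temp P (x t) - avg_temp P xs) \<longlongrightarrow> m) at_top"
  shows "((\<lambda>t. temp (x t)) \<longlongrightarrow> temp xs + m *\<^sub>R 1) at_top"
proof (rule heat_relaxation)
  show "((\<lambda>s. diag_mat (volume P) *v temp (x s)) has_vector_derivative
      - (A_h P *v temp (x t)) + heat_input P \<mu> (x t)) (at t within {0..})" if "0 \<le> t" for t
    using x that by (auto simp: is_solution_def)
  show "((\<lambda>t. heat_input P \<mu> (x t)) \<longlongrightarrow> A_h P *v temp xs) at_top"
    using u xs by (simp add: is_equilibrium_iff)
  show "((\<lambda>t. (1 \<bullet> (diag_mat (volume P) *v temp (x t))) / (1 \<bullet> (diag_mat (volume P) *v 1)) -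
      (1 \<bullet> (diag_mat (volume P) *v temp xs)) / (1 \<bullet> (diag_mat (volume P) *v 1))) \<longlongrightarrow> m) at_top"
    using m by (simp add: avg_temp_def)
qed (use P in \<open>auto simp: valid_network_def\<close>)

lemma heat_input_tendsto:
  assumes "\<And>e. ((\<lambda>t. hgen (x t) $ e) \<longlongrightarrow> hgen y $ e) F"
    and "\<And>j. j \<in> pump_buses P \<Longrightarrow> ((\<lambda>t. pump_power P \<mu> (x t) j) \<longlongrightarrow> pump_power P \<mu> y j) F"
  shows "((\<lambda>t. heat_input P \<mu> (x t)) \<longlongrightarrow> heat_input P \<mu> y) F"
proof (rule vec_tendstoI)
  fix i
  have h: "((\<lambda>t. pump_heat P \<mu> (x t) $ e) \<longlongrightarrow> pump_heat P \<mu> y $ e) F" for e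
    unfolding pump_heat_def vec_lambda_beta by (intro tendsto_sum tendsto_mult tendsto_const assms) auto
  show "((\<lambda>t. heat_input P \<mu> (x t) $ i) \<longlongrightarrow> heat_input P \<mu> y $ i) F"
    by (cases i) (auto simp: heat_input_def intro!: tendsto_add tendsto_diff tendsto_const assms(1) h)
qed

lemma state_tendsto:
  assumes "((\<lambda>t. angle (x t)) \<longlongrightarrow> \<eta>) F" "\<And>j. ((\<lambda>t. freq (x t) $ j) \<longlongrightarrow> \<omega> $ j) F"
    "\<And>j. ((\<lambda>t. pgen (x t) $ j) \<longlongrightarrow> pG $ j) F" "((\<lambda>t. temp (x t)) \<longlongrightarrow> T) F"
    "\<And>e. ((\<lambda>t. hgen (x t) $ e) \<longlongrightarrow> hG $ e) F"
  shows "(x \<longlongrightarrow> (\<eta>, \<omega>, pG, T, hG)) F"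
proof -
  have "((\<lambda>t. (angle (x t), freq (x t), pgen (x t), temp (x t), hgen (x t))) \<longlongrightarrow> (\<eta>, \<omega>, pG, T, hG)) F"
    by (intro tendsto_Pair assms vec_tendstoI)
  then show ?thesis by (simp add: state_components)
qed

lemma continuous_components:
  "continuous_on UNIV (\<lambda>x. angle x $ l)" "continuous_on UNIV (\<lambda>x. freq x $ j)"
  "continuous_on UNIV (\<lambda>x. pgen x $ j)" "continuous_on UNIV (\<lambda>x. hgen x $ e)"
  "continuous_on UNIV angle"
  unfolding state_components[abs_def] by (intro continuous_intros)+

text \<open>In Mode 1 the pump consumption is merely extra damping, so the electric part evolves
  without feedback from the heating network and every bus is damped. The heating network is then
  treated as driven by convergent frequencies.\<close>

lemma mode1_converges:
  fixes P :: "('n::finite, 'e::finite, 'v::finite) chp_network"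
  assumes P: "valid_network P" and mode: "valid_mode P (Mode1 a)"
    and xs: "is_equilibrium P (Mode1 a) xs"
    and ang: "\<And>l. l \<in> lines P \<Longrightarrow> \<bar>angle xs $ l\<bar> < pi / 2"
  shows "\<exists>U. open U \<and> xs \<in> U \<and> (\<forall>x. is_solution P (Mode1 a) x \<and> x 0 \<in> U \<longrightarrow>
      (\<exists>x_eq. is_equilibrium P (Mode1 a) x_eq \<and> (x \<longlongrightarrow> x_eq) at_top))"
proof -
  let ?\<mu> = "Mode1 a"
  have B: "0 < suscept P l" if "l \<in> lines P" for l using P that by (simp add: valid_network_def)
  obtain c r k where c: "0 \<le> c" "c < pi / 2" and r: "0 < r" and k: "0 < k"
    and cr: "\<And>l. l \<in> lines P \<Longrightarrow> \<bar>angle xs $ l\<bar> + r \<le> c"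
    and kB: "\<And>l. l \<in> lines P \<Longrightarrow> k \<le> suscept P l * cos c / 2"
    by (rule exists_trapping_constants[of "lines P" "angle xs" "suscept P", OF ang B]) (assumption | rule that)+
  \<comment> \<open>The energy of the swing network as a function of the state, so that
    \<open>U\<close> expresses exactly the two starting conditions of the locale as open
    conditions.\<close>
  define W where "W = (\<lambda>x :: ('n, 'e, 'v) chp_state.
    (\<Sum>j\<in>UNIV. inertia P j * (freq x $ j - freq xs $ j)\<^sup>2) / 2
      + line_energy (lines P) (suscept P) (angle xs) (angle x)
      + (\<Sum>j\<in>gens P. tau_e P j / Q_e P j * (pgen x $ j - pgen xs $ j)\<^sup>2) / 2)"
  define U where "U = {x. norm (angle x - angle xs) < r \<and> W x < k * r\<^sup>2}"
  have "continuous_on UNIV W"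
    unfolding W_def line_energy_def
    by (intro continuous_on_add continuous_on_divide continuous_on_sum continuous_on_mult continuous_on_power
        continuous_on_diff continuous_on_cos continuous_on_const continuous_components) simp_all
  then have "open U"
    unfolding U_def
    by (intro open_Collect_conj open_Collect_less continuous_on_norm continuous_on_diff continuous_on_const
        continuous_components)
  moreover have "xs \<in> U" using r k by (simp add: U_def W_def line_energy_def)
  moreover have "\<exists>x_eq. is_equilibrium P ?\<mu> x_eq \<and> (x \<longlongrightarrow> x_eq) at_top"
    if sol: "is_solution P ?\<mu> x" and x0: "x 0 \<in> U" for x
  proof -
    define d where "d = (\<lambda>j. damping P j + (if j \<in> pump_buses P then a j else 0))"
    define \<omega> where "\<omega> = (\<lambda>t j. freq (x t) $ j - freq xs $ j)"
    define p where "p = (\<lambda>t j. pgen (x t) $ j - pgen xs $ j)"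
    have d: "0 < d j" for j using mode by (auto simp: d_def intro!: add_pos_nonneg less_imp_le)
    have st: "x t \<in> state_space P" if "0 \<le> t" for t using sol that by (auto simp: is_solution_def)
    have st_xs: "xs \<in> state_space P" using xs by (simp add: is_equilibrium_iff)
    have bal: "swing_rhs P ?\<mu> xs j = 0" for j
      using xs by (auto simp: is_equilibrium_iff bus_balanced_def)
    have p0: "p t j = 0" if "0 \<le> t" "j \<notin> gens P" for t j
      using st[OF that(1)] st_xs that(2) by (simp add: p_def state_space_def)
    have rhs: "swing_rhs P ?\<mu> (x t) j = - d j * \<omega> t j + (\<Sum>g | g \<in> gens P \<and> g = j. p t g)
        + line_inflow (lines P) (suscept P) (angle (x t)) j
        - line_inflow (lines P) (suscept P) (angle xs) j" if t: "0 \<le> t" for t j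
    proof -
      have "(\<Sum>g | g \<in> gens P \<and> g = j. p t g) = p t j"
      proof (cases "j \<in> gens P")
        case True
        then have "{g. g \<in> gens P \<and> g = j} = {j}" by auto
        then show ?thesis by simp
      next
        case False
        then have "{g. g \<in> gens P \<and> g = j} = {}" by auto
        then show ?thesis using p0[OF t False] by (simp only: sum.empty)
      qed
      moreover have "swing_rhs P ?\<mu> (x t) j - swing_rhs P ?\<mu> xs j = - d j * \<omega> t j + p t j
          + line_inflow (lines P) (suscept P) (angle (x t)) j
          - line_inflow (lines P) (suscept P) (angle xs) j"
        by (cases "j \<in> pump_buses P")
          (simp_all add: swing_rhs_def d_def \<omega>_def p_def net_inflow_eq algebra_simps)
      ultimately show ?thesis using bal[of j] by linarith
    qed
    \<comment> \<open>No bus is undamped here, so any bus, even \<open>undefined\<close>, may stand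
      for \<open>b\<close>.\<close>
    interpret swing_network "lines P" "suscept P" "inertia P" d "gens P" "\<lambda>j. j" "tau_e P" "Q_e P"
      undefined c r k "angle xs" "\<lambda>t. angle (x t)" \<omega> p
    proof
      show "((\<lambda>s. inertia P j * \<omega> s j) has_real_derivative
        - d j * \<omega> t j + (\<Sum>g | g \<in> gens P \<and> g = j. p t g)
        + line_inflow (lines P) (suscept P) (angle (x t)) j
        - line_inflow (lines P) (suscept P) (angle xs) j) (at t within {0..})" if t: "0 \<le> t" for t j
      proof -
        have "((\<lambda>s. inertia P j * freq (x s) $ j) has_real_derivative swing_rhs P ?\<mu> (x t) j)
            (at t within {0..})"
          using sol t by (auto simp: is_solution_def swing_eq_def)
        from DERIV_diff[OF this DERIV_const[of "inertia P j * freq xs $ j"]] show ?thesis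
          by (simp add: rhs[OF t] \<omega>_def right_diff_distrib)
      qed
      show "((\<lambda>s. tau_e P g * p s g) has_real_derivative - p t g - Q_e P g * \<omega> t g) (at t within {0..})"
        if t: "0 \<le> t" and g: "g \<in> gens P" for t g
      proof -
        have "((\<lambda>s. tau_e P g * pgen (x s) $ g) has_real_derivative
            - pgen (x t) $ g - Q_e P g * freq (x t) $ g) (at t within {0..})"
          using sol t g by (auto simp: is_solution_def)
        from DERIV_diff[OF this DERIV_const[of "tau_e P g * pgen xs $ g"]] show ?thesis
          using xs g by (simp add: p_def \<omega>_def right_diff_distrib distrib_left is_equilibrium_iff)
      qed
      show "((\<lambda>s. angle (x s) $ (i, j)) has_real_derivative \<omega> t i - \<omega> t j) (at t within {0..})"
        if "0 \<le> t" "(i, j) \<in> lines P" for t i j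
        using sol that xs by (fastforce simp: is_solution_def \<omega>_def is_equilibrium_iff)
      show "angle (x t) $ l = angle xs $ l" if "0 \<le> t" "l \<notin> lines P" for t l
        using state_space_zero(1)[OF st[OF that(1)] that(2)] state_space_zero(1)[OF st_xs that(2)] by simp
      show "norm (angle (x 0) - angle xs) < r" using x0 by (simp add: U_def)
      show "(\<Sum>j\<in>UNIV. inertia P j * (\<omega> 0 j)\<^sup>2) / 2
          + line_energy (lines P) (suscept P) (angle xs) (angle (x 0))
          + (\<Sum>g\<in>gens P. tau_e P g / Q_e P g * (p 0 g)\<^sup>2) / 2 < k * r\<^sup>2"
        using x0 by (simp add: U_def W_def \<omega>_def p_def)
      show "0 \<le> inertia P j" for j using P by (cases "j \<in> gens P") (auto simp: valid_network_def less_imp_le)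
      show "(i, j) \<in> (lines P \<union> (lines P)\<inverse>)\<^sup>*" for i j using P by (simp add: valid_network_def)
      show "0 \<le> d j" for j using d[of j] by simp
    qed (use P d c r k cr kB in \<open>auto simp: valid_network_def\<close>)
    obtain z w where z: "((\<lambda>t. angle (x t)) \<longlongrightarrow> z) at_top"
      and z0: "\<And>l. l \<notin> lines P \<Longrightarrow> z $ l = angle xs $ l"
      and zflow: "\<And>j. inflow z j = inflow (angle xs) j"
      by (rule converges) (assumption | rule that)+
    have \<omega>: "((\<lambda>t. \<omega> t j) \<longlongrightarrow> 0) at_top" for j by (rule \<omega>_tendsto_damped[OF d])
    have freq: "((\<lambda>t. freq (x t) $ j) \<longlongrightarrow> freq xs $ j) at_top" for j
      using \<omega>[of j] unfolding \<omega>_def by (rule LIM_zero_cancel)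
    have p: "((\<lambda>t. p t j) \<longlongrightarrow> 0) at_top" for j
    proof (cases "j \<in> gens P")
      case False
      have "\<forall>\<^sub>F t in at_top. p t j = 0"
        using eventually_ge_at_top[of 0] by eventually_elim (rule p0[OF _ False])
      then show ?thesis by (rule tendsto_eventually)
    qed (rule p_tendsto)
    have pgen: "((\<lambda>t. pgen (x t) $ j) \<longlongrightarrow> pgen xs $ j) at_top" for j
      using p[of j] unfolding p_def by (rule LIM_zero_cancel)
    define \<theta> where "\<theta> = (\<lambda>t. avg_temp P (x t) - avg_temp P xs)"
    define g where "g = (\<lambda>t e. hgen (x t) $ e - hgen xs $ e)"
    define v where "v = (\<lambda>t. \<Sum>j\<in>pump_buses P. pump_coeff P j * (a j * \<omega> t j))"
    have D\<theta>: "(\<theta> has_real_derivative ((\<Sum>e\<in>hgens P. g t e) + v t) / total_volume P) (at t within {0..})"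
      if "0 \<le> t" for t
    proof -
      have "(\<Sum>j\<in>pump_buses P. pump_coeff P j * (pump_power P ?\<mu> (x t) j - pump_power P ?\<mu> xs j)) = v t"
        unfolding v_def by (intro sum.cong refl) (simp add: \<omega>_def right_diff_distrib)
      then show ?thesis
        using D_avg_temp_deviation[OF P sol xs that] by (simp add: \<theta>_def g_def)
    qed
    have g0: "g t e = 0" if "0 \<le> t" "e \<notin> hgens P" for t e
      using st[OF that(1)] st_xs that(2) by (simp add: g_def state_space_def)
    \<comment> \<open>Heat sources react to the average temperature and bring it back to its
      equilibrium value. Without them any constant shift of the temperatures is again an
      equilibrium, and only convergence can be claimed.\<close>
    have "\<exists>m. (\<theta> \<longlongrightarrow> m) at_top \<and> (m = 0 \<or> hgens P = {}) \<and> (\<forall>e\<in>hgens P. ((\<lambda>t. g t e) \<longlongrightarrow> 0) at_top)"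
    proof (cases "hgens P = {}")
      case True
      have "(\<theta> has_real_derivative
          (\<Sum>j\<in>UNIV. (if j \<in> pump_buses P then pump_coeff P j * a j / total_volume P else 0) * \<omega> t j))
          (at t within {0..})" if "0 \<le> t" for t
      proof -
        have "(\<Sum>j\<in>UNIV. (if j \<in> pump_buses P then pump_coeff P j * a j / total_volume P else 0) * \<omega> t j)
            = (\<Sum>j\<in>UNIV. if j \<in> pump_buses P then pump_coeff P j * a j / total_volume P * \<omega> t j else 0)"
          by (intro sum.cong) auto
        also have "\<dots> = v t / total_volume P"
          by (simp add: sum.If_cases v_def sum_divide_distrib mult.assoc)
        finally show ?thesis using D\<theta>[OF that] True by simp
      qed
      then obtain m where "(\<theta> \<longlongrightarrow> m) at_top" by (rule frequency_integral_convergent[OF d])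
      with True show ?thesis by auto
    next
      case False
      then obtain e0 where e0: "e0 \<in> hgens P" by blast
      have Dg: "((\<lambda>r. tau_h P e * g r e) has_real_derivative - g t e - Q_h P e * \<theta> t) (at t within {0..})"
        if t: "0 \<le> t" and e: "e \<in> hgens P" for t e
      proof -
        have "((\<lambda>s. tau_h P e * hgen (x s) $ e) has_real_derivative
            - hgen (x t) $ e - Q_h P e * avg_temp P (x t)) (at t within {0..})"
          using sol t e by (auto simp: is_solution_def)
        from DERIV_diff[OF this DERIV_const[of "tau_h P e * hgen xs $ e"]] show ?thesis
          using xs e by (simp add: g_def \<theta>_def right_diff_distrib distrib_left is_equilibrium_iff)
      qed
      have v: "(v \<longlongrightarrow> 0) at_top"
        unfolding v_def by (intro tendsto_null_sum tendsto_mult_right_zero \<omega>)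
      have pos: "0 < tau_h P e" "0 < Q_h P e" if "e \<in> hgens P" for e
        using P that by (auto simp: valid_network_def)
      have "(\<theta> \<longlongrightarrow> 0) at_top" "\<forall>e\<in>hgens P. ((\<lambda>t. g t e) \<longlongrightarrow> 0) at_top"
        using driven_integral_control[OF finite e0 total_volume_pos[OF P] pos D\<theta> Dg v] by auto
      then show ?thesis by blast
    qed
    then obtain m where m: "(\<theta> \<longlongrightarrow> m) at_top" "m = 0 \<or> hgens P = {}"
      and g: "\<And>e. e \<in> hgens P \<Longrightarrow> ((\<lambda>t. g t e) \<longlongrightarrow> 0) at_top" by blast
    have hgen: "((\<lambda>t. hgen (x t) $ e) \<longlongrightarrow> hgen xs $ e) at_top" for e
    proof -
      have "((\<lambda>t. g t e) \<longlongrightarrow> 0) at_top"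
      proof (cases "e \<in> hgens P")
        case False
        have "\<forall>\<^sub>F t in at_top. g t e = 0"
          using eventually_ge_at_top[of 0] by eventually_elim (rule g0[OF _ False])
        then show ?thesis by (rule tendsto_eventually)
      qed (rule g)
      then show ?thesis unfolding g_def by (rule LIM_zero_cancel)
    qed
    have temp: "((\<lambda>t. temp (x t)) \<longlongrightarrow> temp xs + m *\<^sub>R 1) at_top"
    proof (rule temp_converges[OF P sol xs _ m(1)[unfolded \<theta>_def]])
      show "((\<lambda>t. heat_input P ?\<mu> (x t)) \<longlongrightarrow> heat_input P ?\<mu> xs) at_top"
        by (rule heat_input_tendsto[OF hgen]) (auto intro!: tendsto_mult_left freq)
    qed
    define y where "y = (z, freq xs, pgen xs, temp xs + m *\<^sub>R 1, hgen xs)"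
    have y: "angle y = z" "freq y = freq xs" "pgen y = pgen xs" "temp y = temp xs + m *\<^sub>R 1" "hgen y = hgen xs"
      by (simp_all add: y_def state_components)
    have "is_equilibrium P ?\<mu> y"
      unfolding is_equilibrium_iff
    proof (intro conjI)
      show "y \<in> state_space P"
        using state_space_zero[OF st_xs] z0 by (simp add: state_space_def y)
      show "\<forall>(i, j)\<in>lines P. freq y $ i = freq y $ j" using xs by (simp add: is_equilibrium_iff y)
      show "\<forall>j. bus_balanced P ?\<mu> y j"
      proof
        fix j
        have "swing_rhs P ?\<mu> y j = swing_rhs P ?\<mu> xs j"
          by (simp add: swing_rhs_def y net_inflow_eq zflow)
        then show "bus_balanced P ?\<mu> y j" using bal by (simp add: bus_balanced_def)
      qed
      show "\<forall>j\<in>gens P. pgen y $ j = - Q_e P j * freq y $ j" using xs by (simp add: is_equilibrium_iff y)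
      have "heat_input P ?\<mu> y = heat_input P ?\<mu> xs" by (rule heat_input_cong) (simp_all add: y)
      then show "A_h P *v temp y = heat_input P ?\<mu> y"
        using xs P by (simp add: is_equilibrium_iff y valid_network_def matrix_vector_right_distrib
            matrix_vector_mult_scaleR)
      show "\<forall>e\<in>hgens P. hgen y $ e = - Q_h P e * avg_temp P y"
        using xs m(2) avg_temp_add_const[OF P y(4)] by (auto simp: is_equilibrium_iff y)
    qed
    moreover have "(x \<longlongrightarrow> y) at_top"
      unfolding y_def by (intro state_tendsto z freq pgen temp hgen)
    ultimately show ?thesis by blast
  qed
  ultimately show ?thesis by blast
qed

text \<open>
  In Mode 2 the frequency of the heat pump bus is a multiple of the average temperature, so that the
  total heat balance is a swing equation for this bus, with inertia \<open>vol / (C * m)\<close>, without damping,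
  and with the heat sources, divided by \<open>C\<close>, as generators.
\<close>

lemma mode2_converges:
  fixes P :: "('n::finite, 'e::finite, 'v::finite) chp_network"
  assumes P: "valid_network P" and mode: "valid_mode P (Mode2 b m)"
    and xs: "is_equilibrium P (Mode2 b m) xs"
    and ang: "\<And>l. l \<in> lines P \<Longrightarrow> \<bar>angle xs $ l\<bar> < pi / 2"
  shows "\<exists>U. open U \<and> xs \<in> U \<and> (\<forall>x. is_solution P (Mode2 b m) x \<and> x 0 \<in> U \<longrightarrow>
      (\<exists>x_eq. is_equilibrium P (Mode2 b m) x_eq \<and> (x \<longlongrightarrow> x_eq) at_top))"
proof -
  let ?\<mu> = "Mode2 b m"
  have B: "0 < suscept P l" if "l \<in> lines P" for l using P that by (simp add: valid_network_def)
  have pumps: "pump_buses P = {b}" and b_gens: "b \<notin> gens P" and b_damping: "damping P b = 0"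
    and damping: "\<And>j. j \<noteq> b \<Longrightarrow> 0 < damping P j" and m: "0 < m"
    using mode by auto
  define C where "C = pump_coeff P b"
  have C: "0 < C" using P pumps by (simp add: valid_network_def C_def)
  define vol where "vol = total_volume P"
  have vol: "0 < vol" using total_volume_pos[OF P] by (simp add: vol_def)
  define M where "M = (\<lambda>j. if j = b then vol / (C * m) else inertia P j)"
  define G where "G = Inl ` gens P \<union> Inr ` hgens P"
  define bus where "bus = (\<lambda>g :: 'n + 'e. case g of Inl j \<Rightarrow> j | Inr e \<Rightarrow> b)"
  define \<tau> where "\<tau> = (\<lambda>g. case g of Inl j \<Rightarrow> tau_e P j | Inr e \<Rightarrow> tau_h P e)"
  \<comment> \<open>The factor \<open>1 / C\<close> comes from rescaling the heat sources, and
    \<open>1 / m\<close> from expressing the average temperature through the frequency at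
    \<open>b\<close>.\<close>
  define Q where "Q = (\<lambda>g. case g of Inl j \<Rightarrow> Q_e P j | Inr e \<Rightarrow> Q_h P e / (m * C))"
  define dev where "dev = (\<lambda>(x :: ('n, 'e, 'v) chp_state) g. case g of
    Inl j \<Rightarrow> pgen x $ j - pgen xs $ j | Inr e \<Rightarrow> (hgen x $ e - hgen xs $ e) / C)"
  obtain c r k where c: "0 \<le> c" "c < pi / 2" and r: "0 < r" and k: "0 < k"
    and cr: "\<And>l. l \<in> lines P \<Longrightarrow> \<bar>angle xs $ l\<bar> + r \<le> c"
    and kB: "\<And>l. l \<in> lines P \<Longrightarrow> k \<le> suscept P l * cos c / 2"
    by (rule exists_trapping_constants[of "lines P" "angle xs" "suscept P", OF ang B])
      (assumption | rule that)+
  define W where "W = (\<lambda>x :: ('n, 'e, 'v) chp_state.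
    (\<Sum>j\<in>UNIV. M j * (freq x $ j - freq xs $ j)\<^sup>2) / 2
      + line_energy (lines P) (suscept P) (angle xs) (angle x)
      + (\<Sum>g\<in>G. \<tau> g / Q g * (dev x g)\<^sup>2) / 2)"
  define U where "U = {x. norm (angle x - angle xs) < r \<and> W x < k * r\<^sup>2}"
  have "continuous_on UNIV (\<lambda>x. dev x g)" for g
    using C by (cases g) (auto simp: dev_def intro!: continuous_on_divide continuous_on_diff
        continuous_on_const continuous_components)
  then have "continuous_on UNIV W"
    unfolding W_def line_energy_def
    by (intro continuous_on_add continuous_on_divide continuous_on_sum continuous_on_mult continuous_on_power
        continuous_on_diff continuous_on_cos continuous_on_const continuous_components) simp_all
  then have "open U"
    unfolding U_def
    by (intro open_Collect_conj open_Collect_less continuous_on_norm continuous_on_diff continuous_on_const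
        continuous_components)
  moreover have "xs \<in> U"
  proof -
    have "dev xs g = 0" for g by (cases g) (simp_all add: dev_def)
    then show ?thesis using r k by (simp add: U_def W_def line_energy_def)
  qed
  moreover have "\<exists>x_eq. is_equilibrium P ?\<mu> x_eq \<and> (x \<longlongrightarrow> x_eq) at_top"
    if sol: "is_solution P ?\<mu> x" and x0: "x 0 \<in> U" for x
  proof -
    define \<omega> where "\<omega> = (\<lambda>t j. freq (x t) $ j - freq xs $ j)"
    define p where "p = (\<lambda>t. dev (x t))"
    define \<theta> where "\<theta> = (\<lambda>t. avg_temp P (x t) - avg_temp P xs)"
    have st: "x t \<in> state_space P" if "0 \<le> t" for t using sol that by (auto simp: is_solution_def)
    have st_xs: "xs \<in> state_space P" using xs by (simp add: is_equilibrium_iff)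
    have bus_xs: "bus_balanced P ?\<mu> xs j" for j using xs by (simp add: is_equilibrium_iff)
    have bal: "swing_rhs P ?\<mu> xs j = 0" if "j \<noteq> b" for j
      using bus_xs[of j] that by (simp add: bus_balanced_def)
    have bus_x: "bus_eq P ?\<mu> x t j" if "0 \<le> t" for t j using sol that by (simp add: is_solution_def)
    have \<omega>b: "\<omega> t b = m * \<theta> t" if "0 \<le> t" for t
      using bus_x[OF that, of b] bus_xs[of b] by (simp add: bus_balanced_def \<omega>_def \<theta>_def right_diff_distrib)
    have D_bus: "((\<lambda>s. M j * \<omega> s j) has_real_derivative
        - damping P j * \<omega> t j + (\<Sum>g | g \<in> G \<and> bus g = j. p t g)
        + line_inflow (lines P) (suscept P) (angle (x t)) j
        - line_inflow (lines P) (suscept P) (angle xs) j) (at t within {0..})" if t: "0 \<le> t" for t j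
    proof (cases "j = b")
      case True
      have "{g. g \<in> G \<and> bus g = b} = Inr ` hgens P"
        using b_gens by (auto simp: G_def bus_def)
      then have gens: "(\<Sum>g | g \<in> G \<and> bus g = b. p t g) = (\<Sum>e\<in>hgens P. hgen (x t) $ e - hgen xs $ e) / C"
        by (simp add: sum.reindex p_def dev_def sum_divide_distrib)
      have "((\<lambda>s. M b * (m * \<theta> s)) has_real_derivative M b * (m *
          (((\<Sum>e\<in>hgens P. hgen (x t) $ e - hgen xs $ e)
            + C * (net_inflow P (x t) b - net_inflow P xs b)) / vol))) (at t within {0..})"
        using D_avg_temp_deviation[OF P sol xs t]
        by (intro DERIV_cmult) (simp add: \<theta>_def pumps C_def vol_def)
      also have "M b * (m * (((\<Sum>e\<in>hgens P. hgen (x t) $ e - hgen xs $ e)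
            + C * (net_inflow P (x t) b - net_inflow P xs b)) / vol)) =
          (\<Sum>e\<in>hgens P. hgen (x t) $ e - hgen xs $ e) / C + (net_inflow P (x t) b - net_inflow P xs b)"
        using C m vol by (simp add: M_def field_simps)
      finally have "((\<lambda>s. M b * (m * \<theta> s)) has_real_derivative
          - damping P b * \<omega> t b + (\<Sum>g | g \<in> G \<and> bus g = b. p t g)
          + line_inflow (lines P) (suscept P) (angle (x t)) b
          - line_inflow (lines P) (suscept P) (angle xs) b) (at t within {0..})"
        unfolding gens by (simp add: b_damping net_inflow_eq add_diff_eq)
      then have "((\<lambda>s. M b * \<omega> s b) has_real_derivative
          - damping P b * \<omega> t b + (\<Sum>g | g \<in> G \<and> bus g = b. p t g)
          + line_inflow (lines P) (suscept P) (angle (x t)) b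
          - line_inflow (lines P) (suscept P) (angle xs) b) (at t within {0..})"
        unfolding has_field_derivative_def
        by (rule has_derivative_transform[rotated 2]) (use t \<omega>b in auto)
      with True show ?thesis by simp
    next
      case False
      have gens: "(\<Sum>g | g \<in> G \<and> bus g = j. p t g) = pgen (x t) $ j - pgen xs $ j"
      proof (cases "j \<in> gens P")
        case True
        then have "{g. g \<in> G \<and> bus g = j} = {Inl j}"
          using False by (auto simp: G_def bus_def)
        then show ?thesis by (simp add: p_def dev_def)
      next
        case not_gen: False
        then have "{g. g \<in> G \<and> bus g = j} = {}" using False by (auto simp: G_def bus_def)
        moreover have "pgen (x t) $ j - pgen xs $ j = 0"
          using state_space_zero(2)[OF st[OF t] not_gen] state_space_zero(2)[OF st_xs not_gen] by simp
        ultimately show ?thesis by (simp only: sum.empty)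
      qed
      have "((\<lambda>s. inertia P j * freq (x s) $ j) has_real_derivative swing_rhs P ?\<mu> (x t) j)
          (at t within {0..})"
        using bus_x[OF t, of j] False by (simp add: swing_eq_def)
      from DERIV_diff[OF this DERIV_const[of "inertia P j * freq xs $ j"]]
      have "((\<lambda>s. M j * \<omega> s j) has_real_derivative swing_rhs P ?\<mu> (x t) j) (at t within {0..})"
        using False by (simp add: \<omega>_def M_def right_diff_distrib)
      moreover have "swing_rhs P ?\<mu> (x t) j - swing_rhs P ?\<mu> xs j =
          - damping P j * \<omega> t j + (pgen (x t) $ j - pgen xs $ j)
          + line_inflow (lines P) (suscept P) (angle (x t)) j
          - line_inflow (lines P) (suscept P) (angle xs) j"
        using False by (simp add: swing_rhs_def \<omega>_def net_inflow_eq algebra_simps)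
      ultimately show ?thesis unfolding gens using bal[OF False] by simp
    qed
    have D_gen: "((\<lambda>s. \<tau> g * p s g) has_real_derivative - p t g - Q g * \<omega> t (bus g)) (at t within {0..})"
      if t: "0 \<le> t" and g: "g \<in> G" for t g
    proof (cases g)
      case (Inl j)
      then have j: "j \<in> gens P" using g by (auto simp: G_def)
      have "((\<lambda>s. tau_e P j * pgen (x s) $ j) has_real_derivative
          - pgen (x t) $ j - Q_e P j * freq (x t) $ j) (at t within {0..})"
        using sol t j by (auto simp: is_solution_def)
      from DERIV_diff[OF this DERIV_const[of "tau_e P j * pgen xs $ j"]] show ?thesis
        using xs j by (simp add: Inl p_def dev_def \<tau>_def Q_def bus_def \<omega>_def right_diff_distrib
            distrib_left is_equilibrium_iff)
    next
      case (Inr e)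
      then have e: "e \<in> hgens P" using g by (auto simp: G_def)
      have "((\<lambda>s. tau_h P e * hgen (x s) $ e) has_real_derivative
          - hgen (x t) $ e - Q_h P e * avg_temp P (x t)) (at t within {0..})"
        using sol t e by (auto simp: is_solution_def)
      from DERIV_cdivide[OF DERIV_diff[OF this DERIV_const[of "tau_h P e * hgen xs $ e"]], of C]
      have "((\<lambda>s. \<tau> g * p s g) has_real_derivative
          (- hgen (x t) $ e - Q_h P e * avg_temp P (x t)) / C) (at t within {0..})"
        by (simp add: Inr p_def dev_def \<tau>_def right_diff_distrib)
      moreover have "(- hgen (x t) $ e - Q_h P e * avg_temp P (x t)) / C = - p t g - Q g * \<omega> t (bus g)"
        using xs e m C by (simp add: Inr p_def dev_def Q_def bus_def \<omega>b[OF t] \<theta>_def is_equilibrium_iff field_simps)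
      ultimately show ?thesis by simp
    qed
    interpret swing_network "lines P" "suscept P" M "damping P" G bus \<tau> Q
      b c r k "angle xs" "\<lambda>t. angle (x t)" \<omega> p
    proof
      show "((\<lambda>s. angle (x s) $ (i, j)) has_real_derivative \<omega> t i - \<omega> t j) (at t within {0..})"
        if "0 \<le> t" "(i, j) \<in> lines P" for t i j
        using sol that xs by (fastforce simp: is_solution_def \<omega>_def is_equilibrium_iff)
      show "angle (x t) $ l = angle xs $ l" if "0 \<le> t" "l \<notin> lines P" for t l
        using state_space_zero(1)[OF st[OF that(1)] that(2)] state_space_zero(1)[OF st_xs that(2)] by simp
      show "norm (angle (x 0) - angle xs) < r" using x0 by (simp add: U_def)
      show "(\<Sum>j\<in>UNIV. M j * (\<omega> 0 j)\<^sup>2) / 2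
          + line_energy (lines P) (suscept P) (angle xs) (angle (x 0))
          + (\<Sum>g\<in>G. \<tau> g / Q g * (p 0 g)\<^sup>2) / 2 < k * r\<^sup>2"
        using x0 by (simp add: U_def W_def \<omega>_def p_def)
      show "0 \<le> M j" for j
        using P vol C m by (cases "j \<in> gens P") (auto simp: M_def valid_network_def less_imp_le)
      show "0 < M b \<or> 0 < damping P b" using vol C m by (simp add: M_def)
      show "(i, j) \<in> (lines P \<union> (lines P)\<inverse>)\<^sup>*" for i j using P by (simp add: valid_network_def)
      show "0 \<le> damping P j" for j using damping[of j] b_damping by (cases "j = b") auto
      show "finite G" by (simp add: G_def)
      show "0 < \<tau> g" "0 < Q g" if "g \<in> G" for g
        using that P m C by (auto simp: G_def \<tau>_def Q_def valid_network_def)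
    qed (use D_bus D_gen B damping c r k cr kB in auto)
    obtain z w where z: "((\<lambda>t. angle (x t)) \<longlongrightarrow> z) at_top"
      and z0: "\<And>l. l \<notin> lines P \<Longrightarrow> z $ l = angle xs $ l"
      and zflow: "\<And>j. inflow z j = inflow (angle xs) j"
      and w: "\<And>j. ((\<lambda>t. \<omega> t j) \<longlongrightarrow> w j) at_top"
      and w0: "\<And>j. w j = 0 \<or> damping P j = 0 \<and> UNIV = {j} \<and> (\<forall>g\<in>G. bus g \<noteq> j)"
      and flow: "\<And>j. ((\<lambda>t. inflow (angle (x t)) j) \<longlongrightarrow> inflow (angle xs) j) at_top"
      by (rule converges) (assumption | rule that)+
    have w_damped: "w j = 0" if "j \<noteq> b" for j using w0[of j] damping[OF that] by auto
    \<comment> \<open>Heat sources count as generators at \<open>b\<close>, which rules out the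
      exceptional case of \<open>converges\<close>. So the temperatures shift only if no source has
      to respond.\<close>
    have w_b: "w b = 0" if "hgens P \<noteq> {}"
    proof -
      from that obtain e where "e \<in> hgens P" by blast
      then have "Inr e \<in> G" "bus (Inr e) = b" by (auto simp: G_def bus_def)
      with w0[of b] show ?thesis by metis
    qed
    \<comment> \<open>A nonzero limit occurs only when there is a single bus, and then the line is a
      self-loop.\<close>
    have w_line: "w i = w j" if "(i, j) \<in> lines P" for i j
    proof (cases "w i = 0 \<and> w j = 0")
      case False
      then have "i = j" using w0[of i] w0[of j] by (metis UNIV_I singletonD)
      then show ?thesis by simp
    qed simp
    have freq: "((\<lambda>t. freq (x t) $ j) \<longlongrightarrow> (freq xs + (\<chi> j. w j)) $ j) at_top" for j
      using tendsto_add[OF w[of j] tendsto_const[of "freq xs $ j"]] by (simp add: \<omega>_def add.commute)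
    have pgen: "((\<lambda>t. pgen (x t) $ j) \<longlongrightarrow> pgen xs $ j) at_top" for j
    proof (cases "j \<in> gens P")
      case True
      then have "((\<lambda>t. p t (Inl j)) \<longlongrightarrow> 0) at_top" by (intro p_tendsto) (simp add: G_def)
      then have "((\<lambda>t. pgen (x t) $ j - pgen xs $ j) \<longlongrightarrow> 0) at_top" by (simp add: p_def dev_def)
      then show ?thesis by (rule LIM_zero_cancel)
    next
      case False
      have "\<forall>\<^sub>F t in at_top. pgen (x t) $ j = pgen xs $ j"
        using eventually_ge_at_top[of 0]
        by eventually_elim (simp add: state_space_zero(2)[OF st False] state_space_zero(2)[OF st_xs False])
      then show ?thesis by (rule tendsto_eventually)
    qed
    have hgen: "((\<lambda>t. hgen (x t) $ e) \<longlongrightarrow> hgen xs $ e) at_top" for e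
    proof (cases "e \<in> hgens P")
      case True
      then have "((\<lambda>t. p t (Inr e)) \<longlongrightarrow> 0) at_top" by (intro p_tendsto) (simp add: G_def)
      then have "((\<lambda>t. C * p t (Inr e)) \<longlongrightarrow> 0) at_top" by (rule tendsto_mult_right_zero)
      then have "((\<lambda>t. hgen (x t) $ e - hgen xs $ e) \<longlongrightarrow> 0) at_top"
        using C by (simp add: p_def dev_def)
      then show ?thesis by (rule LIM_zero_cancel)
    next
      case False
      have "\<forall>\<^sub>F t in at_top. hgen (x t) $ e = hgen xs $ e"
        using eventually_ge_at_top[of 0]
        by eventually_elim (simp add: state_space_zero(3)[OF st False] state_space_zero(3)[OF st_xs False])
      then show ?thesis by (rule tendsto_eventually)
    qed
    have \<theta>: "(\<theta> \<longlongrightarrow> w b / m) at_top"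
    proof (rule Lim_transform_eventually)
      show "((\<lambda>t. \<omega> t b / m) \<longlongrightarrow> w b / m) at_top" using m by (intro tendsto_divide w tendsto_const) simp
      show "\<forall>\<^sub>F t in at_top. \<omega> t b / m = \<theta> t"
        using eventually_ge_at_top[of 0] by eventually_elim (use m in \<open>simp add: \<omega>b\<close>)
    qed
    have temp: "((\<lambda>t. temp (x t)) \<longlongrightarrow> temp xs + (w b / m) *\<^sub>R 1) at_top"
    proof (rule temp_converges[OF P sol xs _ \<theta>[unfolded \<theta>_def]])
      show "((\<lambda>t. heat_input P ?\<mu> (x t)) \<longlongrightarrow> heat_input P ?\<mu> xs) at_top"
        using flow[of b] by (intro heat_input_tendsto hgen) (simp add: pumps net_inflow_eq)
    qed
    \<comment> \<open>The temperature shift \<open>w b / m\<close> matches the frequency shift at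
      \<open>b\<close>, preserving the Mode 2 relation there; as a constant profile it does not
      disturb the heat flow.\<close>
    define y where "y = (z, freq xs + (\<chi> j. w j), pgen xs, temp xs + (w b / m) *\<^sub>R 1, hgen xs)"
    have y: "angle y = z" "freq y = freq xs + (\<chi> j. w j)" "pgen y = pgen xs"
      "temp y = temp xs + (w b / m) *\<^sub>R 1" "hgen y = hgen xs"
      by (simp_all add: y_def state_components)
    have flow_y: "net_inflow P y j = net_inflow P xs j" for j by (simp add: net_inflow_eq y zflow)
    have avg_y: "avg_temp P y = avg_temp P xs + w b / m" by (rule avg_temp_add_const[OF P y(4)])
    have "is_equilibrium P ?\<mu> y"
      unfolding is_equilibrium_iff
    proof (intro conjI)
      show "y \<in> state_space P"
        using state_space_zero[OF st_xs] z0 by (simp add: state_space_def y)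
      show "\<forall>(i, j)\<in>lines P. freq y $ i = freq y $ j"
        using xs w_line by (fastforce simp: is_equilibrium_iff y)
      show "\<forall>j. bus_balanced P ?\<mu> y j"
      proof
        fix j
        show "bus_balanced P ?\<mu> y j"
        proof (cases "j = b")
          case True
          then show ?thesis using bus_xs[of b] m by (simp add: bus_balanced_def y(2) avg_y distrib_left)
        next
          case False
          then have "swing_rhs P ?\<mu> y j = swing_rhs P ?\<mu> xs j"
            by (simp add: swing_rhs_def flow_y y(2,3) w_damped)
          then show ?thesis using False bal by (simp add: bus_balanced_def)
        qed
      qed
      show "\<forall>j\<in>gens P. pgen y $ j = - Q_e P j * freq y $ j"
      proof
        fix j assume j: "j \<in> gens P"
        then have "w j = 0" using b_gens by (intro w_damped) auto
        then show "pgen y $ j = - Q_e P j * freq y $ j" using xs j by (simp add: is_equilibrium_iff y)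
      qed
      have "heat_input P ?\<mu> y = heat_input P ?\<mu> xs" by (rule heat_input_cong) (simp_all add: y flow_y)
      then show "A_h P *v temp y = heat_input P ?\<mu> y"
        using xs P by (simp add: is_equilibrium_iff y valid_network_def matrix_vector_right_distrib
            matrix_vector_mult_scaleR)
      show "\<forall>e\<in>hgens P. hgen y $ e = - Q_h P e * avg_temp P y"
        using xs w_b by (auto simp: is_equilibrium_iff y avg_y)
    qed
    moreover have "(x \<longlongrightarrow> y) at_top"
      unfolding y_def by (intro state_tendsto z freq pgen temp hgen)
    ultimately show ?thesis by blast
  qed
  ultimately show ?thesis by blast
qed

theorem theorem5:
  fixes P :: "('n::finite, 'e::finite, 'v::finite) chp_network"
    and \<mu> :: "'n pump_mode"
    and x_star :: "('n, 'e, 'v) chp_state"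
  assumes "valid_network P"
    and "valid_mode P \<mu>"
    and "is_equilibrium P \<mu> x_star"
    and "\<forall>(i, j)\<in>lines P. \<bar>angle x_star $ (i, j)\<bar> < pi / 2"
  shows "\<exists>U. open U \<and> x_star \<in> U \<and>
           (\<forall>x. is_solution P \<mu> x \<and> x 0 \<in> U \<longrightarrow>
             (\<exists>x_eq. is_equilibrium P \<mu> x_eq \<and> (x \<longlongrightarrow> x_eq) at_top))"
proof (cases \<mu>)
  case (Mode1 a)
  then show ?thesis using mode1_converges[of P a x_star] assms by auto
next
  case (Mode2 b m)
  then show ?thesis using mode2_converges[of P b m x_star] assms by auto
qed

end
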